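(* Let $p,\ell$ be integers with $1\le \ell<p$. For every $\varepsilon>0$ there exists $n_0$ such that for every $n\ge n_0$ there is a graph $G$ whose vertex set is the disjoint union $W\cup Z$ with $|W|=|Z|=n$, such that $\alpha_p(G)\le \varepsilon n$, $e(G[W])\le \varepsilon n^2$, $e(G[Z])\le\varepsilon n^2$, and $\left|e_G(W,Z)-\frac{\ell}{p}n^2\right|\le \varepsilon n^2$. If additionally $\ell\le p/2$, then $G$ can moreover be taken to be $K_{p+\ell+1}$-free, and consequently $$\varrho_p(p+\ell+1)\ge \frac{\ell}{2p}.$$
   Context: For a graph $G$ and an integer $p\ge 1$, the $p$-independence number $\alpha_p(G)$ is the maximum size of a set $U\subseteq V(G)$ such that $G[U]$ contains no copy of $K_p$. $e_G(W,Z)$ denotes the number of edges of $G$ with one endpoint in $W$ and the other in $Z$. For integers $p\le q$ and $m\le n$, the Ramsey–Turán number $\mathsf{RT}_p(n,K_q,m)$ is the maximum number of edges in an $n$-vertex $K_q$-free graph $G$ with $\alpha_p(G)\le m$, and the Ramsey–Turán density is $\varrho_p(q):=\lim_{\varepsilon\to 0}\lim_{n\to\infty}\mathsf{RT}_p(n,K_q,\varepsilon n)/\binom{n}{2}$ (these limits exist). The quantity $\frac{\ell}{2p}$ equals the conjectured value $\varrho_p^*(p+\ell+1)$. *)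

theory Defs
  imports Complex_Main
begin

text \<open>A finite simple graph is given by its vertex set \<open>V\<close> and its set \<open>E\<close> of edges,
  which are two-element subsets of \<open>V\<close>.\<close>

definition sgraph :: "'a set \<Rightarrow> 'a set set \<Rightarrow> bool" where
  "sgraph V E \<longleftrightarrow> finite V \<and> (\<forall>e\<in>E. e \<subseteq> V \<and> card e = 2)"

definition induced_edges :: "'a set set \<Rightarrow> 'a set \<Rightarrow> 'a set set" where
  "induced_edges E U = {e \<in> E. e \<subseteq> U}"

definition edges_between :: "'a set set \<Rightarrow> 'a set \<Rightarrow> 'a set \<Rightarrow> 'a set set" where
  "edges_between E W Z = {e \<in> E. \<exists>w\<in>W. \<exists>z\<in>Z. e = {w, z}}"

definition K_free :: "nat \<Rightarrow> 'a set \<Rightarrow> 'a set set \<Rightarrow> bool" where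
  "K_free p V E \<longleftrightarrow>
     \<not> (\<exists>S\<subseteq>V. finite S \<and> card S = p \<and> (\<forall>x\<in>S. \<forall>y\<in>S. x \<noteq> y \<longrightarrow> {x, y} \<in> E))"

definition p_independence_number :: "nat \<Rightarrow> 'a set \<Rightarrow> 'a set set \<Rightarrow> nat" where
  "p_independence_number p V E = Max {card U | U. U \<subseteq> V \<and> K_free p U (induced_edges E U)}"

text \<open>The bound \<open>m\<close> is real, because it is instantiated with \<open>\<epsilon> n\<close>.
  The value is unspecified if there is no graph as required; for \<open>p < q\<close> and \<open>m = \<epsilon> n\<close>
  with a fixed \<open>\<epsilon> > 0\<close>, such graphs exist for all large \<open>n\<close>.\<close>

definition ramsey_turan :: "nat \<Rightarrow> nat \<Rightarrow> nat \<Rightarrow> real \<Rightarrow> nat" where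
  "ramsey_turan p n q m =
     Max {card E | E :: nat set set.
            sgraph {..<n} E \<and> K_free q {..<n} E \<and> real (p_independence_number p {..<n} E) \<le> m}"

text \<open>\<open>Lim\<close> and \<open>lim\<close> are meaningful only for convergent arguments; for \<open>1 \<le> p < q\<close> both
  limits exist (the outer one because the inner limit is monotone in \<open>\<epsilon>\<close>).\<close>

definition ramsey_turan_density :: "nat \<Rightarrow> nat \<Rightarrow> real" where
  "ramsey_turan_density p q =
     Lim (at_right 0)
       (\<lambda>\<epsilon>::real. lim (\<lambda>n. real (ramsey_turan p n q (\<epsilon> * real n)) / real (n choose 2)))"

end

theory Submission
  imports Defs "HOL-Analysis.L2_Norm" "HOL-Analysis.Complex_Transcendental"
begin

text \<open>The construction generalises the Bollobas-Erdos graph. Both sides are copies of the torus of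
  vectors in \<open>\<complex>\<^sup>N\<close> with unimodular coordinates, discretised to \<open>p N\<close>-th roots of unity. With
  \<open>\<omega> = exp (2 \<pi> i / p)\<close>, two points of one side are adjacent if one of them lies within a constant
  \<open>r\<close> of a nontrivial rotate \<open>\<omega>\<^sup>j y\<close> of the other; points of different sides are adjacent if their
  Hermitian product lies in a sector of angle \<open>2 \<pi> l / p\<close>, at distance at least a constant
  \<open>\<tau> > r\<^sup>2\<close> from the boundary of that sector.

  A Poincare inequality gives concentration of measure at a scale independent of \<open>N\<close>, so every set
  of positive density contains a point near each of \<open>x, \<omega> x, \<dots>, \<omega>\<^sup>p\<^sup>-\<^sup>1 x\<close> for some \<open>x\<close>, hence a
  \<open>p\<close>-clique. The Hermitian product has size about \<open>sqrt N\<close>, so the margin \<open>\<tau>\<close> costs nothing and the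
  cross density tends to \<open>l / p\<close>.

  Cliques of the two sides correspond to sets \<open>J, K\<close> of residues modulo \<open>p\<close>. If together they form
  a clique of size \<open>p + l + 1\<close>, there are coefficients with \<open>\<Sum> a\<^sub>j \<omega>\<^sup>j = 0\<close> and \<open>\<Sum> b\<^sub>k \<omega>\<^sup>k = 0\<close> for
  which all products \<open>a\<^sub>j b\<^sub>k\<close> lie in the dual cone of the sector, which is convex as \<open>2 l \<le> p\<close>.
  Summing the Hermitian products with these coefficients then gives at least \<open>2 \<tau>\<close> on the one hand
  and a quantity bilinear in the errors, at most \<open>2 r\<^sup>2\<close>, on the other.\<close>

section \<open>The Poincare inequality on words\<close>

text \<open>A torus takes the place of a sphere because its discretisation is a product of cycles:
  measure becomes counting, and the Poincare inequality of one cycle passes to the product without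
  loss. It yields only a tail of order \<open>1 / (\<mu> - 1)\<^sup>2\<close>, which suffices since
  \<epsilon> and \<open>p\<close> are fixed while the dimension \<open>N\<close> grows. The order
  \<open>p N\<close> of the roots serves two ends: divisibility by \<open>p\<close> makes
  multiplication by \<omega> an exact permutation of the points, and being at least \<open>N\<close>
  keeps the discretisation error bounded. The constants are chosen in the order \<epsilon>, \<mu>,
  \<open>r = 2 \<mu>\<close>, \<open>\<tau> = r\<^sup>2 + 1\<close>, and \<open>N\<close> last;
  whatever they are compared with grows like \<open>sqrt N\<close>. This gives one finite model for
  each \<epsilon>, and graphs of every large order arise from it by blowing up. As
  \<open>lim\<close> and \<open>Lim\<close> mean something only for convergent arguments, the
  density bound also needs a proof that both limits exist. The inner one comes from superadditivity
  under blow-ups, the outer one from monotonicity in \<epsilon>.\<close>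

definition words :: "nat \<Rightarrow> nat \<Rightarrow> nat list set" where
  "words N m = {x. set x \<subseteq> {..<m} \<and> length x = N}"

lemma finite_words [simp]: "finite (words N m)"
  unfolding words_def by (rule finite_lists_length_eq) simp

lemma card_words: "card (words N m) = m ^ N"
  unfolding words_def by (simp add: card_lists_length_eq)

lemma words_0: "words 0 m = {[]}"
  by (auto simp: words_def)

lemma sum_words_Suc:
  "(\<Sum>x\<in>words (Suc N) m. f x) = (\<Sum>a<m. \<Sum>x\<in>words N m. f (a # x))"
proof -
  have "words (Suc N) m = (\<lambda>(a, x). a # x) ` ({..<m} \<times> words N m)"
    by (auto simp: words_def length_Suc_conv)
  moreover have "inj_on (\<lambda>(a, x). a # x) ({..<m} \<times> words N m)"
    by (auto simp: inj_on_def)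
  ultimately show ?thesis
    by (simp add: sum.reindex sum.cartesian_product case_prod_unfold)
qed

lemma nth_words_less: "x \<in> words N m \<Longrightarrow> i < N \<Longrightarrow> x ! i < m"
  unfolding words_def using nth_mem by blast

definition shift :: "nat \<Rightarrow> nat \<Rightarrow> nat \<Rightarrow> nat list \<Rightarrow> nat list" where
  "shift m c i x = x[i := (x ! i + c) mod m]"

lemma shift_Cons [simp]:
  "shift m c 0 (a # x) = ((a + c) mod m) # x"
  "shift m c (Suc i) (a # x) = a # shift m c i x"
  by (simp_all add: shift_def)

lemma shift_in_words: "x \<in> words N m \<Longrightarrow> i < N \<Longrightarrow> shift m c i x \<in> words N m"
  by (auto simp: words_def shift_def dest!: set_update_subset_insert[THEN subsetD])
     (metis lessThan_iff mod_less_divisor not_less_zero nth_mem subsetD gr0I)+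

lemma shift_shift_inverse:
  assumes "x \<in> words N m" "i < N" "c + d = m"
  shows "shift m d i (shift m c i x) = x"
proof -
  have "x ! i < m" using assms by (simp add: nth_words_less)
  then have "((x ! i + c) mod m + d) mod m = x ! i"
    using assms(3) by (metis add.assoc mod_add_left_eq mod_add_self2 mod_less)
  then show ?thesis using assms by (simp add: shift_def words_def)
qed

lemma bij_betw_shift:
  assumes "i < N" "c \<le> m"
  shows "bij_betw (shift m c i) (words N m) (words N m)"
  by (rule bij_betw_byWitness[where f' = "shift m (m - c) i"])
    (use assms in \<open>auto intro: shift_shift_inverse shift_in_words\<close>)

lemma sum_squared_le_card:
  fixes f :: "'a \<Rightarrow> real"
  assumes "finite A"
  shows "(\<Sum>i\<in>A. f i)\<^sup>2 \<le> real (card A) * (\<Sum>i\<in>A. (f i)\<^sup>2)"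
  using Cauchy_Schwarz_ineq_sum[of "\<lambda>_. 1" f A] by simp

lemma sum_pairs_diff_squared:
  fixes f :: "'a \<Rightarrow> real"
  assumes "finite A"
  shows "(\<Sum>x\<in>A. \<Sum>y\<in>A. (f x - f y)\<^sup>2) = 2 * (real (card A) * (\<Sum>x\<in>A. (f x)\<^sup>2) - (\<Sum>x\<in>A. f x)\<^sup>2)"
proof -
  have "(\<Sum>x\<in>A. \<Sum>y\<in>A. (f x - f y)\<^sup>2)
      = (\<Sum>x\<in>A. \<Sum>y\<in>A. (f x)\<^sup>2) + (\<Sum>x\<in>A. \<Sum>y\<in>A. (f y)\<^sup>2) - 2 * (\<Sum>x\<in>A. \<Sum>y\<in>A. f x * f y)"
    by (simp add: power2_diff sum.distrib sum_subtractf sum_distrib_left mult.assoc)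
  also have "(\<Sum>x\<in>A. \<Sum>y\<in>A. f x * f y) = (\<Sum>x\<in>A. f x)\<^sup>2"
    by (simp add: power2_eq_square sum_product)
  finally show ?thesis by (simp add: sum_distrib_left algebra_simps)
qed

text \<open>Two values of \<open>g\<close> are joined by a path of fewer than \<open>m\<close>
  steps, so Cauchy-Schwarz bounds their squared difference by \<open>m\<close> times the energy;
  summing over all pairs gives twice the left-hand side. No sharper constant is needed: the factor
  \<open>m\<^sup>2\<close> is cancelled later by steps of length at most
  \<open>2 \<pi> / m\<close>.\<close>

lemma poincare_cycle:
  fixes g :: "nat \<Rightarrow> real"
  shows "real m * (\<Sum>a<m. (g a)\<^sup>2) - (\<Sum>a<m. g a)\<^sup>2
           \<le> (real m)\<^sup>2 * (real m * (\<Sum>a<m. (g ((a + 1) mod m) - g a)\<^sup>2))"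
proof -
  define D where "D = (\<Sum>a<m. (g ((a + 1) mod m) - g a)\<^sup>2)"
  have D0: "D \<ge> 0" unfolding D_def by (simp add: sum_nonneg)
  have *: "(g a - g b)\<^sup>2 \<le> real m * D" if "a \<le> b" "b < m" for a b
  proof -
    have "(g b - g a)\<^sup>2 = (\<Sum>k=a..<b. g (Suc k) - g k)\<^sup>2"
      using that by (simp add: sum_Suc_diff')
    also have "\<dots> \<le> real (b - a) * (\<Sum>k=a..<b. (g (Suc k) - g k)\<^sup>2)"
      using sum_squared_le_card[of "{a..<b}"] by simp
    also have "(\<Sum>k=a..<b. (g (Suc k) - g k)\<^sup>2) = (\<Sum>k=a..<b. (g ((k + 1) mod m) - g k)\<^sup>2)"
      using that by (intro sum.cong) auto
    also have "real (b - a) * \<dots> \<le> real m * D"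
      unfolding D_def using that
      by (intro mult_mono sum_mono2 sum_nonneg) auto
    finally show ?thesis by (simp add: power2_commute)
  qed
  have "(\<Sum>a<m. \<Sum>b<m. (g a - g b)\<^sup>2) \<le> (\<Sum>a<m. \<Sum>b<m. real m * D)"
    by (intro sum_mono) (metis * lessThan_iff linear power2_commute)
  also have "\<dots> = real m * (real m * (real m * D))" by simp
  finally have "2 * (real m * (\<Sum>a<m. (g a)\<^sup>2) - (\<Sum>a<m. g a)\<^sup>2) \<le> real m * (real m * (real m * D))"
    by (simp add: sum_pairs_diff_squared)
  also have "\<dots> \<le> 2 * (real m * (real m * (real m * D)))" using D0 by simp
  finally show ?thesis unfolding D_def by (simp add: power2_eq_square mult.assoc)
qed

text \<open>The constant does not depend on the number of factors: the variance splits into the mean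
  conditional variance and the variance of the conditional mean, and conditional means do not
  increase the Dirichlet form.\<close>

lemma poincare_words:
  fixes f :: "nat list \<Rightarrow> real"
  shows "real (m ^ N) * (\<Sum>x\<in>words N m. (f x)\<^sup>2) - (\<Sum>x\<in>words N m. f x)\<^sup>2
           \<le> (real m)\<^sup>2 * (real (m ^ N) * (\<Sum>i<N. \<Sum>x\<in>words N m. (f (shift m 1 i x) - f x)\<^sup>2))"
proof (induction N arbitrary: f)
  case 0
  show ?case by (simp add: words_0)
next
  case (Suc N)
  define X where "X = words N m"
  define F where "F = (\<lambda>x. \<Sum>a<m. f (a # x))"
  define D1 where "D1 = (\<Sum>x\<in>X. \<Sum>a<m. (f (((a + 1) mod m) # x) - f (a # x))\<^sup>2)"
  define D2 where "D2 = (\<Sum>i<N. \<Sum>x\<in>X. \<Sum>a<m. (f (a # shift m 1 i x) - f (a # x))\<^sup>2)"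
  have 1: "(\<Sum>x\<in>X. real m * (\<Sum>a<m. (f (a # x))\<^sup>2) - (F x)\<^sup>2) \<le> (real m)\<^sup>2 * (real m * D1)"
    unfolding D1_def F_def sum_distrib_left[of _ _ X]
    by (intro sum_mono poincare_cycle)
  \<comment> \<open>Cauchy-Schwarz over the first letter: \<open>F\<close> is a sum rather than a
    mean, hence the factor \<open>m\<close>.\<close>
  have "(\<Sum>i<N. \<Sum>x\<in>X. (F (shift m 1 i x) - F x)\<^sup>2) \<le> real m * D2"
    unfolding D2_def sum_distrib_left[of _ _ X] sum_distrib_left[of _ _ "{..<N}"] F_def sum_subtractf[symmetric]
    by (intro sum_mono) (rule sum_squared_le_card[of "{..<m}", simplified card_lessThan], simp)
  then have 2: "real (m ^ N) * (\<Sum>x\<in>X. (F x)\<^sup>2) - (\<Sum>x\<in>X. F x)\<^sup>2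
      \<le> (real m)\<^sup>2 * (real (m ^ N) * (real m * D2))"
    using order.trans[OF Suc.IH[of F]] unfolding X_def[symmetric]
    by (meson mult_left_mono of_nat_0_le_iff zero_le_power2)
  have s1: "(\<Sum>x\<in>words (Suc N) m. (f x)\<^sup>2) = (\<Sum>x\<in>X. \<Sum>a<m. (f (a # x))\<^sup>2)"
    unfolding sum_words_Suc X_def by (rule sum.swap)
  have s2: "(\<Sum>x\<in>words (Suc N) m. f x) = (\<Sum>x\<in>X. F x)"
    unfolding sum_words_Suc X_def F_def by (rule sum.swap)
  have s3: "(\<Sum>i<Suc N. \<Sum>x\<in>words (Suc N) m. (f (shift m 1 i x) - f x)\<^sup>2) = D1 + D2"
  proof -
    have "(\<Sum>x\<in>words (Suc N) m. (f (shift m 1 0 x) - f x)\<^sup>2) = D1"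
      unfolding sum_words_Suc X_def D1_def by (subst sum.swap) simp
    moreover have "(\<Sum>i<N. \<Sum>x\<in>words (Suc N) m. (f (shift m 1 (Suc i) x) - f x)\<^sup>2) = D2"
      unfolding sum_words_Suc X_def D2_def by (subst (2) sum.swap) simp
    ultimately show ?thesis by (subst sum.lessThan_Suc_shift) simp
  qed
  have "real (m ^ Suc N) * (\<Sum>x\<in>X. \<Sum>a<m. (f (a # x))\<^sup>2) - (\<Sum>x\<in>X. F x)\<^sup>2
      = real (m ^ N) * (\<Sum>x\<in>X. real m * (\<Sum>a<m. (f (a # x))\<^sup>2) - (F x)\<^sup>2)
        + (real (m ^ N) * (\<Sum>x\<in>X. (F x)\<^sup>2) - (\<Sum>x\<in>X. F x)\<^sup>2)"
    by (simp add: sum_subtractf sum_distrib_left algebra_simps)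
  also have "\<dots> \<le> real (m ^ N) * ((real m)\<^sup>2 * (real m * D1)) + (real m)\<^sup>2 * (real (m ^ N) * (real m * D2))"
    by (intro add_mono mult_left_mono 1 2) simp
  also have "\<dots> = (real m)\<^sup>2 * (real (m ^ Suc N) * (D1 + D2))"
    by (simp add: algebra_simps)
  finally show ?case unfolding s1 s2 s3 .
qed

text \<open>A substitute for isoperimetry: each pair from \<open>A\<close> and \<open>B\<close>
  contributes at least \<open>(b - a)\<^sup>2\<close> to the double sum of squared differences. A
  function of small energy therefore cannot separate two dense sets.\<close>

lemma two_set_bound:
  fixes f :: "nat list \<Rightarrow> real"
  assumes "A \<subseteq> words N m" "B \<subseteq> words N m"
    and "\<And>x. x \<in> A \<Longrightarrow> f x \<le> a" "\<And>x. x \<in> B \<Longrightarrow> b \<le> f x" "a \<le> b"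
  shows "real (card A) * real (card B) * (b - a)\<^sup>2
           \<le> 2 * ((real m)\<^sup>2 * (real (m ^ N) * (\<Sum>i<N. \<Sum>x\<in>words N m. (f (shift m 1 i x) - f x)\<^sup>2)))"
proof -
  let ?X = "words N m"
  have "real (card A) * real (card B) * (b - a)\<^sup>2 = (\<Sum>x\<in>A. \<Sum>y\<in>B. (b - a)\<^sup>2)" by simp
  also have "\<dots> \<le> (\<Sum>x\<in>A. \<Sum>y\<in>B. (f x - f y)\<^sup>2)"
  proof (intro sum_mono)
    fix x y assume "x \<in> A" "y \<in> B"
    then have "b - a \<le> f y - f x" using assms(3)[of x] assms(4)[of y] by linarith
    then have "(b - a)\<^sup>2 \<le> (f y - f x)\<^sup>2" using assms(5) by (intro power_mono) auto
    then show "(b - a)\<^sup>2 \<le> (f x - f y)\<^sup>2" by (simp add: power2_commute)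
  qed
  also have "\<dots> \<le> (\<Sum>x\<in>?X. \<Sum>y\<in>?X. (f x - f y)\<^sup>2)"
    by (intro order.trans[OF sum_mono sum_mono2] sum_mono2 sum_nonneg)
      (use assms(1,2) in auto)
  also have "\<dots> = 2 * (real (m ^ N) * (\<Sum>x\<in>?X. (f x)\<^sup>2) - (\<Sum>x\<in>?X. f x)\<^sup>2)"
    by (subst sum_pairs_diff_squared) (simp_all add: card_words)
  finally show ?thesis using mult_left_mono[OF poincare_words[of m N f], of 2] by (rule order.trans) simp
qed

section \<open>Concentration of measure in the Euclidean metric\<close>

definition unit_root :: "nat \<Rightarrow> nat \<Rightarrow> complex" where
  "unit_root m a = cis (2 * pi * real a / real m)"

lemma norm_unit_root [simp]: "cmod (unit_root m a) = 1"
  by (simp add: unit_root_def)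

lemma unit_root_add: "unit_root m (a + b) = unit_root m a * unit_root m b"
  by (simp add: unit_root_def cis_mult ring_distribs add_divide_distrib)

lemma unit_root_0 [simp]: "unit_root m 0 = 1"
  by (simp add: unit_root_def)

lemma unit_root_self: "m > 0 \<Longrightarrow> unit_root m m = 1"
  by (simp add: unit_root_def)

lemma unit_root_mult: "m > 0 \<Longrightarrow> unit_root m (m * k) = 1"
  by (induction k) (simp_all add: unit_root_add unit_root_self)

lemma unit_root_mod: "m > 0 \<Longrightarrow> unit_root m (a mod m) = unit_root m a"
  by (metis mult_div_mod_eq mult_1 unit_root_add unit_root_mult)

text \<open>The case \<open>c = m - 1\<close> is the backward step. Both directions occur because
  the energy is estimated through increases only, and a decrease is an increase along the reversed
  step.\<close>

lemma norm_unit_root_diff_step: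
  assumes "m > 0" "c = 1 \<or> c = m - 1"
  shows "cmod (unit_root m ((a + c) mod m) - unit_root m a) \<le> 2 * pi / real m"
proof -
  have "cmod (unit_root m ((a + c) mod m) - unit_root m a) = cmod (unit_root m a * (unit_root m c - 1))"
    using assms(1) by (simp add: unit_root_mod unit_root_add algebra_simps)
  also have "\<dots> = cmod (unit_root m c - 1)" by (simp add: norm_mult)
  also have "\<dots> = cmod (unit_root m 1 - 1)"
  proof (cases "c = 1")
    case False
    then have "c + 1 = m" using assms by auto
    then have "unit_root m c * unit_root m 1 = 1"
      using unit_root_self[OF assms(1)] by (metis unit_root_add)
    then have "(unit_root m c - 1) * unit_root m 1 = - (unit_root m 1 - 1)"
      by (simp add: algebra_simps)
    then show ?thesis by (metis mult.right_neutral norm_minus_cancel norm_mult norm_unit_root)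
  qed simp
  also have "\<dots> = 2 * \<bar>sin (pi / real m)\<bar>"
    using dist_exp_i_1[of "2 * pi / real m"] by (simp add: unit_root_def cis_conv_exp)
  also have "\<dots> \<le> 2 * \<bar>pi / real m\<bar>" by (intro mult_left_mono abs_sin_x_le_abs_x) simp
  finally show ?thesis by simp
qed

definition wdist :: "nat \<Rightarrow> nat \<Rightarrow> nat list \<Rightarrow> nat list \<Rightarrow> real" where
  "wdist N m x y = L2_set (\<lambda>i. cmod (unit_root m (x ! i) - unit_root m (y ! i))) {..<N}"

lemma wdist_squared:
  "(wdist N m x y)\<^sup>2 = (\<Sum>i<N. (cmod (unit_root m (x ! i) - unit_root m (y ! i)))\<^sup>2)"
  by (simp add: wdist_def L2_set_def sum_nonneg)

lemma wdist_shift: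
  assumes "x \<in> words N m" "i < N" "m > 0" "c = 1 \<or> c = m - 1"
  defines "h \<equiv> 2 * pi / real m"
  shows "(wdist N m (shift m c i x) a)\<^sup>2
     \<le> (wdist N m x a)\<^sup>2 + (2 * h * cmod (unit_root m (x ! i) - unit_root m (a ! i)) + h\<^sup>2)"
proof -
  let ?d = "\<lambda>y j. (cmod (unit_root m (y ! j) - unit_root m (a ! j)))\<^sup>2"
  let ?u = "cmod (unit_root m (x ! i) - unit_root m (a ! i))"
  let ?x = "shift m c i x"
  have len: "length x = N" using assms(1) by (simp add: words_def)
  have split: "(\<Sum>j<N. ?d y j) = ?d y i + (\<Sum>j\<in>{..<N} - {i}. ?d y j)" for y
    using assms(2) by (subst sum.remove[of _ i]) auto
  have rest: "(\<Sum>j\<in>{..<N} - {i}. ?d ?x j) = (\<Sum>j\<in>{..<N} - {i}. ?d x j)"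
    by (intro sum.cong) (auto simp: shift_def)
  have xi: "?x ! i = (x ! i + c) mod m" using assms(2) len by (simp add: shift_def)
  have "cmod (unit_root m (?x ! i) - unit_root m (a ! i))
      \<le> cmod (unit_root m (?x ! i) - unit_root m (x ! i)) + ?u"
    using norm_triangle_ineq[of "unit_root m (?x ! i) - unit_root m (x ! i)"
        "unit_root m (x ! i) - unit_root m (a ! i)"] by simp
  also have "\<dots> \<le> h + ?u"
    unfolding xi h_def using norm_unit_root_diff_step assms(3,4) by simp
  finally have "?d ?x i \<le> (h + ?u)\<^sup>2" by (intro power_mono) auto
  also have "\<dots> = ?d x i + (2 * h * ?u + h\<^sup>2)" by (simp add: power2_sum algebra_simps)
  finally show ?thesis unfolding wdist_squared split rest by simp
qed

lemma sqrt_add_le: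
  fixes u d :: real
  assumes "u > 0" "d \<ge> 0"
  shows "sqrt (u + d) \<le> sqrt u + d / (2 * sqrt u)"
proof (rule real_le_lsqrt)
  have "(sqrt u + d / (2 * sqrt u))\<^sup>2 = u + d + (d / (2 * sqrt u))\<^sup>2"
    using assms by (simp add: power2_sum)
  then show "u + d \<le> (sqrt u + d / (2 * sqrt u))\<^sup>2" by simp
qed (use assms in auto)

definition wsetdist2 :: "nat \<Rightarrow> nat \<Rightarrow> nat list set \<Rightarrow> nat list \<Rightarrow> real" where
  "wsetdist2 N m A x = Min ((\<lambda>a. (wdist N m x a)\<^sup>2) ` A)"

lemma wsetdist2_props:
  assumes "A \<subseteq> words N m" "A \<noteq> {}"
  shows "a \<in> A \<Longrightarrow> wsetdist2 N m A x \<le> (wdist N m x a)\<^sup>2"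
    and "\<exists>a\<in>A. wsetdist2 N m A x = (wdist N m x a)\<^sup>2"
    and "wsetdist2 N m A x \<ge> 0"
proof -
  have fin: "finite A" using assms(1) finite_words by (rule finite_subset)
  show "a \<in> A \<Longrightarrow> wsetdist2 N m A x \<le> (wdist N m x a)\<^sup>2"
    unfolding wsetdist2_def using fin by (intro Min_le) auto
  have "Min ((\<lambda>a. (wdist N m x a)\<^sup>2) ` A) \<in> (\<lambda>a. (wdist N m x a)\<^sup>2) ` A"
    using fin assms(2) by (intro Min_in) auto
  then show *: "\<exists>a\<in>A. wsetdist2 N m A x = (wdist N m x a)\<^sup>2"
    unfolding wsetdist2_def by auto
  then show "wsetdist2 N m A x \<ge> 0" by auto
qed

text \<open>The distance itself would not do: at a point of \<open>A\<close> each of the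
  \<open>N\<close> steps may raise it by about \<open>h\<close>, which gives energy of order
  \<open>N * h\<^sup>2\<close>. Smoothing by \<open>sqrt (1 + _)\<close> makes such a rise of order
  \<open>h\<^sup>2\<close>. Only increases are estimated, because for them the point of
  \<open>A\<close> nearest to \<open>x\<close> can be kept as a competitor after the step. The
  leading terms add up to a multiple of \<open>q\<close>, which the denominator \<open>1 + q\<close>
  absorbs.\<close>

lemma one_sided_dirichlet:
  assumes A: "A \<subseteq> words N m" "A \<noteq> {}" and x: "x \<in> words N m" and m: "m > 0"
    and c: "c = 1 \<or> c = m - 1"
  defines "h \<equiv> 2 * pi / real m" and "f \<equiv> \<lambda>x. sqrt (1 + wsetdist2 N m A x)"
  shows "(\<Sum>i<N. (max 0 (f (shift m c i x) - f x))\<^sup>2) \<le> 2 * h\<^sup>2 + real N * h ^ 4 / 2"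
proof -
  obtain a where a: "a \<in> A" and qa: "wsetdist2 N m A x = (wdist N m x a)\<^sup>2"
    using wsetdist2_props(2)[OF A] by blast
  define q where "q = wsetdist2 N m A x"
  have q: "q = (wdist N m x a)\<^sup>2" "q \<ge> 0" using qa by (auto simp: q_def)
  have fx: "f x > 0" "(f x)\<^sup>2 = 1 + q" unfolding f_def q_def[symmetric] using q(2) by auto
  define u where "u = (\<lambda>i. cmod (unit_root m (x ! i) - unit_root m (a ! i)))"
  have h0: "h \<ge> 0" by (simp add: h_def)
  have bound: "(max 0 (f (shift m c i x) - f x))\<^sup>2 \<le> (2 * h\<^sup>2 * (u i)\<^sup>2 + h ^ 4 / 2) / (1 + q)" if i: "i < N" for i
  proof -
    define d where "d = 2 * h * u i + h\<^sup>2"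
    have d0: "d \<ge> 0" using h0 by (simp add: d_def u_def)
    have "wsetdist2 N m A (shift m c i x) \<le> (wdist N m (shift m c i x) a)\<^sup>2"
      by (rule wsetdist2_props(1)[OF A a])
    also have "\<dots> \<le> q + d"
      unfolding q d_def u_def h_def by (rule wdist_shift[OF x i m c])
    finally have "f (shift m c i x) \<le> sqrt (1 + q + d)" by (simp add: f_def)
    also have "\<dots> \<le> sqrt (1 + q) + d / (2 * sqrt (1 + q))"
      using q(2) d0 by (intro sqrt_add_le) auto
    also have "sqrt (1 + q) = f x" by (simp add: f_def q_def)
    finally have "max 0 (f (shift m c i x) - f x) \<le> d / (2 * f x)" using d0 fx(1) by auto
    then have "(max 0 (f (shift m c i x) - f x))\<^sup>2 \<le> (d / (2 * f x))\<^sup>2" by (intro power_mono) auto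
    also have "\<dots> = (d\<^sup>2 / 4) / (1 + q)" by (simp add: power_divide power_mult_distrib fx(2))
    also have "d\<^sup>2 / 4 \<le> 2 * h\<^sup>2 * (u i)\<^sup>2 + h ^ 4 / 2"
    proof -
      have "0 \<le> (2 * h * u i - h\<^sup>2)\<^sup>2" by simp
      then show ?thesis unfolding d_def by (simp add: power2_eq_square power4_eq_xxxx algebra_simps)
    qed
    finally show ?thesis using q(2) by (simp add: divide_right_mono)
  qed
  have "(\<Sum>i<N. (max 0 (f (shift m c i x) - f x))\<^sup>2) \<le> (\<Sum>i<N. (2 * h\<^sup>2 * (u i)\<^sup>2 + h ^ 4 / 2) / (1 + q))"
    by (intro sum_mono bound) simp
  also have "\<dots> = (2 * h\<^sup>2 * (\<Sum>i<N. (u i)\<^sup>2) + real N * h ^ 4 / 2) / (1 + q)"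
    by (simp add: sum_divide_distrib[symmetric] sum.distrib sum_distrib_left)
  also have "(\<Sum>i<N. (u i)\<^sup>2) = q" by (simp add: q wdist_squared u_def)
  also have "(2 * h\<^sup>2 * q + real N * h ^ 4 / 2) / (1 + q) \<le> 2 * h\<^sup>2 + real N * h ^ 4 / 2"
  proof -
    have "2 * h\<^sup>2 * q + real N * h ^ 4 / 2
        \<le> (2 * h\<^sup>2 * q + real N * h ^ 4 / 2) + (2 * h\<^sup>2 + q * (real N * h ^ 4 / 2))"
      using q(2) by simp
    also have "\<dots> = (2 * h\<^sup>2 + real N * h ^ 4 / 2) * (1 + q)" by (simp add: algebra_simps)
    finally show ?thesis using q(2) by (simp add: divide_le_eq)
  qed
  finally show ?thesis .
qed

text \<open>A decrease under the step \<open>+1\<close> at \<open>x\<close> is an increase under the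
  step \<open>m - 1\<close> at the shifted point; reindexing along the shift turns both halves of
  the energy into one-sided sums.\<close>

lemma dirichlet_distance:
  assumes A: "A \<subseteq> words N m" "A \<noteq> {}" and m: "m > 0"
  defines "h \<equiv> 2 * pi / real m" and "f \<equiv> \<lambda>x. sqrt (1 + wsetdist2 N m A x)"
  shows "(\<Sum>i<N. \<Sum>x\<in>words N m. (f (shift m 1 i x) - f x)\<^sup>2) \<le> real (m ^ N) * (4 * h\<^sup>2 + real N * h ^ 4)"
proof -
  let ?X = "words N m"
  let ?P = "\<lambda>c i x. (max 0 (f (shift m c i x) - f x))\<^sup>2"
  have sq: "(s - t)\<^sup>2 = (max 0 (s - t))\<^sup>2 + (max 0 (t - s))\<^sup>2" for s t :: real
    by (auto simp: max_def power2_commute)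
  have "(\<Sum>x\<in>?X. (f (shift m 1 i x) - f x)\<^sup>2) = (\<Sum>x\<in>?X. ?P 1 i x + ?P (m - 1) i x)" if i: "i < N" for i
  proof -
    have "(\<Sum>x\<in>?X. ?P (m - 1) i x) = (\<Sum>x\<in>?X. ?P (m - 1) i (shift m 1 i x))"
      using bij_betw_shift[of i N 1 m] i m by (intro sum.reindex_bij_betw[symmetric]) auto
    also have "\<dots> = (\<Sum>x\<in>?X. (max 0 (f x - f (shift m 1 i x)))\<^sup>2)"
      using i m by (intro sum.cong) (auto simp: shift_shift_inverse)
    finally show ?thesis by (subst sq) (simp add: sum.distrib)
  qed
  then have "(\<Sum>i<N. \<Sum>x\<in>?X. (f (shift m 1 i x) - f x)\<^sup>2) = (\<Sum>i<N. \<Sum>x\<in>?X. ?P 1 i x + ?P (m - 1) i x)"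
    by (rule sum.cong[OF refl]) simp
  also have "\<dots> = (\<Sum>x\<in>?X. (\<Sum>i<N. ?P 1 i x) + (\<Sum>i<N. ?P (m - 1) i x))"
    by (subst sum.swap) (simp add: sum.distrib)
  also have "\<dots> \<le> (\<Sum>x\<in>?X. (2 * h\<^sup>2 + real N * h ^ 4 / 2) + (2 * h\<^sup>2 + real N * h ^ 4 / 2))"
    unfolding f_def h_def by (intro sum_mono add_mono one_sided_dirichlet A m) auto
  also have "\<dots> = real (m ^ N) * (4 * h\<^sup>2 + real N * h ^ 4)" by (simp add: card_words)
  finally show ?thesis .
qed

text \<open>The smoothed distance is at most 1 on \<open>A\<close> and at least \<mu> on
  \<open>B\<close>. Since \<open>m * h = 2 * \<pi> < 6.4\<close>, the energy bound contributes less
  than \<open>4 * 6.4\<^sup>2 + 6.4 ^ 4 < 2000\<close>, and \<open>two_set_bound\<close> doubles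
  this. The hypothesis \<open>N \<le> m\<^sup>2\<close> controls the discretisation term
  \<open>N * h ^ 4\<close>.\<close>

lemma concentration:
  assumes A: "A \<subseteq> words N m" and m: "m > 0" and Nm: "N \<le> m\<^sup>2" and mu: "\<mu> \<ge> 1"
  defines "B \<equiv> {x \<in> words N m. \<forall>a\<in>A. \<mu> < wdist N m a x}"
  shows "real (card A) * real (card B) * (\<mu> - 1)\<^sup>2 \<le> 4000 * (real (m ^ N))\<^sup>2"
proof (cases "A = {}")
  case False
  define f where "f = (\<lambda>x. sqrt (1 + wsetdist2 N m A x))"
  define h where "h = 2 * pi / real m"
  have sym: "wdist N m x y = wdist N m y x" for x y
    by (simp add: wdist_def norm_minus_commute)
  have fA: "f x \<le> 1" if "x \<in> A" for x
    using wsetdist2_props(1)[OF A False that, of x] wsetdist2_props(3)[OF A False, of x]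
    by (simp add: f_def wdist_def L2_set_def)
  have fB: "\<mu> \<le> f x" if x: "x \<in> B" for x
  proof -
    obtain a where a: "a \<in> A" "wsetdist2 N m A x = (wdist N m x a)\<^sup>2"
      using wsetdist2_props(2)[OF A False] by blast
    then have "\<mu> < wdist N m x a" using x sym by (auto simp: B_def)
    then have "\<mu>\<^sup>2 \<le> (wdist N m x a)\<^sup>2" using mu by (intro power_mono) auto
    then show ?thesis unfolding f_def a(2) by (intro real_le_rsqrt) auto
  qed
  have "real (card A) * real (card B) * (\<mu> - 1)\<^sup>2
      \<le> 2 * ((real m)\<^sup>2 * (real (m ^ N) * (\<Sum>i<N. \<Sum>x\<in>words N m. (f (shift m 1 i x) - f x)\<^sup>2)))"
    using fA fB mu A by (intro two_set_bound) (auto simp: B_def)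
  also have "\<dots> \<le> 2 * ((real m)\<^sup>2 * (real (m ^ N) * (real (m ^ N) * (4 * h\<^sup>2 + real N * h ^ 4))))"
    unfolding f_def h_def by (intro mult_left_mono dirichlet_distance A False m) auto
  also have "\<dots> = 2 * ((real m)\<^sup>2 * (4 * h\<^sup>2 + real N * h ^ 4)) * (real (m ^ N))\<^sup>2"
    by (simp add: power2_eq_square algebra_simps)
  also have "\<dots> \<le> 4000 * (real (m ^ N))\<^sup>2"
  proof (intro mult_right_mono)
    have "(real m)\<^sup>2 * (4 * h\<^sup>2 + real N * h ^ 4) = 4 * (real m * h)\<^sup>2 + (real N / (real m)\<^sup>2) * (real m * h) ^ 4"
      using m by (simp add: field_simps power2_eq_square power4_eq_xxxx)
    also have "real m * h = 2 * pi" using m by (simp add: h_def)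
    also have "4 * (2 * pi)\<^sup>2 + (real N / (real m)\<^sup>2) * (2 * pi) ^ 4 \<le> 4 * (2 * 3.2)\<^sup>2 + 1 * (2 * 3.2) ^ 4"
    proof (intro add_mono mult_mono power_mono)
      show "real N / (real m)\<^sup>2 \<le> 1" using Nm m by (simp add: divide_le_eq flip: of_nat_power)
    qed (use pi_less_4 pi_approx in \<open>auto intro!: mult_nonneg_nonneg\<close>)
    also have "\<dots> \<le> 2000" by (simp add: power2_eq_square power4_eq_xxxx)
    finally show "2 * ((real m)\<^sup>2 * (4 * h\<^sup>2 + real N * h ^ 4)) \<le> 4000" by simp
  qed simp
  finally show ?thesis .
qed simp

section \<open>Rotations of the discrete torus and the Euclidean norm\<close>

lemma bij_betw_add_mod:
  assumes "c \<le> m" "m > (0::nat)"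
  shows "bij_betw (\<lambda>a. (a + c) mod m) {..<m} {..<m}"
proof (rule bij_betw_byWitness[where f' = "\<lambda>a. (a + (m - c)) mod m"])
  have "((a + c) mod m + d) mod m = a" if "a < m" "c + d = m" for a c d
    using that by (metis add.assoc mod_add_left_eq mod_add_self2 mod_less)
  note * = this
  show "\<forall>a\<in>{..<m}. ((a + c) mod m + (m - c)) mod m = a"
    by (rule ballI, rule *) (use assms in auto)
  show "\<forall>a\<in>{..<m}. ((a + (m - c)) mod m + c) mod m = a"
    by (rule ballI, rule *) (use assms in auto)
qed (use assms in auto)

text \<open>For \<open>m = p * N\<close> and \<open>c = k * N\<close> this multiplies the associated
  vector by \<open>unit_root p k\<close>.\<close>

definition rot :: "nat \<Rightarrow> nat \<Rightarrow> nat list \<Rightarrow> nat list" where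
  "rot m c x = map (\<lambda>a. (a + c) mod m) x"

lemma bij_betw_rot:
  assumes "c \<le> m" "m > 0"
  shows "bij_betw (rot m c) (words N m) (words N m)"
proof -
  let ?g = "\<lambda>a. (a + c) mod m"
  have "bij_betw (map ?g) (lists {..<m}) (lists {..<m})"
    using bij_lists[OF bij_betw_add_mod[OF assms]] .
  then have inj: "inj_on (map ?g) (lists {..<m})" and im: "map ?g ` lists {..<m} = lists {..<m}"
    by (auto simp: bij_betw_def)
  have w: "words N m = {x \<in> lists {..<m}. length x = N}" by (auto simp: words_def)
  show ?thesis unfolding bij_betw_def w rot_def
  proof (intro conjI)
    show "inj_on (map ?g) {x \<in> lists {..<m}. length x = N}" by (rule inj_on_subset[OF inj]) auto
    show "map ?g ` {x \<in> lists {..<m}. length x = N} = {x \<in> lists {..<m}. length x = N}"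
    proof (intro equalityI subsetI)
      fix y assume y: "y \<in> {x \<in> lists {..<m}. length x = N}"
      then obtain x where "x \<in> lists {..<m}" "y = map ?g x" using im by blast
      then show "y \<in> map ?g ` {x \<in> lists {..<m}. length x = N}" using y by auto
    qed (use im in auto)
  qed
qed

definition wvec :: "nat \<Rightarrow> nat list \<Rightarrow> nat \<Rightarrow> complex" where
  "wvec m x = (\<lambda>i. unit_root m (x ! i))"

definition nrm :: "nat \<Rightarrow> (nat \<Rightarrow> complex) \<Rightarrow> real" where
  "nrm N v = L2_set (\<lambda>i. cmod (v i)) {..<N}"

lemma nrm_cong: "(\<And>i. i < N \<Longrightarrow> v i = w i) \<Longrightarrow> nrm N v = nrm N w"
  unfolding nrm_def by (rule L2_set_cong) auto

lemma nrm_nonneg [simp]: "nrm N v \<ge> 0"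
  by (simp add: nrm_def)

lemma nrm_triangle: "nrm N (\<lambda>i. v i + w i) \<le> nrm N v + nrm N w"
  unfolding nrm_def
  by (rule order.trans[OF L2_set_mono L2_set_triangle_ineq]) (auto intro: norm_triangle_ineq)

lemma nrm_diff_triangle: "nrm N (\<lambda>i. u i - w i) \<le> nrm N (\<lambda>i. u i - v i) + nrm N (\<lambda>i. v i - w i)"
  using nrm_triangle[of N "\<lambda>i. u i - v i" "\<lambda>i. v i - w i"] by simp

lemma nrm_scale: "nrm N (\<lambda>i. c * v i) = cmod c * nrm N v"
  unfolding nrm_def by (simp add: norm_mult L2_set_right_distrib)

lemma nrm_scale_diff: "nrm N (\<lambda>i. c * v i - c * w i) = cmod c * nrm N (\<lambda>i. v i - w i)"
  using nrm_scale[of N c "\<lambda>i. v i - w i"] by (simp add: algebra_simps)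

lemma nrm_minus_commute: "nrm N (\<lambda>i. v i - w i) = nrm N (\<lambda>i. w i - v i)"
  by (simp add: nrm_def norm_minus_commute)

lemma nrm_wvec: "nrm N (wvec m x) = sqrt (real N)"
  by (simp add: nrm_def wvec_def L2_set_def)

lemma nrm_rotate_wvec:
  "nrm N (\<lambda>i. wvec m x i - c * wvec m x i) = cmod (1 - c) * sqrt (real N)"
  using nrm_scale[of N "1 - c" "wvec m x"] by (simp add: nrm_wvec algebra_simps)

lemma wdist_eq_nrm: "wdist N m x y = nrm N (\<lambda>i. wvec m x i - wvec m y i)"
  by (simp add: wdist_def nrm_def wvec_def)

lemma unit_root_coarse: "N > 0 \<Longrightarrow> unit_root (p * N) (k * N) = unit_root p k"
  by (simp add: unit_root_def mult.assoc)

lemma wvec_rot: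
  assumes "x \<in> words N (p * N)" "i < N" "p > 0"
  shows "wvec (p * N) (rot (p * N) (k * N) x) i = unit_root p k * wvec (p * N) x i"
  using assms
  by (simp add: wvec_def rot_def words_def unit_root_mod unit_root_add unit_root_coarse mult.commute[of "unit_root p k"])

text \<open>Each rotate of the exceptional set of the concentration inequality has density below
  \<open>1 / p\<close>, so some \<open>x\<close> lies outside all of them.\<close>

lemma spread_rotates:
  assumes A: "A \<subseteq> words N (p * N)" and p: "p > 0" and N: "N > 0"
    and eps: "real (card A) \<ge> \<epsilon> * real ((p * N) ^ N)" "\<epsilon> > 0"
    and mu: "\<mu> \<ge> 1" "\<epsilon> * (\<mu> - 1)\<^sup>2 > 4000 * real p"
  shows "\<exists>x\<in>words N (p * N). \<forall>j<p. \<exists>a\<in>A.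
           nrm N (\<lambda>i. wvec (p * N) a i - unit_root p j * wvec (p * N) x i) \<le> \<mu>"
proof (rule ccontr)
  define m where "m = p * N"
  define X where "X = words N m"
  have m: "m > 0" "N \<le> m" using p N by (auto simp: m_def)
  define B where "B = {x \<in> X. \<forall>a\<in>A. \<mu> < wdist N m a x}"
  define Bj where "Bj = (\<lambda>j. {x \<in> X. rot m (j * N) x \<in> B})"
  assume contra: "\<not> ?thesis"
  have finX: "finite X" by (simp add: X_def)
  \<comment> \<open>The assumed failure says that every \<open>x\<close> has some rotate far from
    \<open>A\<close>; the sets \<open>Bj j\<close> are then too small to cover.\<close>
  have "X \<subseteq> (\<Union>j<p. Bj j)"
  proof
    fix x assume x: "x \<in> X"
    then obtain j where j: "j < p" and far:
        "\<And>a. a \<in> A \<Longrightarrow> \<not> nrm N (\<lambda>i. wvec m a i - unit_root p j * wvec m x i) \<le> \<mu>"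
      using contra unfolding X_def m_def by blast
    have "rot m (j * N) x \<in> X"
      using bij_betw_rot[of "j * N" m N] j x m by (auto simp: X_def m_def bij_betw_def)
    moreover have "wdist N m a (rot m (j * N) x) = nrm N (\<lambda>i. wvec m a i - unit_root p j * wvec m x i)" for a
      unfolding wdist_eq_nrm m_def
      by (rule nrm_cong) (use x p in \<open>simp add: wvec_rot X_def m_def\<close>)
    ultimately have "rot m (j * N) x \<in> B" using far by (auto simp: B_def not_le)
    then show "x \<in> (\<Union>j<p. Bj j)" using j x by (auto simp: Bj_def)
  qed
  then have "card X \<le> card (\<Union>j<p. Bj j)" using finX by (intro card_mono) (auto simp: Bj_def)
  also have "\<dots> \<le> (\<Sum>j<p. card (Bj j))" by (rule card_UN_le) simp
  also have "\<dots> \<le> (\<Sum>j<p. card B)"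
  proof (rule sum_mono)
    fix j assume "j \<in> {..<p}"
    then have "inj_on (rot m (j * N)) X"
      using bij_betw_rot[of "j * N" m N] m by (auto simp: X_def m_def bij_betw_def)
    then show "card (Bj j) \<le> card B"
      using finX by (intro card_inj_on_le[of "rot m (j * N)"])
        (auto simp: Bj_def B_def intro: inj_on_subset)
  qed
  finally have le: "real (card X) \<le> real p * real (card B)" by (simp flip: of_nat_mult)
  have cX: "card X = m ^ N" by (simp add: X_def card_words)
  then have X0: "real (card X) > 0" using m by simp
  have "N \<le> m\<^sup>2" using m by (metis le_square le_trans power2_eq_square)
  then have conc: "real (card A) * real (card B) * (\<mu> - 1)\<^sup>2 \<le> 4000 * (real (m ^ N))\<^sup>2"
    unfolding B_def X_def using A mu m by (intro concentration) (auto simp: m_def)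
  have "\<epsilon> * real (card X) * real (card B) * (\<mu> - 1)\<^sup>2 \<le> real (card A) * real (card B) * (\<mu> - 1)\<^sup>2"
    using eps(1) unfolding cX m_def by (intro mult_right_mono) auto
  also have "\<dots> \<le> 4000 * (real (card X))\<^sup>2"
    using conc by (simp add: cX)
  finally have "real (card X) * ((\<epsilon> * (\<mu> - 1)\<^sup>2) * real (card B)) \<le> real (card X) * (4000 * real (card X))"
    by (simp add: power2_eq_square algebra_simps)
  then have "(\<epsilon> * (\<mu> - 1)\<^sup>2) * real (card B) \<le> 4000 * real (card X)" using X0 by simp
  also have "\<dots> \<le> 4000 * real p * real (card B)" using le by simp
  finally have "\<not> real (card B) > 0"
    using mu(2) mult_strict_right_mono[OF mu(2), of "real (card B)"] by linarith
  then show False using le X0 by simp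
qed

lemma unit_root_eq_iff:
  assumes "m > 0"
  shows "unit_root m a = unit_root m b \<longleftrightarrow> a mod m = b mod m"
  using complex_root_unity_eq[of m a b] assms
  by (simp add: unit_root_def cis_conv_exp algebra_simps)

text \<open>A dense set would contain two points that almost differ by the rotation by \<open>unit_root p 1\<close>;
  those are about \<open>sqrt N\<close> apart.\<close>

lemma small_ball:
  assumes p: "p > 1" and eps: "\<epsilon> > 0"
  shows "\<exists>N0>0. \<forall>N\<ge>N0. \<forall>v. real (card {x \<in> words N (p * N). nrm N (\<lambda>i. wvec (p * N) x i - v i) \<le> r})
           \<le> \<epsilon> * real ((p * N) ^ N)"
proof -
  \<comment> \<open>With this choice \<open>\<epsilon> * (\<mu> - 1)\<^sup>2\<close> equals
    \<open>4000 * p + \<epsilon>\<close>, just above the threshold of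
    \<open>spread_rotates\<close>.\<close>
  define \<mu> where "\<mu> = 1 + sqrt (4000 * real p / \<epsilon> + 1)"
  have mu: "\<mu> \<ge> 1" "\<epsilon> * (\<mu> - 1)\<^sup>2 > 4000 * real p"
    using eps by (auto simp: \<mu>_def field_simps)
  have g: "cmod (1 - unit_root p 1) > 0"
    using unit_root_eq_iff[of p 0 1] p by simp
  \<comment> \<open>The path from \<open>a\<close> over \<open>v\<close>, \<open>b\<close> and the
    rotate of \<open>x\<close> to the rotate of \<open>a\<close> has length at most
    \<open>2 * r + 2 * \<mu>\<close>; from \<open>N0\<close> on, its endpoints are farther apart
    than that.\<close>
  define N0 where "N0 = nat \<lceil>((2 * \<bar>r\<bar> + 2 * \<mu>) / cmod (1 - unit_root p 1))\<^sup>2\<rceil> + 1"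
  have "real (card {x \<in> words N (p * N). nrm N (\<lambda>i. wvec (p * N) x i - v i) \<le> r}) \<le> \<epsilon> * real ((p * N) ^ N)"
    (is "real (card ?A) \<le> _") if N: "N \<ge> N0" for N v
  proof (rule ccontr)
    assume "\<not> ?thesis"
    then have big: "real (card ?A) \<ge> \<epsilon> * real ((p * N) ^ N)" by simp
    have N': "N > 0" using N by (simp add: N0_def)
    obtain x where x: "\<And>j. j < p \<Longrightarrow> \<exists>a\<in>?A. nrm N (\<lambda>i. wvec (p * N) a i - unit_root p j * wvec (p * N) x i) \<le> \<mu>"
      using spread_rotates[OF _ _ N' big eps mu] p by auto
    obtain a where a: "a \<in> ?A" "nrm N (\<lambda>i. wvec (p * N) a i - wvec (p * N) x i) \<le> \<mu>"
      using x[of 0] p by auto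
    obtain b where b: "b \<in> ?A" "nrm N (\<lambda>i. wvec (p * N) b i - unit_root p 1 * wvec (p * N) x i) \<le> \<mu>"
      using x[of 1] p by auto
    let ?w = "unit_root p 1" and ?v = "wvec (p * N)"
    have "cmod (1 - ?w) * sqrt (real N) = nrm N (\<lambda>i. ?v a i - ?w * ?v a i)"
      by (simp add: nrm_rotate_wvec)
    also have "\<dots> \<le> nrm N (\<lambda>i. ?v a i - v i) + nrm N (\<lambda>i. v i - ?v b i)
        + nrm N (\<lambda>i. ?v b i - ?w * ?v x i) + nrm N (\<lambda>i. ?w * ?v x i - ?w * ?v a i)"
      using nrm_diff_triangle[of N "?v a" "\<lambda>i. ?w * ?v a i" v]
        nrm_diff_triangle[of N v "\<lambda>i. ?w * ?v a i" "?v b"]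
        nrm_diff_triangle[of N "?v b" "\<lambda>i. ?w * ?v a i" "\<lambda>i. ?w * ?v x i"] by linarith
    also have "\<dots> \<le> r + r + \<mu> + \<mu>"
      using a b by (intro add_mono) (auto simp: nrm_scale_diff nrm_minus_commute[of N v] nrm_minus_commute[of N "?v x"])
    also have "\<dots> \<le> 2 * \<bar>r\<bar> + 2 * \<mu>" by simp
    finally have "sqrt (real N) \<le> (2 * \<bar>r\<bar> + 2 * \<mu>) / cmod (1 - ?w)"
      using g by (simp add: le_divide_eq mult.commute)
    then have "real N \<le> ((2 * \<bar>r\<bar> + 2 * \<mu>) / cmod (1 - ?w))\<^sup>2"
      by (rule sqrt_le_D)
    then show False using N unfolding N0_def by linarith
  qed
  moreover have "N0 > 0" by (simp add: N0_def)
  ultimately show ?thesis by blast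
qed

section \<open>Anticoncentration of the Hermitian form\<close>

definition herm :: "nat \<Rightarrow> nat \<Rightarrow> nat list \<Rightarrow> nat list \<Rightarrow> complex" where
  "herm N m x y = (\<Sum>i<N. wvec m x i * cnj (wvec m y i))"

lemma herm_Cons:
  "herm (Suc N) m (a # x) (b # y) = unit_root m a * cnj (unit_root m b) + herm N m x y"
  unfolding herm_def wvec_def by (subst sum.lessThan_Suc_shift) simp

lemma cnj_unit_root: "b \<le> m \<Longrightarrow> m > 0 \<Longrightarrow> cnj (unit_root m b) = unit_root m (m - b)"
proof -
  assume "b \<le> m" "m > 0"
  then have "unit_root m b * unit_root m (m - b) = 1"
    by (simp add: unit_root_self flip: unit_root_add)
  moreover have "unit_root m b * cnj (unit_root m b) = 1"
    by (simp add: complex_norm_square[symmetric])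
  ultimately show ?thesis
    by (metis mult.commute mult.left_commute mult.right_neutral)
qed

text \<open>Up to the factor \<open>m\<close>, the characteristic function of the imaginary part of
  a uniformly random \<open>m\<close>-th root of unity.\<close>

definition char_fun :: "nat \<Rightarrow> real \<Rightarrow> complex" where
  "char_fun m u = (\<Sum>a<m. cis (u * Im (unit_root m a)))"

text \<open>The coordinates are independent, and multiplying by the conjugate of a fixed root
  permutes the roots, so the result does not depend on \<open>y\<close>.\<close>

lemma sum_cis_herm:
  assumes "m > 0" "y \<in> words N m"
  shows "(\<Sum>x\<in>words N m. cis (u * Im (herm N m x y))) = char_fun m u ^ N"
  using assms(2)
proof (induction N arbitrary: y)
  case 0
  then show ?case by (simp add: words_0 herm_def)
next
  case (Suc N)
  then obtain b z where y: "y = b # z" and b: "b < m" and z: "z \<in> words N m"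
    by (auto simp: words_def length_Suc_conv)
  have "(\<Sum>a<m. cis (u * Im (unit_root m a * cnj (unit_root m b))))
      = (\<Sum>a<m. cis (u * Im (unit_root m ((a + (m - b)) mod m))))"
    using b assms(1) by (simp only: cnj_unit_root unit_root_mod unit_root_add less_imp_le)
  also have "\<dots> = char_fun m u"
    unfolding char_fun_def using bij_betw_add_mod[of "m - b" m] assms(1)
    by (intro sum.reindex_bij_betw[where g = "\<lambda>a. cis (u * Im (unit_root m a))"]) auto
  finally have *: "(\<Sum>a<m. cis (u * Im (unit_root m a * cnj (unit_root m b)))) = char_fun m u" .
  have "(\<Sum>x\<in>words (Suc N) m. cis (u * Im (herm (Suc N) m x y)))
      = (\<Sum>a<m. \<Sum>x\<in>words N m. cis (u * Im (unit_root m a * cnj (unit_root m b))) * cis (u * Im (herm N m x z)))"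
    unfolding sum_words_Suc y herm_Cons cis_mult by (simp add: distrib_left)
  also have "\<dots> = char_fun m u * char_fun m u ^ N"
    unfolding sum_product[symmetric] Suc.IH[OF z] * ..
  finally show ?case by simp
qed

lemma Im_char_fun: "m > 0 \<Longrightarrow> Im (char_fun m u) = 0"
proof -
  assume m: "m > 0"
  let ?r = "\<lambda>a. (m - a) mod m"
  have rr: "?r (?r a) = a" if "a < m" for a
    using that by (cases "a = 0") auto
  have bij: "bij_betw ?r {..<m} {..<m}"
    by (rule bij_betw_byWitness[where f' = ?r]) (use rr m in auto)
  have "(\<Sum>a<m. sin (u * Im (unit_root m a))) = (\<Sum>a<m. sin (u * Im (unit_root m (?r a))))"
    by (rule sum.reindex_bij_betw[symmetric, OF bij])
  also have "\<dots> = (\<Sum>a<m. sin (u * Im (cnj (unit_root m a))))"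
    using m by (intro sum.cong refl) (simp only: unit_root_mod cnj_unit_root lessThan_iff less_imp_le)
  also have "\<dots> = - (\<Sum>a<m. sin (u * Im (unit_root m a)))" by (simp add: sum_negf)
  finally show ?thesis by (simp add: char_fun_def)
qed

text \<open>By the double angle formula the sum differs from \<open>m / 2\<close> by a geometric sum
  of powers of \<open>unit_root m 2\<close>, which vanishes because \<open>m \<ge> 3\<close> makes
  this ratio different from 1.\<close>

lemma sum_Im_unit_root_squared:
  assumes "m \<ge> 3"
  shows "(\<Sum>a<m. (Im (unit_root m a))\<^sup>2) = real m / 2"
proof -
  have ne: "unit_root m 2 \<noteq> 1"
    using unit_root_eq_iff[of m 2 0] assms by simp
  have pow: "unit_root m (k * a) = unit_root m k ^ a" for k a
    by (induction a) (simp_all add: unit_root_add)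
  have "(\<Sum>a<m. unit_root m (2 * a)) = (unit_root m 2 ^ m - 1) / (unit_root m 2 - 1)"
    unfolding pow using ne by (simp add: geometric_sum)
  also have "unit_root m 2 ^ m = 1"
    using pow[of 2 m] unit_root_mult[of m 2] assms by (simp add: mult.commute)
  finally have zero: "(\<Sum>a<m. unit_root m (2 * a)) = 0" by simp
  have "(Im (unit_root m a))\<^sup>2 = (1 - Re (unit_root m (2 * a))) / 2" for a
  proof -
    have "Re (unit_root m (2 * a)) = (Re (unit_root m a))\<^sup>2 - (Im (unit_root m a))\<^sup>2"
      by (simp add: mult_2 unit_root_add power2_eq_square)
    moreover have "(Re (unit_root m a))\<^sup>2 + (Im (unit_root m a))\<^sup>2 = 1"
      by (simp flip: cmod_power2)
    ultimately show ?thesis by simp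
  qed
  then have "(\<Sum>a<m. (Im (unit_root m a))\<^sup>2) = (\<Sum>a<m. (1 - Re (unit_root m (2 * a))) / 2)"
    by (intro sum.cong refl)
  also have "\<dots> = (real m - Re (\<Sum>a<m. unit_root m (2 * a))) / 2"
    by (simp add: sum_subtractf flip: sum_divide_distrib)
  finally have "(\<Sum>a<m. (Im (unit_root m a))\<^sup>2) = (real m - Re (\<Sum>a<m. unit_root m (2 * a))) / 2" .
  then show ?thesis by (simp add: zero)
qed

lemma cos_1_ge_half: "cos (1::real) \<ge> 1 / 2"
proof -
  have "cos (pi / 3) \<le> cos (1::real)"
    using pi_gt3 pi_less_4 by (intro cos_monotone_0_pi_le) auto
  then show ?thesis by (simp add: cos_60)
qed

text \<open>Integrating \<open>cos \<ge> 1 / 2\<close> on the unit interval twice gives the constant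
  \<open>1 / 4\<close>, weaker than the Taylor bound but enough for geometric decay.\<close>

lemma cos_le_quadratic:
  fixes v :: real
  assumes "\<bar>v\<bar> \<le> 1"
  shows "cos v \<le> 1 - v\<^sup>2 / 4"
proof -
  have half: "cos t \<ge> 1 / 2" if "0 \<le> t" "t \<le> 1" for t :: real
    using cos_monotone_0_pi_le[of t 1] that pi_gt3 cos_1_ge_half by linarith
  have sin: "sin t \<ge> t / 2" if t: "0 \<le> t" "t \<le> 1" for t :: real
  proof -
    have "sin 0 - 0 / 2 \<le> sin t - t / 2"
    proof (rule DERIV_nonneg_imp_nondecreasing[OF t(1), where f = "\<lambda>t. sin t - t / 2"])
      fix x assume "0 \<le> x" "x \<le> t"
      then have "((\<lambda>t. sin t - t / 2) has_real_derivative (cos x - 1 / 2)) (at x) \<and> 0 \<le> cos x - 1 / 2"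
        using half[of x] t by (auto intro!: derivative_eq_intros)
      then show "\<exists>y. ((\<lambda>t. sin t - t / 2) has_real_derivative y) (at x) \<and> 0 \<le> y" by blast
    qed
    then show ?thesis by simp
  qed
  define w where "w = \<bar>v\<bar>"
  have "(1 - 0\<^sup>2 / 4 - cos 0) \<le> 1 - w\<^sup>2 / 4 - cos w"
  proof (rule DERIV_nonneg_imp_nondecreasing[where f = "\<lambda>t. 1 - t\<^sup>2 / 4 - cos t"])
    show "0 \<le> w" by (simp add: w_def)
    fix x assume "0 \<le> x" "x \<le> w"
    then have "((\<lambda>t. 1 - t\<^sup>2 / 4 - cos t) has_real_derivative (sin x - x / 2)) (at x) \<and> 0 \<le> sin x - x / 2"
      using sin[of x] assms by (auto intro!: derivative_eq_intros simp: w_def)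
    then show "\<exists>y. ((\<lambda>t. 1 - t\<^sup>2 / 4 - cos t) has_real_derivative y) (at x) \<and> 0 \<le> y" by blast
  qed
  then show ?thesis by (simp add: w_def)
qed

text \<open>The roots are closed under conjugation, so the sum is real, and for small
  \<open>u\<close> it is nonnegative; its modulus is therefore a sum of cosines.\<close>

lemma norm_char_fun_le:
  assumes "m \<ge> 3" "\<bar>u\<bar> \<le> 1"
  shows "cmod (char_fun m u) \<le> real m * (1 - u\<^sup>2 / 8)"
proof -
  have v: "\<bar>u * Im (unit_root m a)\<bar> \<le> 1" for a
    using abs_Im_le_cmod[of "unit_root m a"] assms(2) by (simp add: abs_mult mult_le_one)
  have "0 \<le> Re (char_fun m u)"
    unfolding char_fun_def Re_sum
  proof (intro sum_nonneg)
    fix a assume "a \<in> {..<m}"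
    show "0 \<le> Re (cis (u * Im (unit_root m a)))"
      using v[of a] pi_gt3 by (auto intro!: cos_ge_zero)
  qed
  then have "cmod (char_fun m u) = Re (char_fun m u)"
    using Im_char_fun[of m u] assms(1) by (simp add: cmod_def)
  also have "\<dots> \<le> (\<Sum>a<m. 1 - (u * Im (unit_root m a))\<^sup>2 / 4)"
    unfolding char_fun_def Re_sum using v by (intro sum_mono) (simp add: cos_le_quadratic)
  also have "\<dots> = real m - u\<^sup>2 / 4 * (\<Sum>a<m. (Im (unit_root m a))\<^sup>2)"
    by (simp add: sum_subtractf power_mult_distrib sum_distrib_left)
  also have "\<dots> = real m * (1 - u\<^sup>2 / 8)"
    by (simp add: sum_Im_unit_root_squared[OF assms(1)] algebra_simps)
  finally show ?thesis .
qed

text \<open>If \<open>\<bar>Y\<bar> < \<tau>\<close>, then the \<open>J\<close> points \<open>cis (j Y / (J \<tau>))\<close> with \<open>j < J\<close> all have real part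
  at least \<open>1 / 2\<close>, while their sum has mean square about \<open>J\<close> because the characteristic function
  of \<open>Y\<close> decays geometrically in \<open>N\<close>.\<close>

lemma anticoncentration_herm:
  assumes tau: "\<tau> \<ge> 1" and eta: "\<eta> > 0"
  shows "\<exists>N0. \<forall>N\<ge>N0. \<forall>m\<ge>3. \<forall>y\<in>words N m.
           real (card {x \<in> words N m. \<bar>Im (herm N m x y)\<bar> < \<tau>}) \<le> \<eta> * real (m ^ N)"
proof -
  \<comment> \<open>Each bad \<open>x\<close> contributes at least \<open>(J / 2)\<^sup>2\<close>.
    Per word, the diagonal terms cost \<open>J \<le> \<eta> * J\<^sup>2 / 8\<close>, and
    \<open>N0\<close> is taken so large that the others cost at most as much again.\<close>
  define J where "J = nat \<lceil>8 / \<eta>\<rceil> + 1"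
  have J: "J > 0" "8 / \<eta> \<le> real J" by (simp add: J_def) (simp add: J_def, linarith)
  \<comment> \<open>For a bad \<open>x\<close> all angles \<open>s * j * Y x\<close> are at most 1
    in absolute value. As \<open>\<tau> \<ge> 1\<close>, all frequencies \<open>s * (j - k)\<close>
    are within reach of \<open>norm_char_fun_le\<close>, and for \<open>j \<noteq> k\<close> they
    are at least \<open>s\<close>, which gives the common rate \<open>\<kappa>\<close>.\<close>
  define s where "s = 1 / (real J * \<tau>)"
  have s: "s > 0" "s * real J * \<tau> = 1" using J tau by (auto simp: s_def)
  define \<kappa> where "\<kappa> = 1 - s\<^sup>2 / 8"
  have sJ: "s * real J \<le> 1" using s tau by (metis mult_left_mono mult.right_neutral mult_nonneg_nonneg less_imp_le of_nat_0_le_iff)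
  have "s \<le> s * real J" using s J by simp
  then have s1: "s \<le> 1" using sJ by linarith
  have kap: "0 \<le> \<kappa>" "\<kappa> < 1"
    using s power_le_one[of s 2] s1 by (auto simp: \<kappa>_def)
  obtain N0 where N0: "\<kappa> ^ N0 < \<eta> / 8" using real_arch_pow_inv[of "\<eta> / 8" \<kappa>] kap eta by auto
  have "real (card {x \<in> words N m. \<bar>Im (herm N m x y)\<bar> < \<tau>}) \<le> \<eta> * real (m ^ N)"
    (is "real (card ?B) \<le> _") if N: "N \<ge> N0" and m: "m \<ge> 3" and y: "y \<in> words N m" for N m y
  proof -
    let ?X = "words N m"
    define Y where "Y = (\<lambda>x. Im (herm N m x y))"
    define K where "K = (\<lambda>x. \<Sum>j<J. cis (s * real j * Y x))"
    have "real (card ?B) * ((real J)\<^sup>2 / 4) = (\<Sum>x\<in>?B. (real J / 2)\<^sup>2)" by (simp add: power_divide)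
    also have "\<dots> \<le> (\<Sum>x\<in>?B. (cmod (K x))\<^sup>2)"
    proof (intro sum_mono power_mono)
      fix x assume x: "x \<in> ?B"
      have "real J / 2 = (\<Sum>j<J. 1 / 2)" by simp
      also have "\<dots> \<le> (\<Sum>j<J. cos (s * real j * Y x))"
      proof (intro sum_mono)
        fix j assume j: "j \<in> {..<J}"
        have "\<bar>s * real j * Y x\<bar> = s * real j * \<bar>Y x\<bar>" using s by (simp add: abs_mult)
        also have "\<dots> \<le> s * real J * \<tau>"
          using s x j tau by (intro mult_mono) (auto simp: Y_def)
        finally have le: "\<bar>s * real j * Y x\<bar> \<le> 1" using s by simp
        have "cos 1 \<le> cos \<bar>s * real j * Y x\<bar>"
          using le pi_gt3 by (intro cos_monotone_0_pi_le) auto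
        then show "1 / 2 \<le> cos (s * real j * Y x)" using cos_1_ge_half by simp
      qed
      also have "\<dots> = Re (K x)" by (simp add: K_def)
      also have "\<dots> \<le> cmod (K x)" by (rule complex_Re_le_cmod)
      finally show "real J / 2 \<le> cmod (K x)" .
    qed simp
    also have "\<dots> \<le> (\<Sum>x\<in>?X. (cmod (K x))\<^sup>2)" by (intro sum_mono2) auto
    also have "\<dots> = Re (\<Sum>x\<in>?X. K x * cnj (K x))"
      by (simp add: complex_norm_square[symmetric] del: of_real_power)
    also have "(\<Sum>x\<in>?X. K x * cnj (K x))
        = (\<Sum>x\<in>?X. \<Sum>j<J. \<Sum>k<J. cis (s * (real j - real k) * Y x))"
      unfolding K_def cnj_sum sum_product by (simp add: cis_cnj cis_mult algebra_simps)
    also have "\<dots> = (\<Sum>j<J. \<Sum>k<J. \<Sum>x\<in>?X. cis (s * (real j - real k) * Y x))"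
      by (subst sum.swap, subst (2) sum.swap) simp
    also have "\<dots> = (\<Sum>j<J. \<Sum>k<J. char_fun m (s * (real j - real k)) ^ N)"
      unfolding Y_def using sum_cis_herm[OF _ y] m by simp
    also have "Re \<dots> \<le> (\<Sum>j<J. \<Sum>k<J. (if j = k then real (m ^ N) else 0) + real (m ^ N) * \<kappa> ^ N)"
      unfolding Re_sum
    proof (intro sum_mono)
      fix j k assume jk: "j \<in> {..<J}" "k \<in> {..<J}"
      show "Re (char_fun m (s * (real j - real k)) ^ N) \<le> (if j = k then real (m ^ N) else 0) + real (m ^ N) * \<kappa> ^ N"
      proof (cases "j = k")
        case True
        then show ?thesis using kap by (simp add: char_fun_def)
      next
        case False
        define d where "d = \<bar>real j - real k\<bar>"
        have d: "1 \<le> d" "d \<le> real J" using False jk by (auto simp: d_def)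
        have u: "\<bar>s * (real j - real k)\<bar> = s * d" using s by (simp add: abs_mult d_def)
        have "s * d \<le> s * real J" using s d by simp
        then have u1: "\<bar>s * (real j - real k)\<bar> \<le> 1" using u sJ by linarith
        have "s \<le> s * d" using s d by simp
        then have "s\<^sup>2 \<le> (s * d)\<^sup>2" using s by (intro power_mono) auto
        also have "(s * d)\<^sup>2 = (s * (real j - real k))\<^sup>2" unfolding u[symmetric] by (rule power2_abs)
        finally have "real m * (1 - (s * (real j - real k))\<^sup>2 / 8) \<le> real m * \<kappa>"
          unfolding \<kappa>_def by (intro mult_left_mono) auto
        then have "cmod (char_fun m (s * (real j - real k))) \<le> real m * \<kappa>"
          using norm_char_fun_le[OF m u1] by linarith
        then have "cmod (char_fun m (s * (real j - real k)) ^ N) \<le> (real m * \<kappa>) ^ N"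
          unfolding norm_power by (intro power_mono) auto
        then show ?thesis
          using False complex_Re_le_cmod[of "char_fun m (s * (real j - real k)) ^ N"]
          by (simp add: power_mult_distrib)
      qed
    qed
    also have "\<dots> = (real J + (real J)\<^sup>2 * \<kappa> ^ N) * real (m ^ N)"
      by (simp add: sum.distrib power2_eq_square algebra_simps)
    also have "\<dots> \<le> (\<eta> * (real J)\<^sup>2 / 4) * real (m ^ N)"
    proof (intro mult_right_mono)
      have "8 \<le> \<eta> * real J" using J eta by (simp add: field_simps)
      then have "8 * real J \<le> \<eta> * real J * real J" by (intro mult_right_mono) auto
      moreover have "\<kappa> ^ N \<le> \<eta> / 8" using power_decreasing[OF N, of \<kappa>] kap N0 by linarith
      then have "(real J)\<^sup>2 * \<kappa> ^ N \<le> (real J)\<^sup>2 * (\<eta> / 8)" by (intro mult_left_mono) auto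
      ultimately show "real J + (real J)\<^sup>2 * \<kappa> ^ N \<le> \<eta> * (real J)\<^sup>2 / 4"
        by (simp add: power2_eq_square algebra_simps)
    qed simp
    finally have "real (card ?B) * ((real J)\<^sup>2 / 4) \<le> (\<eta> * real (m ^ N)) * ((real J)\<^sup>2 / 4)"
      by (simp add: algebra_simps)
    then show ?thesis using J by (simp add: mult_le_cancel_right)
  qed
  then show ?thesis by blast
qed

section \<open>The cross adjacency\<close>

text \<open>The sector is half-open, so that its rotates tile without overlap. Zero must be excluded
  by hand because \<open>Arg2pi 0 = 0\<close>.\<close>

definition in_sector :: "nat \<Rightarrow> nat \<Rightarrow> complex \<Rightarrow> bool" where
  "in_sector p l z \<longleftrightarrow> z \<noteq> 0 \<and> Arg2pi z < 2 * pi * real l / real p"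

text \<open>\<open>\<bar>Im (unit_root p k * z)\<bar>\<close> is the distance of \<open>z\<close>
  from the line through the conjugate of \<open>unit_root p k\<close>. Among these lines are the two
  that bound the sector; asking for all \<open>p\<close> of them gives the margin in every direction
  \<open>unit_root p k\<close>, up to sign.\<close>

definition cross_adj :: "nat \<Rightarrow> nat \<Rightarrow> real \<Rightarrow> complex \<Rightarrow> bool" where
  "cross_adj p l \<tau> z \<longleftrightarrow> in_sector p l z \<and> (\<forall>k<p. \<tau> \<le> \<bar>Im (unit_root p k * z)\<bar>)"

text \<open>The plane without the origin splits into \<open>p\<close> half-open sectors of angle
  \<open>2 * \<pi> / p\<close>. If \<open>z\<close> lies in the one numbered \<open>k\<close>, its
  rotate lies in the one numbered \<open>(j + k) mod p\<close>, and the sector in question is the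
  union of the first \<open>l\<close>.\<close>

lemma card_rotations_in_sector:
  assumes "z \<noteq> 0" "p > 0" "l \<le> p"
  shows "card {j \<in> {..<p}. in_sector p l (unit_root p j * z)} = l"
proof -
  define t where "t = real p * Arg2pi z / (2 * pi)"
  have t: "0 \<le> t" "t < real p"
    using Arg2pi_ge_0[of z] Arg2pi_lt_2pi[of z] assms(2) by (auto simp: t_def divide_less_eq mult.commute)
  define k where "k = nat \<lfloor>t\<rfloor>"
  define r where "r = t - real k"
  have k: "k < p" and r: "0 \<le> r" "r < 1" and tk: "t = real k + r"
    using t by (auto simp: k_def r_def) linarith+
  have z: "z = of_real (cmod z) * cis (2 * pi * t / real p)"
    using Arg2pi_eq[of z] assms(2) by (simp add: t_def cis_conv_exp)
  have sec: "in_sector p l (unit_root p j * z) \<longleftrightarrow> (j + k) mod p < l" for j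
  proof -
    let ?k = "(j + k) mod p"
    have "unit_root p j * cis (2 * pi * t / real p) = unit_root p (j + k) * cis (2 * pi * r / real p)"
      by (simp add: unit_root_def cis_mult tk add_divide_distrib distrib_left add.assoc)
    also have "unit_root p (j + k) = unit_root p ?k" using assms(2) by (simp add: unit_root_mod)
    also have "\<dots> * cis (2 * pi * r / real p) = cis (2 * pi * (real ?k + r) / real p)"
      by (simp add: unit_root_def cis_mult add_divide_distrib distrib_left)
    finally have "of_real (cmod z) * exp (\<i> * of_real (2 * pi * (real ?k + r) / real p)) = unit_root p j * z"
      by (subst (2) z) (simp add: cis_conv_exp mult.left_commute)
    moreover have "?k < p" using assms(2) by simp
    then have "real ?k + r < real p" using r(2) by linarith
    then have "2 * pi * (real ?k + r) / real p < 2 * pi"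
      using assms(2) by (simp add: divide_less_eq)
    ultimately have "Arg2pi (unit_root p j * z) = 2 * pi * (real ?k + r) / real p"
      using assms(1) r(1) by (intro Arg2pi_unique) auto
    moreover have "unit_root p j * z \<noteq> 0" using assms(1) by (metis mult_eq_0_iff norm_unit_root norm_zero zero_neq_one)
    ultimately have "in_sector p l (unit_root p j * z) \<longleftrightarrow> real ?k + r < real l"
      using assms(2) by (simp add: in_sector_def divide_less_cancel)
    also have "\<dots> \<longleftrightarrow> ?k < l" using r by linarith
    finally show ?thesis .
  qed
  have bij: "bij_betw (\<lambda>j. (j + k) mod p) {..<p} {..<p}"
    using k by (intro bij_betw_add_mod) auto
  have "bij_betw (\<lambda>j. (j + k) mod p) {j \<in> {..<p}. (j + k) mod p < l} {..<l}"
  proof (rule bij_betw_subset[OF bij])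
    show "(\<lambda>j. (j + k) mod p) ` {j \<in> {..<p}. (j + k) mod p < l} = {..<l}"
    proof (intro equalityI subsetI)
      fix i assume "i \<in> {..<l}"
      then have "i \<in> (\<lambda>j. (j + k) mod p) ` {..<p}" using bij assms(3) by (auto simp: bij_betw_def)
      then show "i \<in> (\<lambda>j. (j + k) mod p) ` {j \<in> {..<p}. (j + k) mod p < l}"
        using \<open>i \<in> {..<l}\<close> by auto
    qed auto
  qed auto
  then have "card {j \<in> {..<p}. (j + k) mod p < l} = card {..<l}" by (rule bij_betw_same_card)
  then show ?thesis by (simp add: sec)
qed

lemma herm_rot:
  assumes "x \<in> words N (p * N)" "p > 0"
  shows "herm N (p * N) (rot (p * N) (j * N) x) y = unit_root p j * herm N (p * N) x y"
  unfolding herm_def sum_distrib_left using assms by (intro sum.cong) (simp_all add: wvec_rot mult.assoc)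

lemma card_words_rot:
  assumes "j \<le> p" "p > 0" "N > 0"
  shows "card {x \<in> words N (p * N). P (unit_root p j * herm N (p * N) x y)}
       = card {x \<in> words N (p * N). P (herm N (p * N) x y)}"
proof -
  let ?X = "words N (p * N)" and ?r = "rot (p * N) (j * N)"
  have bij: "bij_betw ?r ?X ?X" using assms by (intro bij_betw_rot) auto
  have "bij_betw ?r {x \<in> ?X. P (herm N (p * N) (?r x) y)} {x \<in> ?X. P (herm N (p * N) x y)}"
  proof (rule bij_betw_subset[OF bij])
    show "?r ` {x \<in> ?X. P (herm N (p * N) (?r x) y)} = {x \<in> ?X. P (herm N (p * N) x y)}"
      using bij by (auto simp: bij_betw_def)
  qed auto
  then have "card {x \<in> ?X. P (herm N (p * N) (?r x) y)} = card {x \<in> ?X. P (herm N (p * N) x y)}"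
    by (rule bij_betw_same_card)
  moreover have "{x \<in> ?X. P (herm N (p * N) (?r x) y)} = {x \<in> ?X. P (unit_root p j * herm N (p * N) x y)}"
    using assms by (auto simp: herm_rot)
  ultimately show ?thesis by simp
qed

lemma card_filter:
  "finite A \<Longrightarrow> card {x \<in> A. P x} = (\<Sum>x\<in>A. if P x then 1 else 0)"
  using sum.inter_filter[of A "\<lambda>_. 1 :: nat" P] by simp

text \<open>Rotating \<open>x\<close> permutes the words, so averaging over the \<open>p\<close>
  rotates shows that exactly the fraction \<open>l / p\<close> of the words with
  \<open>h x \<noteq> 0\<close> falls into the sector. The error consists of the zeros, at most as
  many as the words near one line, and of the words near one of the \<open>p\<close> lines, equally
  many for each; hence the factor \<open>p + 1\<close>.\<close>

lemma cross_density:
  fixes y :: "nat list"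
  assumes "p > 0" "N > 0" "l \<le> p" "\<tau> > 0"
  defines "X \<equiv> words N (p * N)"
  defines "h \<equiv> \<lambda>x. herm N (p * N) x y"
  shows "\<bar>real (card {x \<in> X. cross_adj p l \<tau> (h x)}) - real l / real p * real (card X)\<bar>
           \<le> real (p + 1) * real (card {x \<in> X. \<bar>Im (h x)\<bar> < \<tau>})"
proof -
  have fin: "finite X" by (simp add: X_def)
  define b where "b = card {x \<in> X. \<bar>Im (h x)\<bar> < \<tau>}"
  define Bad where "Bad = {x \<in> X. \<exists>k<p. \<bar>Im (unit_root p k * h x)\<bar> < \<tau>}"
  define S where "S = {x \<in> X. in_sector p l (h x)}"
  have "Bad = (\<Union>k<p. {x \<in> X. \<bar>Im (unit_root p k * h x)\<bar> < \<tau>})" by (auto simp: Bad_def)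
  then have "card Bad \<le> (\<Sum>k<p. card {x \<in> X. \<bar>Im (unit_root p k * h x)\<bar> < \<tau>})"
    by (simp add: card_UN_le)
  also have "\<dots> = (\<Sum>k<p. b)"
    unfolding b_def X_def h_def using assms(1,2)
    by (intro sum.cong refl card_words_rot[where P = "\<lambda>z. \<bar>Im z\<bar> < \<tau>"]) auto
  finally have bad: "card Bad \<le> p * b" by simp
  define Z where "Z = {x \<in> X. h x = 0}"
  have Zb: "card Z \<le> b" unfolding b_def Z_def using fin assms(4) by (intro card_mono) auto
  have "p * card S = (\<Sum>j<p. card {x \<in> X. in_sector p l (unit_root p j * h x)})"
    using card_words_rot[of _ p N "in_sector p l" y] assms(1,2) unfolding S_def X_def h_def by simp
  also have "\<dots> = (\<Sum>j<p. \<Sum>x\<in>X. if in_sector p l (unit_root p j * h x) then 1 else 0)"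
    by (simp only: card_filter[OF fin])
  also have "\<dots> = (\<Sum>x\<in>X. \<Sum>j<p. if in_sector p l (unit_root p j * h x) then 1 else 0)"
    by (rule sum.swap)
  also have "\<dots> = (\<Sum>x\<in>X. card {j \<in> {..<p}. in_sector p l (unit_root p j * h x)})"
    by (simp only: card_filter[OF finite_lessThan])
  also have "\<dots> = (\<Sum>x\<in>X. if h x \<noteq> 0 then l else 0)"
  proof (intro sum.cong refl)
    fix x
    show "card {j \<in> {..<p}. in_sector p l (unit_root p j * h x)} = (if h x \<noteq> 0 then l else 0)"
    proof (cases "h x = 0")
      case True
      then show ?thesis by (simp add: in_sector_def)
    next
      case False
      then show ?thesis using card_rotations_in_sector[OF False assms(1,3)] by simp
    qed
  qed
  also have "\<dots> = l * card {x \<in> X. h x \<noteq> 0}"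
    using fin sum.inter_filter[of X "\<lambda>_. l" "\<lambda>x. h x \<noteq> 0"] by (simp add: mult.commute)
  also have "card {x \<in> X. h x \<noteq> 0} = card (X - Z)" by (rule arg_cong[where f = card]) (auto simp: Z_def)
  also have "\<dots> = card X - card Z" using fin by (intro card_Diff_subset) (auto simp: Z_def)
  finally have "real (p * card S) = real (l * (card X - card Z))" by simp
  moreover have "card Z \<le> card X" using fin by (intro card_mono) (auto simp: Z_def)
  ultimately have pS: "real p * real (card S) = real l * (real (card X) - real (card Z))"
    by (simp add: of_nat_diff)
  have "{x \<in> X. cross_adj p l \<tau> (h x)} = S - Bad"
    by (auto simp: cross_adj_def S_def Bad_def not_less)
  moreover have "card S - card Bad \<le> card (S - Bad)"
    using fin by (intro diff_card_le_card_Diff) (auto simp: Bad_def)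
  moreover have "card (S - Bad) \<le> card S" using fin by (intro card_mono) (auto simp: S_def)
  ultimately have C: "real (card S) - real (card Bad) \<le> real (card {x \<in> X. cross_adj p l \<tau> (h x)})"
    "real (card {x \<in> X. cross_adj p l \<tau> (h x)}) \<le> real (card S)" by simp_all
  have Seq: "real (card S) = real l / real p * real (card X) - real l / real p * real (card Z)"
    using pS assms(1) by (simp add: field_simps)
  have "real l / real p * real (card Z) \<le> 1 * real b"
    using assms(1,3) Zb by (intro mult_mono) auto
  moreover have "0 \<le> real l / real p * real (card Z)" by simp
  moreover have "real (card Bad) \<le> real p * real b" using bad by (metis of_nat_le_iff of_nat_mult)
  moreover have "real (p + 1) * real b = real p * real b + real b" by (simp add: algebra_simps)
  moreover have "0 \<le> real b" "0 \<le> real p * real b" by simp_all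
  ultimately show ?thesis unfolding b_def[symmetric] abs_le_iff using C Seq by linarith
qed

section \<open>Linear relations between roots of unity\<close>

text \<open>Otherwise every offset from the least element is below \<open>l\<close> or above
  \<open>p - l\<close>; folding the large ones down by \<open>p - l\<close> injects \<open>J\<close>
  into \<open>l\<close> values.\<close>

lemma exists_pair_mid_distance:
  fixes J :: "nat set"
  assumes J: "J \<subseteq> {..<p}" and card: "l < card J" and l: "0 < l" "2 * l \<le> p"
  shows "\<exists>i\<in>J. \<exists>j\<in>J. i < j \<and> l \<le> j - i \<and> j - i \<le> p - l"
proof (rule ccontr)
  assume contra: "\<not> ?thesis"
  have fin: "finite J" using J finite_subset by blast
  have "J \<noteq> {}" using card by auto
  define a where "a = Min J"
  have a: "a \<in> J" and min: "\<And>x. x \<in> J \<Longrightarrow> a \<le> x"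
    using fin \<open>J \<noteq> {}\<close> by (auto simp: a_def)
  define f where "f = (\<lambda>x. if x - a < l then x - a else x - a - (p - l))"
  have far: "x - a < l \<or> p - l < x - a" if "x \<in> J" for x
  proof (rule ccontr)
    assume "\<not> ?thesis"
    then show False using contra a that min[OF that] l by (metis not_le not_less_zero diff_is_0_eq le_antisym less_le)
  qed
  have bound: "x < p" if "x \<in> J" for x using J that by auto
  have "inj_on f J"
  \<comment> \<open>A collision between a small and a folded offset would be a gap of exactly
    \<open>p - l\<close>, which is admissible because \<open>2 * l \<le> p\<close>.\<close>
  proof (rule linorder_inj_onI)
    fix x y assume xy: "x < y" "x \<in> J" "y \<in> J"
    have "\<not> (l \<le> y - x \<and> y - x \<le> p - l)" using contra xy by blast
    then show "f x \<noteq> f y"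
      using far[OF xy(2)] far[OF xy(3)] min[OF xy(2)] min[OF xy(3)] xy(1) l
      by (auto simp: f_def split: if_splits)
  qed (use fin in auto)
  moreover have "f ` J \<subseteq> {..<l}"
    using far bound l by (fastforce simp: f_def)
  ultimately have "card J \<le> card {..<l}" by (intro card_inj_on_le) auto
  then show False using card by simp
qed

text \<open>Elements of the dual cone of the sector; only for those that are roots of unity up to sign
  does \<open>cross_adj\<close> provide the margin \<open>\<tau>\<close>.\<close>

definition dual_dir :: "nat \<Rightarrow> nat \<Rightarrow> complex \<Rightarrow> bool" where
  "dual_dir p l c \<longleftrightarrow> (\<exists>\<phi>\<ge>0. \<phi> \<le> pi - 2 * pi * real l / real p \<and> c = cis \<phi>)
                    \<and> (\<exists>k<p. c = unit_root p k \<or> c = - unit_root p k)"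

lemma norm_dual_dir: "dual_dir p l c \<Longrightarrow> cmod c = 1"
  by (auto simp: dual_dir_def)

text \<open>Adding the angle of \<open>c\<close> keeps the argument of \<open>z\<close> within a
  half-turn, so the imaginary part is nonnegative; as \<open>c\<close> is a root of unity up to
  sign, \<open>cross_adj\<close> bounds its absolute value from below.\<close>

lemma Im_dual_dir_ge:
  assumes c: "dual_dir p l c" and z: "cross_adj p l \<tau> z" and tau: "\<tau> > 0"
  shows "\<tau> \<le> Im (c * z)"
proof -
  obtain \<phi> where phi: "\<phi> \<ge> 0" "\<phi> \<le> pi - 2 * pi * real l / real p" "c = cis \<phi>"
    using c by (auto simp: dual_dir_def)
  have th: "0 \<le> Arg2pi z" "Arg2pi z < 2 * pi * real l / real p"
    using z Arg2pi_ge_0 by (auto simp: cross_adj_def in_sector_def)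
  have "z = of_real (cmod z) * cis (Arg2pi z)"
    using Arg2pi_eq[of z] by (simp add: cis_conv_exp)
  then have "c * z = of_real (cmod z) * cis (\<phi> + Arg2pi z)"
    unfolding phi(3) by (metis cis_mult mult.left_commute)
  then have "Im (c * z) = cmod z * sin (\<phi> + Arg2pi z)" by simp
  moreover have "0 \<le> sin (\<phi> + Arg2pi z)"
    using phi th by (intro sin_ge_zero) auto
  ultimately have "0 \<le> Im (c * z)" by simp
  moreover have "\<tau> \<le> \<bar>Im (c * z)\<bar>"
    using c z unfolding dual_dir_def cross_adj_def by auto
  ultimately show ?thesis by simp
qed

text \<open>With \<open>e = j - i\<close>, the relation forces \<open>d / c\<close> to have angle
  \<open>\<pi> - 2 * \<pi> * e / p\<close>. A gap between \<open>l\<close> and \<open>p - l\<close>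
  makes this at most the width of the dual cone in absolute value; its sign decides which of
  \<open>c\<close> and \<open>d\<close> is set to 1.\<close>

lemma dual_pair_relation:
  assumes J: "J \<subseteq> {..<p}" and card: "l < card J" and l: "0 < l" "2 * l \<le> p"
  shows "\<exists>i\<in>J. \<exists>j\<in>J. \<exists>c d. dual_dir p l c \<and> dual_dir p l d \<and> c * unit_root p i + d * unit_root p j = 0"
proof -
  obtain i j where ij: "i \<in> J" "j \<in> J" "i < j" "l \<le> j - i" "j - i \<le> p - l"
    using exists_pair_mid_distance[OF assms] by blast
  define e where "e = j - i"
  have e: "l \<le> e" "e \<le> p - l" "e < p" "j = i + e" using ij l by (auto simp: e_def)
  have p: "p > 0" using l by simp
  have one: "dual_dir p l 1"
    unfolding dual_dir_def
  proof (intro conjI)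
    show "\<exists>\<phi>\<ge>0. \<phi> \<le> pi - 2 * pi * real l / real p \<and> 1 = cis \<phi>"
      using l p by (intro exI[of _ 0]) (auto simp: field_simps)
    show "\<exists>k<p. 1 = unit_root p k \<or> 1 = - unit_root p k"
      using p by (intro exI[of _ 0]) auto
  qed
  have neg: "cis (t + pi) = - cis t" "cis (t - pi) = - cis t" for t
    by (simp_all add: complex_eq_iff)
  show ?thesis
  proof (cases "2 * e \<le> p")
    case True
    define d where "d = - unit_root p (p - e)"
    have d1: "d * unit_root p e = - 1"
      using unit_root_self[OF p] e by (simp add: d_def flip: unit_root_add)
    have "unit_root p (p - e) = cis (2 * pi - 2 * pi * real e / real p)"
      using e p by (simp add: unit_root_def of_nat_diff field_simps)
    then have "d = cis (pi - 2 * pi * real e / real p)"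
      unfolding d_def using neg(2)[of "2 * pi - 2 * pi * real e / real p"] by (simp add: algebra_simps)
    moreover have "2 * pi * real e / real p \<le> pi"
      using True p by (simp add: divide_le_eq flip: of_nat_mult)
    moreover have "2 * pi * real l / real p \<le> 2 * pi * real e / real p"
      using e by (intro divide_right_mono) auto
    moreover have "p - e < p" using e l by simp
    ultimately have "dual_dir p l d"
      unfolding dual_dir_def d_def by (intro conjI exI[of _ "pi - 2 * pi * real e / real p"] exI[of _ "p - e"]) auto
    moreover have "1 * unit_root p i + d * unit_root p j = unit_root p i * (1 + d * unit_root p e)"
      by (simp add: e(4) unit_root_add algebra_simps)
    then have "1 * unit_root p i + d * unit_root p j = 0" by (simp only: d1) simp
    ultimately show ?thesis using one ij by blast
  next
    case False
    define c where "c = - unit_root p e"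
    have "c = cis (2 * pi * real e / real p - pi)"
      unfolding c_def unit_root_def by (simp add: neg)
    moreover have "pi \<le> 2 * pi * real e / real p"
      using False p by (simp add: le_divide_eq flip: of_nat_mult)
    moreover have "2 * pi * real e / real p - pi \<le> pi - 2 * pi * real l / real p"
    proof -
      have "2 * pi * real e / real p \<le> 2 * pi * (real p - real l) / real p"
        using e l by (intro divide_right_mono mult_left_mono) auto
      also have "\<dots> = 2 * pi - 2 * pi * real l / real p" using p by (simp add: field_simps)
      finally show ?thesis by simp
    qed
    ultimately have "dual_dir p l c"
      unfolding dual_dir_def using e c_def by (intro conjI exI[of _ "2 * pi * real e / real p - pi"] exI[of _ e]) auto
    moreover have "c * unit_root p i + 1 * unit_root p j = 0"
      by (simp add: c_def e(4) unit_root_add)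
    ultimately show ?thesis using one ij by blast
  qed
qed

text \<open>There is an antipodal pair or a triple with all three arcs at most \<open>\<pi>\<close>, which is weighted
  by the law of sines.\<close>

lemma balanced_relation:
  fixes K :: "nat set"
  assumes K: "K \<subseteq> {..<p}" "0 \<in> K" and card: "p + 2 \<le> 2 * card K"
  shows "\<exists>b. (\<forall>k\<in>K. b k \<ge> (0::real)) \<and> (\<Sum>k\<in>K. b k) = 1 \<and> (\<Sum>k\<in>K. of_real (b k) * unit_root p k) = 0"
proof -
  have fin: "finite K" using K finite_subset by blast
  have p: "p > 0" using K by auto
  define K1 where "K1 = {k \<in> K. 2 * k \<le> p}"
  define K2 where "K2 = {k \<in> K. p < 2 * k}"
  define s where "s = Max K1"
  have K1: "finite K1" "0 \<in> K1" using fin K by (auto simp: K1_def)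
  have s: "s \<in> K1" and smax: "\<And>k. k \<in> K1 \<Longrightarrow> k \<le> s"
    unfolding s_def using K1 by (auto intro: Max_in)
  have sK: "s \<in> K" "2 * s \<le> p" using s by (auto simp: K1_def)
  show ?thesis
  proof (cases "K2 = {}")
    case True
    then have "K \<subseteq> {..s}" using smax by (auto simp: K1_def K2_def not_less)
    \<comment> \<open>An upper half-circle of residues contains \<open>p / 2 + 1\<close> elements
      only if it is full; so \<open>p\<close> is even and \<open>s\<close> is antipodal to
      0.\<close>
    then have "card K \<le> s + 1" using card_mono[of "{..s}" K] by simp
    then have s2: "2 * s = p" using card sK by simp
    have ne: "s \<noteq> 0" using s2 p by simp
    have us: "unit_root p s = - 1" using s2 p by (simp add: unit_root_def flip: s2)
    define b where "b = (\<lambda>k. if k = 0 \<or> k = s then 1 / 2 else 0 :: real)"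
    have sub: "(\<Sum>k\<in>K. g k) = g 0 + g s" if "\<And>k. k \<notin> {0, s} \<Longrightarrow> g k = 0" for g :: "nat \<Rightarrow> 'b::comm_monoid_add"
    proof -
      have "(\<Sum>k\<in>K. g k) = (\<Sum>k\<in>{0, s}. g k)"
        using fin K(2) sK that by (intro sum.mono_neutral_right) auto
      then show ?thesis using ne by simp
    qed
    have "(\<Sum>k\<in>K. b k) = 1" by (subst sub) (auto simp: b_def)
    moreover have "(\<Sum>k\<in>K. of_real (b k) * unit_root p k) = 0" by (subst sub) (auto simp: b_def us)
    ultimately show ?thesis by (intro exI[of _ b]) (auto simp: b_def)
  next
    case False
    define t where "t = Min K2"
    have K2: "finite K2" using fin by (simp add: K2_def)
    have t: "t \<in> K2" and tmin: "\<And>k. k \<in> K2 \<Longrightarrow> t \<le> k"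
      using K2 False by (auto simp: t_def)
    have tK: "t \<in> K" "p < 2 * t" "t < p" using t K by (auto simp: K2_def)
    have "K \<subseteq> {..s} \<union> {t..<p}"
    proof
      fix k assume k: "k \<in> K"
      show "k \<in> {..s} \<union> {t..<p}"
      proof (cases "2 * k \<le> p")
        case True
        then show ?thesis using smax[of k] k by (auto simp: K1_def)
      next
        case False
        then show ?thesis using tmin[of k] k K by (auto simp: K2_def)
      qed
    qed
    then have "card K \<le> card ({..s} \<union> {t..<p})" by (intro card_mono) auto
    also have "\<dots> \<le> (s + 1) + (p - t)" by (rule order.trans[OF card_Un_le]) simp
    \<comment> \<open>The residues strictly between \<open>s\<close> and \<open>t\<close> are
      missing from \<open>K\<close>, so the size of \<open>K\<close> limits the arc between them to
      a half-turn.\<close>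
    finally have ts: "2 * (t - s) \<le> p" "s < t" using card tK sK by linarith+
    have s0: "s > 0" using ts tK by (cases s) auto
    define \<beta> where "\<beta> = 2 * pi * real s / real p"
    define \<gamma> where "\<gamma> = 2 * pi * real t / real p"
    have beta: "0 \<le> \<beta>" "\<beta> \<le> pi"
      using sK(2) p by (auto simp: \<beta>_def divide_le_eq simp flip: of_nat_mult)
    have gamma: "pi < \<gamma>" "\<gamma> < 2 * pi"
      using tK(2,3) p by (auto simp: \<gamma>_def divide_less_eq less_divide_eq simp flip: of_nat_mult)
    have diff: "0 \<le> \<gamma> - \<beta>" "\<gamma> - \<beta> \<le> pi"
    proof -
      have eq: "\<gamma> - \<beta> = 2 * pi * real (t - s) / real p"
        using ts(2) by (simp add: \<beta>_def \<gamma>_def of_nat_diff diff_divide_distrib right_diff_distrib)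
      show "0 \<le> \<gamma> - \<beta>" unfolding eq by simp
      have "real (2 * (t - s)) \<le> real p" using ts(1) by (simp only: of_nat_le_iff)
      then have "pi * real (2 * (t - s)) \<le> pi * real p" by (intro mult_left_mono) auto
      then show "\<gamma> - \<beta> \<le> pi" unfolding eq using p by (simp add: divide_le_eq mult_ac)
    qed
    \<comment> \<open>Each of the three unit vectors gets the sine of the arc between the other two;
      the arc from \<gamma> back to 0 has sine \<open>- sin \<gamma>\<close>, which is strictly
      positive and so keeps the total \<open>T\<close> away from 0.\<close>
    define w where "w = (\<lambda>k. if k = 0 then sin (\<gamma> - \<beta>) else if k = s then - sin \<gamma> else if k = t then sin \<beta> else 0)"
    define T where "T = sin (\<gamma> - \<beta>) - sin \<gamma> + sin \<beta>"
    have sg: "- sin \<gamma> > 0" using sin_lt_zero[of \<gamma>] gamma by simp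
    have pos: "sin (\<gamma> - \<beta>) \<ge> 0" "sin \<beta> \<ge> 0" using diff beta by (auto intro: sin_ge_zero)
    have T: "T > 0" using sg pos by (simp add: T_def)
    define b where "b = (\<lambda>k. w k / T)"
    have sub: "(\<Sum>k\<in>K. g k) = g 0 + g s + g t" if "\<And>k. k \<notin> {0, s, t} \<Longrightarrow> g k = 0" for g :: "nat \<Rightarrow> 'b::comm_monoid_add"
    proof -
      have "(\<Sum>k\<in>K. g k) = (\<Sum>k\<in>{0, s, t}. g k)"
        using fin K(2) sK tK that by (intro sum.mono_neutral_right) auto
      then show ?thesis using s0 ts by (simp add: add.assoc)
    qed
    have w: "w 0 = sin (\<gamma> - \<beta>)" "w s = - sin \<gamma>" "w t = sin \<beta>" using s0 ts by (auto simp: w_def)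
    have wnn: "w k \<ge> 0" for k using pos sg by (auto simp: w_def)
    have "(\<Sum>k\<in>K. w k) = T" by (subst sub) (auto simp: w T_def, simp add: w_def)
    then have 1: "(\<Sum>k\<in>K. b k) = 1" using T by (simp add: b_def flip: sum_divide_distrib)
    have "(\<Sum>k\<in>K. of_real (w k) * unit_root p k)
        = of_real (sin (\<gamma> - \<beta>)) + of_real (- sin \<gamma>) * cis \<beta> + of_real (sin \<beta>) * cis \<gamma>"
      by (subst sub) (auto simp: w unit_root_def \<beta>_def \<gamma>_def, simp add: w_def)
    also have "\<dots> = 0" by (simp add: complex_eq_iff sin_diff)
    finally have "(\<Sum>k\<in>K. of_real (w k) * unit_root p k) = 0" .
    then have 2: "(\<Sum>k\<in>K. of_real (b k) * unit_root p k) = 0"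
      by (simp add: b_def flip: sum_divide_distrib)
    show ?thesis using 1 2 wnn T by (intro exI[of _ b]) (auto simp: b_def)
  qed
qed

section \<open>The finite model\<close>

definition sesq :: "nat \<Rightarrow> (nat \<Rightarrow> complex) \<Rightarrow> (nat \<Rightarrow> complex) \<Rightarrow> complex" where
  "sesq N v w = (\<Sum>i<N. v i * cnj (w i))"

lemma norm_sesq_le: "cmod (sesq N v w) \<le> nrm N v * nrm N w"
proof -
  have "cmod (sesq N v w) \<le> (\<Sum>i<N. \<bar>cmod (v i)\<bar> * \<bar>cmod (w i)\<bar>)"
    unfolding sesq_def by (rule order.trans[OF norm_sum]) (simp add: norm_mult)
  also have "\<dots> \<le> nrm N v * nrm N w" unfolding nrm_def by (rule L2_set_mult_ineq)
  finally show ?thesis .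
qed

lemma nrm_sum_le: "finite K \<Longrightarrow> nrm N (\<lambda>i. \<Sum>k\<in>K. f k i) \<le> (\<Sum>k\<in>K. nrm N (f k))"
proof (induction rule: finite_induct)
  case empty
  then show ?case by (simp add: nrm_def L2_set_def)
next
  case (insert k K)
  then show ?case using nrm_triangle[of N "f k" "\<lambda>i. \<Sum>k\<in>K. f k i"] by simp
qed

text \<open>The relations among the coefficients make both arguments of the Hermitian form small, so
  that its value is of second order in \<open>r\<close>.\<close>

lemma margin_le_square:
  fixes b :: "nat \<Rightarrow> real"
  assumes c: "cmod c = 1" "cmod d = 1" "c * u + d * v = 0"
    and A: "nrm N (\<lambda>i. A i - u * X i) \<le> r" and B: "nrm N (\<lambda>i. B i - v * X i) \<le> r"
    and K: "finite K" "\<And>k. k \<in> K \<Longrightarrow> 0 \<le> b k" "(\<Sum>k\<in>K. b k) = 1" "(\<Sum>k\<in>K. of_real (b k) * w k) = 0"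
    and C: "\<And>k. k \<in> K \<Longrightarrow> nrm N (\<lambda>i. C k i - w k * Y i) \<le> r"
    and Im: "\<And>k. k \<in> K \<Longrightarrow> \<tau> \<le> Im (c * sesq N A (C k))" "\<And>k. k \<in> K \<Longrightarrow> \<tau> \<le> Im (d * sesq N B (C k))"
  shows "\<tau> \<le> r\<^sup>2"
proof -
  define P where "P = (\<lambda>i. c * A i + d * B i)"
  define Q where "Q = (\<lambda>i. \<Sum>k\<in>K. of_real (b k) * C k i)"
  have "P = (\<lambda>i. c * (A i - u * X i) + d * (B i - v * X i))"
  proof
    fix i
    have "c * (A i - u * X i) + d * (B i - v * X i) = P i - (c * u + d * v) * X i"
      by (simp add: P_def algebra_simps)
    then show "P i = c * (A i - u * X i) + d * (B i - v * X i)" by (simp add: c(3))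
  qed
  then have "nrm N P \<le> nrm N (\<lambda>i. c * (A i - u * X i)) + nrm N (\<lambda>i. d * (B i - v * X i))"
    using nrm_triangle by simp
  also have "\<dots> \<le> r + r" unfolding nrm_scale using A B c by (intro add_mono) simp_all
  finally have P: "nrm N P \<le> 2 * r" by simp
  have r: "r \<ge> 0" using A nrm_nonneg order_trans by blast
  have "Q = (\<lambda>i. \<Sum>k\<in>K. of_real (b k) * (C k i - w k * Y i))"
  proof
    fix i
    have "(\<Sum>k\<in>K. of_real (b k) * (C k i - w k * Y i)) = Q i - (\<Sum>k\<in>K. of_real (b k) * w k) * Y i"
      by (simp add: Q_def right_diff_distrib sum_subtractf sum_distrib_right mult.assoc)
    then show "Q i = (\<Sum>k\<in>K. of_real (b k) * (C k i - w k * Y i))" by (simp add: K(4))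
  qed
  then have "nrm N Q \<le> (\<Sum>k\<in>K. nrm N (\<lambda>i. of_real (b k) * (C k i - w k * Y i)))"
    using nrm_sum_le[OF K(1)] by simp
  also have "\<dots> \<le> (\<Sum>k\<in>K. b k * r)"
    unfolding nrm_scale using K(2) C by (intro sum_mono mult_mono) auto
  also have "\<dots> = r" using K(3) by (simp flip: sum_distrib_right)
  finally have Q: "nrm N Q \<le> r" .
  \<comment> \<open>The weights \<open>b k\<close> are real, hence unaffected by the conjugation in
    the second argument.\<close>
  have "sesq N P Q = (\<Sum>k\<in>K. of_real (b k) * (c * sesq N A (C k) + d * sesq N B (C k)))"
    unfolding sesq_def P_def Q_def cnj_sum sum_distrib_left sum_distrib_right
    by (subst sum.swap) (simp add: sum.distrib sum_distrib_left algebra_simps)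
  then have "Im (sesq N P Q) = (\<Sum>k\<in>K. b k * (Im (c * sesq N A (C k)) + Im (d * sesq N B (C k))))"
    by simp
  also have "\<dots> \<ge> (\<Sum>k\<in>K. b k * (\<tau> + \<tau>))"
    using K(2) Im by (intro sum_mono mult_left_mono add_mono) auto
  also have "(\<Sum>k\<in>K. b k * (\<tau> + \<tau>)) = 2 * \<tau>" using K(3) by (simp flip: sum_distrib_right)
  finally have "2 * \<tau> \<le> Im (sesq N P Q)" .
  also have "\<dots> \<le> cmod (sesq N P Q)" using abs_Im_le_cmod[of "sesq N P Q"] by linarith
  also have "\<dots> \<le> nrm N P * nrm N Q" by (rule norm_sesq_le)
  also have "\<dots> \<le> (2 * r) * r" using P Q r by (intro mult_mono) auto
  finally show ?thesis by (simp add: power2_eq_square)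
qed

definition side_adj :: "nat \<Rightarrow> nat \<Rightarrow> real \<Rightarrow> nat list \<Rightarrow> nat list \<Rightarrow> bool" where
  "side_adj p N r x y \<longleftrightarrow>
     (\<exists>j\<in>{1..<p}. nrm N (\<lambda>i. wvec (p * N) x i - unit_root p j * wvec (p * N) y i) \<le> r)"

definition clique :: "('b \<Rightarrow> 'b \<Rightarrow> bool) \<Rightarrow> 'b set \<Rightarrow> bool" where
  "clique R Q \<longleftrightarrow> (\<forall>x\<in>Q. \<forall>y\<in>Q. x \<noteq> y \<longrightarrow> R x y)"

text \<open>Multiplication by the inverse rotation \<open>unit_root p (p - j)\<close> is an
  isometry.\<close>

lemma side_adj_sym: "side_adj p N r x y \<Longrightarrow> side_adj p N r y x"
proof -
  assume "side_adj p N r x y"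
  then obtain j where j: "1 \<le> j" "j < p"
    and near: "nrm N (\<lambda>i. wvec (p * N) x i - unit_root p j * wvec (p * N) y i) \<le> r"
    by (auto simp: side_adj_def)
  have "unit_root p (p - j) * unit_root p j = 1"
    using j by (simp add: unit_root_self flip: unit_root_add)
  then have "nrm N (\<lambda>i. unit_root p (p - j) * wvec (p * N) x i - unit_root p (p - j) * (unit_root p j * wvec (p * N) y i))
      = nrm N (\<lambda>i. unit_root p (p - j) * wvec (p * N) x i - wvec (p * N) y i)"
    by (simp flip: mult.assoc)
  then have "nrm N (\<lambda>i. wvec (p * N) y i - unit_root p (p - j) * wvec (p * N) x i) \<le> r"
    using near nrm_minus_commute[of N "wvec (p * N) y"] by (simp add: nrm_scale_diff)
  then show ?thesis unfolding side_adj_def using j by (intro bexI[of _ "p - j"]) auto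
qed

context
  fixes p N :: nat and r :: real
  assumes rotations_far: "\<And>j. 1 \<le> j \<Longrightarrow> j < p \<Longrightarrow> 3 * r < cmod (1 - unit_root p j) * sqrt (real N)"
    and r_nonneg: "0 \<le> r" and p_pos: "0 < p"
begin

lemma side_adj_irrefl: "\<not> side_adj p N r x x"
  using rotations_far r_nonneg unfolding side_adj_def nrm_rotate_wvec by fastforce

text \<open>Two members with the same index would be joined through the same rotate of
  \<open>x0\<close>, so that \<open>y\<close> and a nontrivial rotate of \<open>y\<close> would be
  within \<open>3 * r\<close>, against \<open>rotations_far\<close>. The base point has index 0, as
  \<open>balanced_relation\<close> demands.\<close>

lemma clique_index:
  assumes Q: "clique (side_adj p N r) Q" "x0 \<in> Q"
  shows "\<exists>f. inj_on f Q \<and> f ` Q \<subseteq> {..<p} \<and> f x0 = 0 \<and>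
           (\<forall>x\<in>Q. nrm N (\<lambda>i. wvec (p * N) x i - unit_root p (f x) * wvec (p * N) x0 i) \<le> r)"
proof -
  have "\<exists>j<p. nrm N (\<lambda>i. wvec (p * N) x i - unit_root p j * wvec (p * N) x0 i) \<le> r \<and> (x = x0 \<longrightarrow> j = 0)" if "x \<in> Q" for x
  proof (cases "x = x0")
    case True
    then show ?thesis using p_pos r_nonneg by (intro exI[of _ 0]) (auto simp: nrm_def L2_set_def)
  next
    case False
    then have "side_adj p N r x x0" using Q that by (auto simp: clique_def)
    then show ?thesis using False by (auto simp: side_adj_def)
  qed
  then obtain f where f: "\<And>x. x \<in> Q \<Longrightarrow> f x < p"
    "\<And>x. x \<in> Q \<Longrightarrow> nrm N (\<lambda>i. wvec (p * N) x i - unit_root p (f x) * wvec (p * N) x0 i) \<le> r"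
    "\<And>x. x \<in> Q \<Longrightarrow> x = x0 \<Longrightarrow> f x = 0"
    by metis
  have "inj_on f Q"
  proof (rule inj_onI, rule ccontr)
    fix x y assume xy: "x \<in> Q" "y \<in> Q" "f x = f y" "x \<noteq> y"
    then obtain j where j: "1 \<le> j" "j < p"
      and near: "nrm N (\<lambda>i. wvec (p * N) x i - unit_root p j * wvec (p * N) y i) \<le> r"
      using Q unfolding clique_def side_adj_def by fastforce
    let ?v = "wvec (p * N)"
    have "cmod (1 - unit_root p j) * sqrt (real N) = nrm N (\<lambda>i. ?v y i - unit_root p j * ?v y i)"
      by (simp add: nrm_rotate_wvec)
    also have "\<dots> \<le> nrm N (\<lambda>i. ?v y i - unit_root p (f y) * ?v x0 i)
        + nrm N (\<lambda>i. unit_root p (f y) * ?v x0 i - ?v x i) + nrm N (\<lambda>i. ?v x i - unit_root p j * ?v y i)"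
      using nrm_diff_triangle[of N "?v y" "\<lambda>i. unit_root p j * ?v y i" "\<lambda>i. unit_root p (f y) * ?v x0 i"]
        nrm_diff_triangle[of N "\<lambda>i. unit_root p (f y) * ?v x0 i" "\<lambda>i. unit_root p j * ?v y i" "?v x"]
      by linarith
    also have "\<dots> \<le> r + r + r"
      using f(2)[OF xy(1)] f(2)[OF xy(2)] near nrm_minus_commute[of N _ "?v x"] xy(3)
      by (intro add_mono) simp_all
    finally show False using rotations_far[OF j] by simp
  qed
  then show ?thesis using f Q by (intro exI[of _ f]) auto
qed

text \<open>Neither side exceeds \<open>p\<close>, so each has more than \<open>l\<close> members
  and admits a \<open>dual_pair_relation\<close>. Since \<open>p + l + 1 \<ge> p + 2\<close>, one
  side has at least half of \<open>p + 2\<close> members and admits a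
  \<open>balanced_relation\<close>. The pair is taken on the other side.\<close>

lemma no_large_clique:
  assumes l: "0 < l" "2 * l \<le> p" and tau: "r\<^sup>2 < \<tau>"
    and Q: "clique (side_adj p N r) Q1" "clique (side_adj p N r) Q2"
    and fin: "finite Q1" "finite Q2" and card: "card Q1 + card Q2 = p + l + 1"
    and cross: "\<And>x y. x \<in> Q1 \<Longrightarrow> y \<in> Q2 \<Longrightarrow> cross_adj p l \<tau> (herm N (p * N) x y)"
  shows False
proof -
  let ?v = "wvec (p * N)"
  have tau0: "\<tau> > 0" using tau by (meson le_less_trans zero_le_power2)
  have small: "card Q \<le> p" if Q: "clique (side_adj p N r) Q" "finite Q" for Q
  proof (cases "Q = {}")
    case False
    then obtain x where x: "x \<in> Q" by blast
    obtain f where "inj_on f Q" "f ` Q \<subseteq> {..<p}" using clique_index[OF Q(1) x] by blast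
    then have "card Q \<le> card {..<p}" by (intro card_inj_on_le) auto
    then show ?thesis by simp
  qed simp
  have big: "l < card Q1" "l < card Q2" using small Q fin card by fastforce+
  obtain x0 y0 where x0: "x0 \<in> Q1" and y0: "y0 \<in> Q2" using big by fastforce
  obtain f where f: "inj_on f Q1" "f ` Q1 \<subseteq> {..<p}" "f x0 = 0"
    "\<And>x. x \<in> Q1 \<Longrightarrow> nrm N (\<lambda>i. ?v x i - unit_root p (f x) * ?v x0 i) \<le> r"
    using clique_index[OF Q(1) x0] by blast
  obtain g where g: "inj_on g Q2" "g ` Q2 \<subseteq> {..<p}" "g y0 = 0"
    "\<And>y. y \<in> Q2 \<Longrightarrow> nrm N (\<lambda>i. ?v y i - unit_root p (g y) * ?v y0 i) \<le> r"
    using clique_index[OF Q(2) y0] by blast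
  have cards: "card (f ` Q1) = card Q1" "card (g ` Q2) = card Q2"
    using f(1) g(1) by (simp_all add: card_image)
  have herm: "sesq N (?v x) (?v y) = herm N (p * N) x y" for x y by (simp add: sesq_def herm_def)
  have Im: "\<tau> \<le> Im (c * sesq N (?v x) (?v y))" if "dual_dir p l c" "x \<in> Q1" "y \<in> Q2" for c x y
    unfolding herm using Im_dual_dir_ge[OF that(1) cross[OF that(2,3)] tau0] .
  have "p + 2 \<le> 2 * card Q1 \<or> p + 2 \<le> 2 * card Q2" using card l by linarith
  then show False
  proof
    assume "p + 2 \<le> 2 * card Q2"
    then obtain b where b: "\<And>k. k \<in> g ` Q2 \<Longrightarrow> b k \<ge> (0::real)" "(\<Sum>k\<in>g ` Q2. b k) = 1"
      "(\<Sum>k\<in>g ` Q2. of_real (b k) * unit_root p k) = 0"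
      using balanced_relation[of "g ` Q2" p] g y0 cards by (metis image_eqI)
    obtain x x' c d where x: "x \<in> Q1" "x' \<in> Q1" and c: "dual_dir p l c" "dual_dir p l d"
      and rel: "c * unit_root p (f x) + d * unit_root p (f x') = 0"
      using dual_pair_relation[of "f ` Q1" p l] f(2) cards big l by (metis imageE)
    define C where "C = (\<lambda>k. ?v (inv_into Q2 g k))"
    have C: "inv_into Q2 g k \<in> Q2" "g (inv_into Q2 g k) = k" if "k \<in> g ` Q2" for k
      using that by (auto intro: inv_into_into f_inv_into_f)
    have "\<tau> \<le> r\<^sup>2"
    proof (rule margin_le_square[OF norm_dual_dir[OF c(1)] norm_dual_dir[OF c(2)] rel f(4)[OF x(1)] f(4)[OF x(2)] _ b])
      fix k assume k: "k \<in> g ` Q2"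
      show "nrm N (\<lambda>i. C k i - unit_root p k * ?v y0 i) \<le> r"
        using g(4)[OF C(1)[OF k]] C(2)[OF k] by (simp add: C_def)
      show "\<tau> \<le> Im (c * sesq N (?v x) (C k))" "\<tau> \<le> Im (d * sesq N (?v x') (C k))"
        unfolding C_def using Im c x C(1)[OF k] by blast+
    qed (use fin in auto)
    then show False using tau by simp
  next
    assume "p + 2 \<le> 2 * card Q1"
    then obtain b where b: "\<And>k. k \<in> f ` Q1 \<Longrightarrow> b k \<ge> (0::real)" "(\<Sum>k\<in>f ` Q1. b k) = 1"
      "(\<Sum>k\<in>f ` Q1. of_real (b k) * unit_root p k) = 0"
      using balanced_relation[of "f ` Q1" p] f x0 cards by (metis image_eqI)
    obtain y y' c d where y: "y \<in> Q2" "y' \<in> Q2" and c: "dual_dir p l c" "dual_dir p l d"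
      and rel: "c * unit_root p (g y) + d * unit_root p (g y') = 0"
      using dual_pair_relation[of "g ` Q2" p l] g(2) cards big l by (metis imageE)
    \<comment> \<open>\<open>margin_le_square\<close> wants the balanced side in the second
      argument. Conjugating all vectors exchanges the arguments of \<open>sesq\<close> without
      changing its value; the conjugated pair relation holds with \<open>c\<close> and
      \<open>d\<close> exchanged.\<close>
    define C where "C = (\<lambda>k i. cnj (?v (inv_into Q1 f k) i))"
    have C: "inv_into Q1 f k \<in> Q1" "f (inv_into Q1 f k) = k" if "k \<in> f ` Q1" for k
      using that by (auto intro: inv_into_into f_inv_into_f)
    have unit: "unit_root p j * cnj (unit_root p j) = 1" for j
      by (simp add: complex_norm_square[symmetric])
    have "(c * unit_root p (g y) + d * unit_root p (g y')) * (cnj (unit_root p (g y)) * cnj (unit_root p (g y')))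
        = d * cnj (unit_root p (g y)) * (unit_root p (g y') * cnj (unit_root p (g y')))
          + c * cnj (unit_root p (g y')) * (unit_root p (g y) * cnj (unit_root p (g y)))"
      by (simp add: algebra_simps)
    then have rel': "d * cnj (unit_root p (g y)) + c * cnj (unit_root p (g y')) = 0"
      unfolding rel unit by simp
    have cnj_nrm: "nrm N (\<lambda>i. cnj (v i) - cnj u * cnj (w i)) = nrm N (\<lambda>i. v i - u * w i)" for u v w
      unfolding nrm_def by (metis complex_cnj_diff complex_cnj_mult complex_mod_cnj)
    have swap: "sesq N (\<lambda>i. cnj (v i)) (\<lambda>i. cnj (w i)) = sesq N w v" for v w
      by (simp add: sesq_def mult.commute)
    have "\<tau> \<le> r\<^sup>2"
    proof (rule margin_le_square[OF norm_dual_dir[OF c(2)] norm_dual_dir[OF c(1)] rel' _ _ _ b(1,2)])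
      show "nrm N (\<lambda>i. cnj (?v y i) - cnj (unit_root p (g y)) * cnj (?v y0 i)) \<le> r"
        "nrm N (\<lambda>i. cnj (?v y' i) - cnj (unit_root p (g y')) * cnj (?v y0 i)) \<le> r"
        unfolding cnj_nrm using g(4) y by blast+
      have "(\<Sum>k\<in>f ` Q1. of_real (b k) * cnj (unit_root p k)) = cnj (\<Sum>k\<in>f ` Q1. of_real (b k) * unit_root p k)"
        by simp
      then show "(\<Sum>k\<in>f ` Q1. of_real (b k) * cnj (unit_root p k)) = 0" unfolding b(3) by simp
      fix k assume k: "k \<in> f ` Q1"
      show "nrm N (\<lambda>i. C k i - cnj (unit_root p k) * cnj (?v x0 i)) \<le> r"
        unfolding C_def cnj_nrm using f(4)[OF C(1)[OF k]] C(2)[OF k] by simp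
      show "\<tau> \<le> Im (d * sesq N (\<lambda>i. cnj (?v y i)) (C k))" "\<tau> \<le> Im (c * sesq N (\<lambda>i. cnj (?v y' i)) (C k))"
        unfolding C_def swap using Im c y C(1)[OF k] by blast+
    qed (use fin in auto)
    then show False using tau by simp
  qed
qed

end

text \<open>All that the graph-theoretic part needs to know of the geometry. Both sides are copies
  of \<open>X\<close>; \<open>C\<close> need not be symmetric, its first argument belongs to the
  first side.\<close>

locale two_sided_model =
  fixes X :: "'b set" and S C :: "'b \<Rightarrow> 'b \<Rightarrow> bool" and p l :: nat and \<delta> :: real
  assumes finite_X: "finite X" and X_nonempty: "X \<noteq> {}"
    and symp_S: "symp S" and irreflp_S: "irreflp S"
    and dense_clique: "A \<subseteq> X \<Longrightarrow> \<delta> * real (card X) \<le> real (card A) \<Longrightarrow> \<exists>Q\<subseteq>A. card Q = p \<and> clique S Q"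
    and sparse: "y \<in> X \<Longrightarrow> real (card {x \<in> X. S x y}) \<le> \<delta> * real (card X)"
    and cross_regular: "y \<in> X \<Longrightarrow>
      \<bar>real (card {x \<in> X. C x y}) - real l / real p * real (card X)\<bar> \<le> \<delta> * real (card X)"
    and no_two_sided_clique: "2 * l \<le> p \<Longrightarrow> finite Q1 \<Longrightarrow> finite Q2 \<Longrightarrow> clique S Q1 \<Longrightarrow> clique S Q2 \<Longrightarrow>
      (\<And>x y. x \<in> Q1 \<Longrightarrow> y \<in> Q2 \<Longrightarrow> C x y) \<Longrightarrow> card Q1 + card Q2 \<noteq> p + l + 1"

lemma two_sided_model_exists:
  assumes l: "0 < l" "l < p" and eps: "\<epsilon> > 0"
  shows "\<exists>X (S :: nat list \<Rightarrow> nat list \<Rightarrow> bool) C. two_sided_model X S C p l \<epsilon>"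
proof -
  define \<mu> where "\<mu> = 1 + sqrt (4000 * real p / \<epsilon> + 1)"
  have mu: "\<mu> \<ge> 1" "\<epsilon> * (\<mu> - 1)\<^sup>2 > 4000 * real p"
    using eps by (auto simp: \<mu>_def field_simps)
  \<comment> \<open>Two points within \<mu> of rotates of the same \<open>x\<close> are within
    \<open>2 * \<mu>\<close> after the relative rotation. The margin \<tau> has to exceed
    \<open>r\<^sup>2\<close> for the clique bound and to be at least 1 for
    anticoncentration.\<close>
  define r where "r = 2 * \<mu>"
  define \<tau> where "\<tau> = r\<^sup>2 + 1"
  have r: "r > 0" and tau: "\<tau> \<ge> 1" "r\<^sup>2 < \<tau>" using mu by (auto simp: r_def \<tau>_def)
  have p: "p > 1" "p > 0" using l by auto
  obtain N1 where N1: "\<And>N m y. N \<ge> N1 \<Longrightarrow> m \<ge> 3 \<Longrightarrow> y \<in> words N m \<Longrightarrow>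
      real (card {x \<in> words N m. \<bar>Im (herm N m x y)\<bar> < \<tau>}) \<le> \<epsilon> / real (p + 1) * real (m ^ N)"
    using anticoncentration_herm[OF tau(1), of "\<epsilon> / real (p + 1)"] eps by auto
  obtain N2 where N2: "\<And>N v. N \<ge> N2 \<Longrightarrow>
      real (card {x \<in> words N (p * N). nrm N (\<lambda>i. wvec (p * N) x i - v i) \<le> r}) \<le> \<epsilon> / real p * real ((p * N) ^ N)"
    using small_ball[OF p(1), of "\<epsilon> / real p" r] eps p by auto
  define \<gamma> where "\<gamma> = Min ((\<lambda>j. cmod (1 - unit_root p j)) ` {1..<p})"
  have ne: "unit_root p j \<noteq> 1" if "1 \<le> j" "j < p" for j
    using unit_root_eq_iff[of p j 0] that by simp
  have gamma: "\<gamma> > 0" "\<And>j. 1 \<le> j \<Longrightarrow> j < p \<Longrightarrow> \<gamma> \<le> cmod (1 - unit_root p j)"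
    using p ne by (auto simp: \<gamma>_def)
  \<comment> \<open>From here on a point is farther than \<open>3 * r\<close> from each of its
    nontrivial rotates.\<close>
  define N3 where "N3 = nat \<lceil>(3 * r / \<gamma>)\<^sup>2\<rceil> + 1"
  define N where "N = N1 + N2 + N3 + 2"
  have N: "N \<ge> N1" "N \<ge> N2" "N \<ge> 2" "N > 0" by (auto simp: N_def)
  have "(3 * r / \<gamma>)\<^sup>2 < real N3" unfolding N3_def by linarith
  also have "\<dots> \<le> real N" by (simp add: N_def)
  finally have "3 * r / \<gamma> < sqrt (real N)" by (rule real_less_rsqrt)
  then have gN: "3 * r < \<gamma> * sqrt (real N)" using gamma by (simp add: divide_less_eq mult.commute)
  have far: "3 * r < cmod (1 - unit_root p j) * sqrt (real N)" if "1 \<le> j" "j < p" for j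
    using gN mult_right_mono[OF gamma(2)[OF that], of "sqrt (real N)"] by simp
  define X where "X = words N (p * N)"
  define S where "S = side_adj p N r"
  define C where "C = (\<lambda>x y. cross_adj p l \<tau> (herm N (p * N) x y))"
  have X: "finite X" "card X = (p * N) ^ N" by (auto simp: X_def card_words)
  then have Xne: "X \<noteq> {}" using p N by auto
  have spread: "\<exists>Q\<subseteq>A. card Q = p \<and> clique S Q" if A: "A \<subseteq> X" "\<epsilon> * real (card X) \<le> real (card A)" for A
  proof -
    let ?v = "wvec (p * N)"
    obtain x where "\<And>j. j < p \<Longrightarrow> \<exists>a\<in>A. nrm N (\<lambda>i. ?v a i - unit_root p j * ?v x i) \<le> \<mu>"
      using spread_rotates[of A N p \<epsilon> \<mu>] A p N eps mu
      unfolding X_def card_words by blast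
    then obtain a where a: "\<And>j. j < p \<Longrightarrow> a j \<in> A"
      "\<And>j. j < p \<Longrightarrow> nrm N (\<lambda>i. ?v (a j) i - unit_root p j * ?v x i) \<le> \<mu>" by metis
    have adj: "S (a j) (a k)" if jk: "k < j" "j < p" for j k
    proof -
      let ?u = "unit_root p (j - k)"
      have u: "unit_root p j = ?u * unit_root p k" using jk by (simp flip: unit_root_add)
      have "nrm N (\<lambda>i. ?v (a j) i - ?u * ?v (a k) i)
          \<le> nrm N (\<lambda>i. ?v (a j) i - unit_root p j * ?v x i) + nrm N (\<lambda>i. unit_root p j * ?v x i - ?u * ?v (a k) i)"
        by (rule nrm_diff_triangle)
      also have "nrm N (\<lambda>i. unit_root p j * ?v x i - ?u * ?v (a k) i)
          = nrm N (\<lambda>i. ?v (a k) i - unit_root p k * ?v x i)"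
        unfolding u mult.assoc nrm_scale_diff by (simp add: nrm_minus_commute[of N "?v (a k)"])
      also have "nrm N (\<lambda>i. ?v (a j) i - unit_root p j * ?v x i) + \<dots> \<le> r"
        using a(2)[of j] a(2)[of k] jk by (simp add: r_def)
      finally show ?thesis unfolding S_def side_adj_def using jk by (intro bexI[of _ "j - k"]) auto
    qed
    have irr: "\<not> S y y" for y unfolding S_def using far r p by (intro side_adj_irrefl) auto
    have sym: "S x y \<Longrightarrow> S y x" for x y unfolding S_def by (rule side_adj_sym)
    have "inj_on a {..<p}"
    proof (rule linorder_inj_onI)
      fix j k assume "j < k" "j \<in> {..<p}" "k \<in> {..<p}"
      then show "a j \<noteq> a k" using adj[of j k] irr by auto
    qed auto
    then have "card (a ` {..<p}) = p" by (simp add: card_image)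
    moreover have "clique S (a ` {..<p})"
      unfolding clique_def using adj sym by (auto simp: image_iff) (metis linorder_neqE_nat)
    moreover have "a ` {..<p} \<subseteq> A" using a(1) by auto
    ultimately show ?thesis by blast
  qed
  have sparse: "real (card {x \<in> X. S x y}) \<le> \<epsilon> * real (card X)" for y
  proof -
    let ?B = "\<lambda>j. {x \<in> X. nrm N (\<lambda>i. wvec (p * N) x i - unit_root p j * wvec (p * N) y i) \<le> r}"
    \<comment> \<open>The neighbours of \<open>y\<close> lie in at most \<open>p\<close> balls of
      radius \<open>r\<close>, which explains the share \<open>\<epsilon> / p\<close> granted to
      each.\<close>
    have "{x \<in> X. S x y} \<subseteq> (\<Union>j<p. ?B j)" unfolding S_def side_adj_def by auto
    then have "card {x \<in> X. S x y} \<le> card (\<Union>j<p. ?B j)" using X(1) by (intro card_mono) auto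
    also have "\<dots> \<le> (\<Sum>j<p. card (?B j))" by (rule card_UN_le) simp
    finally have "real (card {x \<in> X. S x y}) \<le> real (\<Sum>j<p. card (?B j))" by (rule of_nat_mono)
    also have "\<dots> = (\<Sum>j<p. real (card (?B j)))" by (rule of_nat_sum)
    also have "\<dots> \<le> (\<Sum>j<p. \<epsilon> / real p * real (card X))"
      unfolding X(2) unfolding X_def by (intro sum_mono N2 N)
    also have "\<dots> = \<epsilon> * real (card X)" using p by simp
    finally show ?thesis .
  qed
  have density: "\<bar>real (card {x \<in> X. C x y}) - real l / real p * real (card X)\<bar> \<le> \<epsilon> * real (card X)" if y: "y \<in> X" for y
  proof -
    have "3 \<le> p * N" using p N mult_le_mono[of 2 p 2 N] by linarith
    then have "real (card {x \<in> X. \<bar>Im (herm N (p * N) x y)\<bar> < \<tau>}) \<le> \<epsilon> / real (p + 1) * real (card X)"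
      using N1[OF N(1) _ y[unfolded X_def]] unfolding X(2) unfolding X_def by blast
    then have "real (p + 1) * real (card {x \<in> X. \<bar>Im (herm N (p * N) x y)\<bar> < \<tau>})
        \<le> real (p + 1) * (\<epsilon> / real (p + 1) * real (card X))" by (intro mult_left_mono) auto
    also have "\<dots> = \<epsilon> * real (card X)" by (simp add: field_simps)
    finally show ?thesis
      using cross_density[of p N l \<tau> y] p N l tau unfolding C_def X_def by linarith
  qed
  have "two_sided_model X S C p l \<epsilon>"
  proof
    show "irreflp S" unfolding S_def irreflp_def using far r p by (intro allI side_adj_irrefl) auto
    show "symp S" unfolding S_def symp_def using side_adj_sym by blast
    fix Q1 Q2 assume Q: "2 * l \<le> p" "finite Q1" "finite Q2" "clique S Q1" "clique S Q2"
      and cross: "\<And>x y. x \<in> Q1 \<Longrightarrow> y \<in> Q2 \<Longrightarrow> C x y"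
    show "card Q1 + card Q2 \<noteq> p + l + 1"
      using no_large_clique[OF far less_imp_le[OF r] p(2) l(1) Q(1) tau(2) _ _ Q(2,3)] Q(4,5) cross
      unfolding S_def C_def by blast
  qed (use X(1) Xne spread sparse density in blast)+
  then show ?thesis by blast
qed

section \<open>Blow-ups\<close>

text \<open>A blow-up: \<open>\<phi>\<close> tells which model vertex each vertex copies. For the
  irreflexive relations used here, the fibres of \<open>\<phi>\<close> span no edges.\<close>

definition pull_edges :: "('b \<Rightarrow> 'b \<Rightarrow> bool) \<Rightarrow> ('a \<Rightarrow> 'b) \<Rightarrow> 'a set \<Rightarrow> 'a set set" where
  "pull_edges R \<phi> V = {{u, v} | u v. u \<in> V \<and> v \<in> V \<and> R (\<phi> u) (\<phi> v)}"

context
  fixes R :: "'b \<Rightarrow> 'b \<Rightarrow> bool"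
  assumes symp: "symp R" and irreflp: "irreflp R"
begin

lemmas R_sym = sympD[OF symp] and R_irrefl = irreflpD[OF irreflp]

lemma pull_edges_iff: "{u, v} \<in> pull_edges R \<phi> V \<longleftrightarrow> u \<in> V \<and> v \<in> V \<and> R (\<phi> u) (\<phi> v)"
  unfolding pull_edges_def mem_Collect_eq doubleton_eq_iff using R_sym by blast

lemma sgraph_pull_edges: "finite V \<Longrightarrow> sgraph V (pull_edges R \<phi> V)"
  unfolding sgraph_def
proof (intro conjI ballI)
  fix e assume "e \<in> pull_edges R \<phi> V"
  then obtain u v where e: "e = {u, v}" "u \<in> V" "v \<in> V" "R (\<phi> u) (\<phi> v)"
    by (auto simp: pull_edges_def)
  then have "u \<noteq> v" using R_irrefl by blast
  then show "e \<subseteq> V" "card e = 2" using e by auto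
qed

text \<open>A clique meets each fibre at most once, so \<open>\<phi>\<close> carries it injectively
  onto a clique of the model.\<close>

lemma K_free_pull_edges:
  assumes "\<And>Q. finite Q \<Longrightarrow> Q \<subseteq> \<phi> ` V \<Longrightarrow> clique R Q \<Longrightarrow> card Q \<noteq> q"
  shows "K_free q V (pull_edges R \<phi> V)"
  unfolding K_free_def
proof
  assume "\<exists>S\<subseteq>V. finite S \<and> card S = q \<and> (\<forall>x\<in>S. \<forall>y\<in>S. x \<noteq> y \<longrightarrow> {x, y} \<in> pull_edges R \<phi> V)"
  then obtain S where S: "S \<subseteq> V" "finite S" "card S = q"
    "\<And>x y. x \<in> S \<Longrightarrow> y \<in> S \<Longrightarrow> x \<noteq> y \<Longrightarrow> R (\<phi> x) (\<phi> y)"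
    unfolding pull_edges_iff by blast
  then have "inj_on \<phi> S" by (intro inj_onI) (metis R_irrefl)
  then have "card (\<phi> ` S) = q" using S(3) by (simp add: card_image)
  moreover have "clique R (\<phi> ` S)" unfolding clique_def using S(4) by blast
  ultimately show False using assms[of "\<phi> ` S"] S by blast
qed

lemma not_K_free_pull_edges:
  assumes "U \<subseteq> V" "finite Q" "Q \<subseteq> \<phi> ` U" "clique R Q" "card Q = q"
  shows "\<not> K_free q U (induced_edges (pull_edges R \<phi> V) U)"
proof -
  define S where "S = inv_into U \<phi> ` Q"
  have "inj_on (inv_into U \<phi>) Q" using assms(3) by (rule inj_on_inv_into)
  then have "card S = q" "finite S" using assms by (auto simp: S_def card_image)
  moreover have SU: "S \<subseteq> U" using assms(3) by (auto simp: S_def intro: inv_into_into)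
  moreover have "{x, y} \<in> induced_edges (pull_edges R \<phi> V) U" if xy: "x \<in> S" "y \<in> S" "x \<noteq> y" for x y
  proof -
    obtain a b where ab: "a \<in> Q" "b \<in> Q" "x = inv_into U \<phi> a" "y = inv_into U \<phi> b"
      using xy by (auto simp: S_def)
    then have "\<phi> x = a" "\<phi> y = b" using assms(3) by (auto intro: f_inv_into_f)
    then have "R (\<phi> x) (\<phi> y)" using assms(4) ab xy by (auto simp: clique_def)
    then show ?thesis using SU xy assms(1) by (auto simp: induced_edges_def pull_edges_iff)
  qed
  ultimately show ?thesis unfolding K_free_def by blast
qed

lemma card_induced_pull_edges_le:
  assumes "W \<subseteq> V" "finite W"
  shows "card (induced_edges (pull_edges R \<phi> V) W) \<le> (\<Sum>v\<in>W. card {u \<in> W. R (\<phi> u) (\<phi> v)})"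
proof -
  let ?P = "SIGMA v:W. {u \<in> W. R (\<phi> u) (\<phi> v)}"
  have "induced_edges (pull_edges R \<phi> V) W \<subseteq> (\<lambda>(v, u). {u, v}) ` ?P"
    unfolding induced_edges_def pull_edges_def by (auto simp: image_iff)
  then have "card (induced_edges (pull_edges R \<phi> V) W) \<le> card ((\<lambda>(v, u). {u, v}) ` ?P)"
    using assms(2) by (intro card_mono) auto
  also have "\<dots> \<le> card ?P" using assms(2) by (intro card_image_le) auto
  also have "\<dots> = (\<Sum>v\<in>W. card {u \<in> W. R (\<phi> u) (\<phi> v)})" using assms(2) by simp
  finally show ?thesis .
qed

lemma card_edges_between_pull_edges:
  assumes "W \<subseteq> V" "Z \<subseteq> V" "W \<inter> Z = {}" "finite W" "finite Z"
  shows "card (edges_between (pull_edges R \<phi> V) W Z) = (\<Sum>z\<in>Z. card {w \<in> W. R (\<phi> w) (\<phi> z)})"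
proof -
  let ?P = "SIGMA z:Z. {w \<in> W. R (\<phi> w) (\<phi> z)}"
  have "edges_between (pull_edges R \<phi> V) W Z = (\<lambda>(z, w). {w, z}) ` ?P"
  proof (intro equalityI subsetI)
    fix e assume "e \<in> edges_between (pull_edges R \<phi> V) W Z"
    then obtain w z where "w \<in> W" "z \<in> Z" "e = {w, z}" "{w, z} \<in> pull_edges R \<phi> V"
      by (auto simp: edges_between_def)
    then show "e \<in> (\<lambda>(z, w). {w, z}) ` ?P" by (auto simp: pull_edges_iff image_iff)
  next
    fix e assume "e \<in> (\<lambda>(z, w). {w, z}) ` ?P"
    then obtain w z where "w \<in> W" "z \<in> Z" "e = {w, z}" "R (\<phi> w) (\<phi> z)" by auto
    then show "e \<in> edges_between (pull_edges R \<phi> V) W Z"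
      using assms by (auto simp: edges_between_def pull_edges_iff)
  qed
  moreover have "inj_on (\<lambda>(z, w). {w, z}) ?P"
    using assms(3) by (auto simp: inj_on_def doubleton_eq_iff)
  ultimately have "card (edges_between (pull_edges R \<phi> V) W Z) = card ?P"
    by (simp add: card_image)
  also have "\<dots> = (\<Sum>z\<in>Z. card {w \<in> W. R (\<phi> w) (\<phi> z)})" using assms by simp
  finally show ?thesis .
qed

end

section \<open>Independence numbers and fibre sizes\<close>

lemma finite_subset_cards: "finite V \<Longrightarrow> finite {card U | U. U \<subseteq> V \<and> P U}"
  by (rule finite_subset[of _ "card ` Pow V"]) auto

lemma p_independence_number_le:
  assumes "finite V" "0 < p"
    and "\<And>U. U \<subseteq> V \<Longrightarrow> K_free p U (induced_edges E U) \<Longrightarrow> real (card U) \<le> m"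
  shows "real (p_independence_number p V E) \<le> m"
proof -
  let ?A = "{card U | U. U \<subseteq> V \<and> K_free p U (induced_edges E U)}"
  have "finite ?A" using assms(1) by (rule finite_subset_cards)
  moreover have "K_free p {} (induced_edges E {})" using assms(2) by (auto simp: K_free_def)
  then have "?A \<noteq> {}" by blast
  ultimately have "Max ?A \<in> ?A" by (rule Max_in)
  then show ?thesis unfolding p_independence_number_def using assms(3) by auto
qed

lemma card_le_p_independence_number:
  assumes "finite V" "U \<subseteq> V" "K_free p U (induced_edges E U)"
  shows "card U \<le> p_independence_number p V E"
  unfolding p_independence_number_def
  using assms by (intro Max_ge finite_subset_cards) auto

lemma card_mod_class:
  fixes n M :: nat
  assumes "c < M"
  shows "n div M \<le> card {v \<in> {..<n}. v mod M = c}" "card {v \<in> {..<n}. v mod M = c} \<le> n div M + 1"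
proof -
  let ?f = "\<lambda>k. c + M * k"
  have inj: "inj_on ?f A" for A using assms by (auto simp: inj_on_def)
  have "?f ` {..<n div M} \<subseteq> {v \<in> {..<n}. v mod M = c}"
  proof
    fix v assume "v \<in> ?f ` {..<n div M}"
    then obtain k where k: "k < n div M" "v = c + M * k" by auto
    have "c + M * k < M * (k + 1)" using assms by simp
    also have "\<dots> \<le> M * (n div M)" using k by (intro mult_le_mono) auto
    also have "\<dots> \<le> n" by simp
    finally show "v \<in> {v \<in> {..<n}. v mod M = c}" using assms k by simp
  qed
  then have "card (?f ` {..<n div M}) \<le> card {v \<in> {..<n}. v mod M = c}" by (intro card_mono) auto
  then show "n div M \<le> card {v \<in> {..<n}. v mod M = c}" by (simp add: card_image inj)
  have "{v \<in> {..<n}. v mod M = c} \<subseteq> ?f ` {..n div M}"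
  proof
    fix v assume "v \<in> {v \<in> {..<n}. v mod M = c}"
    then have "v = c + M * (v div M)" "v div M \<le> n div M" by (auto intro: div_le_mono)
    then show "v \<in> ?f ` {..n div M}" by blast
  qed
  then have "card {v \<in> {..<n}. v mod M = c} \<le> card (?f ` {..n div M})" by (intro card_mono) auto
  then show "card {v \<in> {..<n}. v mod M = c} \<le> n div M + 1" by (simp add: card_image inj)
qed

text \<open>Residues distribute the interval cyclically over \<open>X\<close>, so every point is hit
  \<open>n div M\<close> or \<open>n div M + 1\<close> times; \<open>a\<close> is the first vertex
  of the side.\<close>

lemma card_blowup:
  fixes n M a :: nat
  assumes g: "bij_betw g {..<M} X" and Y: "Y \<subseteq> X" and M: "0 < M"
  shows "(n div M) * card Y \<le> card {v \<in> {a..<a + n}. g ((v - a) mod M) \<in> Y}"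
    and "card {v \<in> {a..<a + n}. g ((v - a) mod M) \<in> Y} \<le> (n div M + 1) * card Y"
proof -
  define I where "I = {i \<in> {..<M}. g i \<in> Y}"
  have "bij_betw g I Y"
    using g Y by (intro bij_betw_subset[OF g]) (auto simp: I_def bij_betw_def)
  then have cI: "card I = card Y" by (rule bij_betw_same_card)
  have "bij_betw (\<lambda>v. v + a) {v \<in> {..<n}. v mod M \<in> I} {v \<in> {a..<a + n}. g ((v - a) mod M) \<in> Y}"
    by (rule bij_betw_byWitness[where f' = "\<lambda>v. v - a"]) (use M in \<open>auto simp: I_def\<close>)
  then have "card {v \<in> {..<n}. v mod M \<in> I} = card {v \<in> {a..<a + n}. g ((v - a) mod M) \<in> Y}"
    by (rule bij_betw_same_card)
  then have "card {v \<in> {a..<a + n}. g ((v - a) mod M) \<in> Y} = card {v \<in> {..<n}. v mod M \<in> I}" ..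
  also have "{v \<in> {..<n}. v mod M \<in> I} = (\<Union>i\<in>I. {v \<in> {..<n}. v mod M = i})" by auto
  also have "card \<dots> = (\<Sum>i\<in>I. card {v \<in> {..<n}. v mod M = i})"
    by (rule card_UN_disjoint) (auto simp: I_def)
  finally have eq: "card {v \<in> {a..<a + n}. g ((v - a) mod M) \<in> Y} = (\<Sum>i\<in>I. card {v \<in> {..<n}. v mod M = i})" .
  have "(\<Sum>i\<in>I. n div M) \<le> (\<Sum>i\<in>I. card {v \<in> {..<n}. v mod M = i})"
    by (intro sum_mono card_mod_class) (auto simp: I_def)
  then show "(n div M) * card Y \<le> card {v \<in> {a..<a + n}. g ((v - a) mod M) \<in> Y}"
    unfolding eq by (simp add: cI mult.commute)
  have "(\<Sum>i\<in>I. card {v \<in> {..<n}. v mod M = i}) \<le> (\<Sum>i\<in>I. n div M + 1)"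
    by (intro sum_mono card_mod_class) (auto simp: I_def)
  then show "card {v \<in> {a..<a + n}. g ((v - a) mod M) \<in> Y} \<le> (n div M + 1) * card Y"
    unfolding eq by (simp add: cI mult.commute)
qed

lemma K_free_induced_mono:
  assumes free: "K_free p U (induced_edges E U)" and sub: "U' \<subseteq> U"
  shows "K_free p U' (induced_edges E U')"
  unfolding K_free_def
proof
  assume "\<exists>S\<subseteq>U'. finite S \<and> card S = p \<and> (\<forall>x\<in>S. \<forall>y\<in>S. x \<noteq> y \<longrightarrow> {x, y} \<in> induced_edges E U')"
  then obtain S where S: "S \<subseteq> U'" "finite S" "card S = p"
    "\<forall>x\<in>S. \<forall>y\<in>S. x \<noteq> y \<longrightarrow> {x, y} \<in> induced_edges E U'" by (elim exE conjE)
  have "induced_edges E U' \<subseteq> induced_edges E U" using sub by (auto simp: induced_edges_def)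
  then have "\<forall>x\<in>S. \<forall>y\<in>S. x \<noteq> y \<longrightarrow> {x, y} \<in> induced_edges E U" using S(4) by blast
  moreover have "S \<subseteq> U" using S(1) sub by (rule order.trans)
  ultimately show False using free S(2,3) unfolding K_free_def by blast
qed

context two_sided_model
begin

text \<open>Rounding up the fibres gives \<open>(q + 1) * M \<le> n + M \<le> 2 * n\<close>, whence
  the factor 2 on each side; a \<open>K_p\<close>-free set splits over the two sides, whence the
  4.\<close>

lemma blowup_graph:
  assumes l: "0 < l" "l < p" and delta: "\<delta> > 0" "\<delta> \<le> 1"
  shows "\<exists>n0. \<forall>n\<ge>n0. \<exists>E. sgraph {..<2 * n} E \<and>
    real (p_independence_number p {..<2 * n} E) \<le> 4 * \<delta> * real n \<and>
    real (card (induced_edges E {..<n})) \<le> 2 * \<delta> * (real n)\<^sup>2 \<and>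
    real (card (induced_edges E {n..<2 * n})) \<le> 2 * \<delta> * (real n)\<^sup>2 \<and>
    \<bar>real (card (edges_between E {..<n} {n..<2 * n})) - real l / real p * (real n)\<^sup>2\<bar> \<le> 2 * \<delta> * (real n)\<^sup>2 \<and>
    (2 * l \<le> p \<longrightarrow> K_free (p + l + 1) {..<2 * n} E)"
proof -
  define M where "M = card X"
  have M: "M > 0" using finite_X X_nonempty by (simp add: M_def card_gt_0_iff)
  obtain g where g: "bij_betw g {..<M} X"
    using ex_bij_betw_nat_finite[OF finite_X] by (auto simp: M_def atLeast0LessThan)
  \<comment> \<open>\<open>True\<close> marks the first side. \<open>C\<close> always receives its
    first argument from there, which makes \<open>R\<close> symmetric.\<close>
  define R where "R = (\<lambda>s t. if fst s = fst t then S (snd s) (snd t)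
      else if fst s then C (snd s) (snd t) else C (snd t) (snd s))"
  have R_sym: "symp R" using symp_S by (auto simp: symp_def R_def)
  have R_irr: "irreflp R" using irreflp_S by (simp add: irreflp_def R_def)
  \<comment> \<open>Ensures \<open>2 * M \<le> \<delta> * n\<close>, so that rounding costs at most
    another \<open>\<delta> * n\<close> in each cross degree.\<close>
  define n0 where "n0 = nat \<lceil>2 * real M / \<delta>\<rceil> + M + 1"
  show ?thesis
  proof (intro exI[of _ n0] allI impI)
    fix n assume n: "n \<ge> n0"
    have nM: "M \<le> n" "0 < n" using n by (auto simp: n0_def)
    have "2 * real M / \<delta> \<le> real n" using n unfolding n0_def by linarith
    then have nd: "2 * real M \<le> \<delta> * real n" using delta by (simp add: divide_le_eq mult.commute)
    define V where "V = {..<2 * n}"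
    define \<phi> where "\<phi> = (\<lambda>v. (v < n, g ((v - (if v < n then 0 else n)) mod M)))"
    define E where "E = pull_edges R \<phi> V"
    have gX: "g (v mod M) \<in> X" for v using g M by (auto simp: bij_betw_def)
    define q where "q = n div M"
    have "q * M \<le> n" "n \<le> (q + 1) * M"
      using M dividend_less_div_times[of M n] by (simp_all add: q_def)
    then have "real (q * M) \<le> real n" "real n \<le> real ((q + 1) * M)" by (simp_all only: of_nat_le_iff)
    then have q: "real q \<le> real n / real M" "real n / real M - 1 \<le> real q"
      using M by (simp_all add: field_simps)
    have qM: "(real q + 1) * real M \<le> real n + real M"
      using mult_right_mono[OF q(1), of "real M"] M by (simp add: algebra_simps)
    have side: "(\<forall>U\<subseteq>A. K_free p U (induced_edges E U) \<longrightarrow> real (card U) \<le> 2 * \<delta> * real n)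
        \<and> real (card (induced_edges E A)) \<le> 2 * \<delta> * (real n)\<^sup>2"
      if A: "A = {a..<a + n}" "A \<subseteq> V" "\<And>v. v \<in> A \<Longrightarrow> \<phi> v = (b, g ((v - a) mod M))" for A a b
    proof (intro conjI allI impI)
      fix U assume U: "U \<subseteq> A" "K_free p U (induced_edges E U)"
      \<comment> \<open>The trace of \<open>U\<close> in the model. If it were dense it would
        contain a \<open>p\<close>-clique, which lifts to \<open>U\<close>; being sparse, it bounds
        \<open>U\<close> through the fibre sizes.\<close>
      define Y where "Y = (\<lambda>v. g ((v - a) mod M)) ` U"
      have YX: "Y \<subseteq> X" using gX by (auto simp: Y_def)
      then have finY: "finite Y" using finite_X finite_subset by blast
      have "\<not> \<delta> * real (card X) \<le> real (card Y)"
      proof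
        assume "\<delta> * real (card X) \<le> real (card Y)"
        then obtain Q where Q: "Q \<subseteq> Y" "card Q = p" "clique S Q" using dense_clique YX by blast
        have "Pair b ` Q \<subseteq> \<phi> ` U"
        proof
          fix s assume "s \<in> Pair b ` Q"
          then obtain v where "v \<in> U" "s = (b, g ((v - a) mod M))" using Q(1) by (auto simp: Y_def)
          then show "s \<in> \<phi> ` U" using A(3)[of v] U(1) by (metis image_eqI subsetD)
        qed
        moreover have "clique R (Pair b ` Q)" using Q(3) by (auto simp: clique_def R_def)
        moreover have "card (Pair b ` Q) = p" using Q(2) by (simp add: card_image inj_on_def)
        moreover have "finite (Pair b ` Q)" using Q(1) finY finite_subset by blast
        moreover have "U \<subseteq> V" using U(1) A(2) by blast
        ultimately show False
          using not_K_free_pull_edges[OF R_sym R_irr] U(2) unfolding E_def by blast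
      qed
      then have Ysmall: "real (card Y) \<le> \<delta> * real M" by (simp add: M_def)
      have "U \<subseteq> {v \<in> {a..<a + n}. g ((v - a) mod M) \<in> Y}" using U(1) A(1) by (auto simp: Y_def)
      then have "card U \<le> card {v \<in> {a..<a + n}. g ((v - a) mod M) \<in> Y}" by (intro card_mono) auto
      also have "\<dots> \<le> (q + 1) * card Y" unfolding q_def by (rule card_blowup(2)[OF g YX M])
      finally have "real (card U) \<le> real ((q + 1) * card Y)" by (rule of_nat_mono)
      also have "\<dots> = (real q + 1) * real (card Y)" by (simp add: distrib_right)
      also have "\<dots> \<le> (real q + 1) * (\<delta> * real M)" using Ysmall by (intro mult_left_mono) auto
      also have "\<dots> = \<delta> * ((real q + 1) * real M)" by simp
      also have "\<dots> \<le> \<delta> * (real n + real M)" using qM delta by (intro mult_left_mono) auto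
      also have "\<dots> \<le> \<delta> * (real n + real n)" using nM delta by (intro mult_left_mono add_mono) auto
      finally show "real (card U) \<le> 2 * \<delta> * real n" by simp
    next
      have "card (induced_edges E A) \<le> (\<Sum>v\<in>A. card {u \<in> A. R (\<phi> u) (\<phi> v)})"
        unfolding E_def using A(1,2) by (intro card_induced_pull_edges_le[OF R_sym R_irr]) auto
      then have "real (card (induced_edges E A)) \<le> real (\<Sum>v\<in>A. card {u \<in> A. R (\<phi> u) (\<phi> v)})"
        by (rule of_nat_mono)
      also have "\<dots> = (\<Sum>v\<in>A. real (card {u \<in> A. R (\<phi> u) (\<phi> v)}))" by simp
      also have "\<dots> \<le> (\<Sum>v\<in>A. 2 * \<delta> * real n)"
      proof (rule sum_mono)
        fix v assume v: "v \<in> A"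
        define y where "y = g ((v - a) mod M)"
        define Y where "Y = {x \<in> X. S x y}"
        have YX: "Y \<subseteq> X" by (auto simp: Y_def)
        have Ysmall: "real (card Y) \<le> \<delta> * real M"
          using sparse gX by (auto simp: Y_def y_def M_def)
        have "{u \<in> A. R (\<phi> u) (\<phi> v)} = {u \<in> {a..<a + n}. g ((u - a) mod M) \<in> Y}"
          using A(1) A(3)[OF v] A(3) gX by (auto simp: Y_def R_def y_def)
        then have "card {u \<in> A. R (\<phi> u) (\<phi> v)} \<le> (q + 1) * card Y"
          unfolding q_def using card_blowup(2)[OF g YX M] by metis
        then have "real (card {u \<in> A. R (\<phi> u) (\<phi> v)}) \<le> real ((q + 1) * card Y)" by (rule of_nat_mono)
        also have "\<dots> = (real q + 1) * real (card Y)" by (simp add: distrib_right)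
        also have "\<dots> \<le> (real q + 1) * (\<delta> * real M)" using Ysmall by (intro mult_left_mono) auto
        also have "\<dots> = \<delta> * ((real q + 1) * real M)" by simp
        also have "\<dots> \<le> \<delta> * (real n + real M)" using qM delta by (intro mult_left_mono) auto
        also have "\<dots> \<le> \<delta> * (real n + real n)" using nM delta by (intro mult_left_mono add_mono) auto
        finally show "real (card {u \<in> A. R (\<phi> u) (\<phi> v)}) \<le> 2 * \<delta> * real n" by simp
      qed
      also have "\<dots> = 2 * \<delta> * (real n)\<^sup>2" using A(1) by (simp add: power2_eq_square)
      finally show "real (card (induced_edges E A)) \<le> 2 * \<delta> * (real n)\<^sup>2" .
    qed
    define W where "W = {0..<0 + n}"
    define Z where "Z = {n..<n + n}"
    have WZ: "W = {..<n}" "Z = {n..<2 * n}" "V = W \<union> Z" "W \<inter> Z = {}" "finite W" "finite Z" "W \<subseteq> V" "Z \<subseteq> V"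
      by (auto simp: W_def Z_def V_def)
    have phiW: "\<phi> v = (True, g ((v - 0) mod M))" if "v \<in> W" for v using that by (simp add: \<phi>_def W_def)
    have phiZ: "\<phi> v = (False, g ((v - n) mod M))" if "v \<in> Z" for v using that by (simp add: \<phi>_def Z_def)
    note sideW = side[OF W_def WZ(7) phiW]
    note sideZ = side[OF Z_def WZ(8) phiZ]
    have indep: "real (p_independence_number p V E) \<le> 4 * \<delta> * real n"
    proof (rule p_independence_number_le)
      fix U assume U: "U \<subseteq> V" "K_free p U (induced_edges E U)"
      have restr: "K_free p (U \<inter> B) (induced_edges E (U \<inter> B))" for B
        by (rule K_free_induced_mono[OF U(2)]) simp
      have "U = (U \<inter> W) \<union> (U \<inter> Z)" using U(1) WZ(3) by blast
      then have "card U \<le> card (U \<inter> W) + card (U \<inter> Z)" by (metis card_Un_le)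
      then have "real (card U) \<le> real (card (U \<inter> W)) + real (card (U \<inter> Z))" by linarith
      also have "\<dots> \<le> 2 * \<delta> * real n + 2 * \<delta> * real n"
        using sideW sideZ restr by (intro add_mono) (meson inf_le2)+
      finally show "real (card U) \<le> 4 * \<delta> * real n" by simp
    qed (use l in \<open>auto simp: V_def\<close>)
    have cross: "\<bar>real (card (edges_between E W Z)) - real l / real p * (real n)\<^sup>2\<bar> \<le> 2 * \<delta> * (real n)\<^sup>2"
    proof -
      define c where "c = (\<lambda>z. card {w \<in> W. R (\<phi> w) (\<phi> z)})"
      have c: "\<bar>real (c z) - real l / real p * real n\<bar> \<le> 2 * \<delta> * real n" if z: "z \<in> Z" for z
      proof -
        define y where "y = g ((z - n) mod M)"
        define Y where "Y = {x \<in> X. C x y}"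
        have YX: "Y \<subseteq> X" by (auto simp: Y_def)
        have dens: "\<bar>real (card Y) - real l / real p * real M\<bar> \<le> \<delta> * real M"
          using cross_regular gX by (auto simp: Y_def y_def M_def)
        have "{w \<in> W. R (\<phi> w) (\<phi> z)} = {u \<in> {0..<0 + n}. g ((u - 0) mod M) \<in> Y}"
          using phiZ[OF z] phiW gX by (auto simp: Y_def R_def y_def W_def)
        then have ceq: "c z = card {u \<in> {0..<0 + n}. g ((u - 0) mod M) \<in> Y}" by (simp add: c_def)
        have lp: "0 \<le> real l / real p" "real l / real p \<le> 1" using l by auto
        define t where "t = real l / real p"
        have tn: "t * real M \<le> real M" using lp by (intro mult_left_le_one_le) (auto simp: t_def)
        have dM: "\<delta> * real M \<le> real M" using delta by (intro mult_left_le_one_le) auto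
        have "c z \<le> (q + 1) * card Y" unfolding q_def ceq by (rule card_blowup(2)[OF g YX M])
        then have "real (c z) \<le> real ((q + 1) * card Y)" by (rule of_nat_mono)
        also have "\<dots> = (real q + 1) * real (card Y)" by (simp add: distrib_right)
        also have "\<dots> \<le> (real q + 1) * ((t + \<delta>) * real M)"
          using dens by (intro mult_left_mono) (auto simp: t_def algebra_simps abs_le_iff)
        also have "\<dots> = (t + \<delta>) * ((real q + 1) * real M)" by simp
        also have "\<dots> \<le> (t + \<delta>) * (real n + real M)"
          using qM delta lp by (intro mult_left_mono) (auto simp: t_def)
        also have "\<dots> = t * real n + \<delta> * real n + (t * real M + \<delta> * real M)" by (simp add: algebra_simps)
        also have "\<dots> \<le> t * real n + \<delta> * real n + \<delta> * real n" using tn dM nd by simp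
        finally have upper: "real (c z) \<le> t * real n + 2 * \<delta> * real n" by simp
        have "t * real n - 2 * \<delta> * real n \<le> t * real n - \<delta> * real n - (t * real M - \<delta> * real M)"
        proof -
          have "0 \<le> \<delta> * real M" using delta by simp
          then show ?thesis using tn nd by simp
        qed
        also have "\<dots> = (real n / real M - 1) * ((t - \<delta>) * real M)"
          using M by (simp add: field_simps)
        also have "\<dots> \<le> (real n / real M - 1) * real (card Y)"
          using dens nM M by (intro mult_left_mono) (auto simp: t_def algebra_simps abs_le_iff le_divide_eq)
        also have "\<dots> \<le> real q * real (card Y)" using q(2) by (intro mult_right_mono) auto
        also have "\<dots> = real (q * card Y)" by simp
        also have "\<dots> \<le> real (c z)" unfolding q_def ceq by (intro of_nat_mono card_blowup(1)[OF g YX M])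
        finally show ?thesis using upper by (simp add: t_def abs_le_iff)
      qed
      have "real (card (edges_between E W Z)) = real (\<Sum>z\<in>Z. c z)"
        unfolding E_def c_def by (subst card_edges_between_pull_edges[OF R_sym R_irr WZ(7,8,4,5,6)]) simp_all
      also have "\<dots> = (\<Sum>z\<in>Z. real (c z))" by simp
      finally have "real (card (edges_between E W Z)) - real l / real p * (real n)\<^sup>2
          = (\<Sum>z\<in>Z. real (c z) - real l / real p * real n)"
        by (simp add: sum_subtractf Z_def power2_eq_square)
      also have "\<bar>\<dots>\<bar> \<le> (\<Sum>z\<in>Z. 2 * \<delta> * real n)" by (rule order.trans[OF sum_abs sum_mono]) (rule c)
      also have "\<dots> = 2 * \<delta> * (real n)\<^sup>2" by (simp add: Z_def power2_eq_square)
      finally show ?thesis .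
    qed
    have free: "K_free (p + l + 1) V E" if "2 * l \<le> p"
      unfolding E_def
    proof (rule K_free_pull_edges[OF R_sym R_irr])
      fix Q assume Q: "finite Q" "clique R Q"
      define Q1 where "Q1 = {x. (True, x) \<in> Q}"
      define Q2 where "Q2 = {x. (False, x) \<in> Q}"
      have Qeq: "Q = Pair True ` Q1 \<union> Pair False ` Q2"
      proof (intro equalityI subsetI)
        fix s assume "s \<in> Q"
        then show "s \<in> Pair True ` Q1 \<union> Pair False ` Q2"
          by (cases s; cases "fst s") (auto simp: Q1_def Q2_def)
      qed (auto simp: Q1_def Q2_def)
      have fin: "finite Q1" "finite Q2"
        using Q(1) unfolding Qeq by (auto dest!: finite_imageD simp: inj_on_def)
      have "card Q = card (Pair True ` Q1) + card (Pair False ` Q2)"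
        unfolding Qeq using fin by (intro card_Un_disjoint) auto
      then have card: "card Q = card Q1 + card Q2" by (simp add: card_image inj_on_def)
      have "clique S Q1" "clique S Q2" "\<forall>x\<in>Q1. \<forall>y\<in>Q2. C x y"
        using Q(2) by (fastforce simp: clique_def R_def Q1_def Q2_def)+
      then show "card Q \<noteq> p + l + 1"
        unfolding card using no_two_sided_clique[OF that fin] by blast
    qed
    have "sgraph V E" unfolding E_def
      by (rule sgraph_pull_edges[OF R_sym R_irr]) (auto simp: V_def)
    then show "\<exists>E. sgraph {..<2 * n} E \<and>
      real (p_independence_number p {..<2 * n} E) \<le> 4 * \<delta> * real n \<and>
      real (card (induced_edges E {..<n})) \<le> 2 * \<delta> * (real n)\<^sup>2 \<and>
      real (card (induced_edges E {n..<2 * n})) \<le> 2 * \<delta> * (real n)\<^sup>2 \<and>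
      \<bar>real (card (edges_between E {..<n} {n..<2 * n})) - real l / real p * (real n)\<^sup>2\<bar> \<le> 2 * \<delta> * (real n)\<^sup>2 \<and>
      (2 * l \<le> p \<longrightarrow> K_free (p + l + 1) {..<2 * n} E)"
      unfolding WZ(1,2)[symmetric] V_def[symmetric]
      using indep cross free sideW sideZ by (intro exI[of _ E] conjI) auto
  qed
qed

end

lemma two_sided_graph:
  assumes l: "0 < l" "l < p" and eps: "\<epsilon> > 0"
  shows "\<exists>n0. \<forall>n\<ge>n0. \<exists>E. sgraph {..<2 * n} E \<and>
    real (p_independence_number p {..<2 * n} E) \<le> \<epsilon> * real n \<and>
    real (card (induced_edges E {..<n})) \<le> \<epsilon> * (real n)\<^sup>2 \<and>
    real (card (induced_edges E {n..<2 * n})) \<le> \<epsilon> * (real n)\<^sup>2 \<and>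
    \<bar>real (card (edges_between E {..<n} {n..<2 * n})) - real l / real p * (real n)\<^sup>2\<bar> \<le> \<epsilon> * (real n)\<^sup>2 \<and>
    (2 * l \<le> p \<longrightarrow> K_free (p + l + 1) {..<2 * n} E)"
proof -
  define \<delta> where "\<delta> = min (\<epsilon> / 4) 1"
  have delta: "\<delta> > 0" "\<delta> \<le> 1" "4 * \<delta> \<le> \<epsilon>" using eps by (auto simp: \<delta>_def)
  have le: "4 * \<delta> * real n \<le> \<epsilon> * real n" "2 * \<delta> * (real n)\<^sup>2 \<le> \<epsilon> * (real n)\<^sup>2" for n
    using delta by (auto intro!: mult_right_mono)
  obtain X and S C :: "nat list \<Rightarrow> nat list \<Rightarrow> bool" where "two_sided_model X S C p l \<delta>"
    using two_sided_model_exists[OF l delta(1)] by blast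
  then interpret two_sided_model X S C p l \<delta> .
  show ?thesis using blowup_graph[OF l delta(1,2)] le by (meson order.trans)
qed

section \<open>The Ramsey-Turan density\<close>

definition rt_graph :: "nat \<Rightarrow> nat \<Rightarrow> nat \<Rightarrow> real \<Rightarrow> nat set set \<Rightarrow> bool" where
  "rt_graph p n q m E \<longleftrightarrow>
     sgraph {..<n} E \<and> K_free q {..<n} E \<and> real (p_independence_number p {..<n} E) \<le> m"

lemma cliqueD: "clique R Q \<Longrightarrow> x \<in> Q \<Longrightarrow> y \<in> Q \<Longrightarrow> x \<noteq> y \<Longrightarrow> R x y"
  by (simp add: clique_def)

lemma K_freeD:
  "K_free q V E \<Longrightarrow> card S = q \<Longrightarrow> finite S \<Longrightarrow> S \<subseteq> V \<Longrightarrow>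
     \<forall>x\<in>S. \<forall>y\<in>S. x \<noteq> y \<longrightarrow> {x, y} \<in> E \<Longrightarrow> False"
  unfolding K_free_def by (erule notE) (intro exI[of _ S] conjI; assumption)

lemma sgraph_subset_Pow: "sgraph V E \<Longrightarrow> E \<subseteq> Pow V"
  by (auto simp: sgraph_def)

lemma card_sgraph_le:
  assumes "sgraph V E"
  shows "card E \<le> card V choose 2"
proof -
  have fin: "finite V" using assms by (simp add: sgraph_def)
  have "E \<subseteq> {B. B \<subseteq> V \<and> card B = 2}" using assms by (auto simp: sgraph_def)
  then have "card E \<le> card {B. B \<subseteq> V \<and> card B = 2}" using fin by (intro card_mono) auto
  then show ?thesis using n_subsets[OF fin, of 2] by simp
qed

lemma finite_rt_cards: "finite {card E | E. rt_graph p n q m E}"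
proof (rule finite_subset)
  show "{card E | E. rt_graph p n q m E} \<subseteq> {..n choose 2}"
    using card_sgraph_le[of "{..<n}"] by (auto simp: rt_graph_def)
qed simp

lemma ramsey_turan_eq_Max: "ramsey_turan p n q m = Max {card E | E. rt_graph p n q m E}"
  by (simp add: ramsey_turan_def rt_graph_def)

lemma card_le_ramsey_turan: "rt_graph p n q m E \<Longrightarrow> card E \<le> ramsey_turan p n q m"
  unfolding ramsey_turan_eq_Max by (rule Max_ge[OF finite_rt_cards]) blast

text \<open>The hypothesis excludes the maximum of an empty set.\<close>

lemma ramsey_turan_attained:
  assumes "rt_graph p n q m E"
  obtains E' where "rt_graph p n q m E'" "card E' = ramsey_turan p n q m"
proof -
  have "Max {card E | E. rt_graph p n q m E} \<in> {card E | E. rt_graph p n q m E}"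
    by (rule Max_in[OF finite_rt_cards]) (use assms in blast)
  then show thesis using that unfolding ramsey_turan_eq_Max by auto
qed

lemma rt_graph_mono: "rt_graph p n q m E \<Longrightarrow> m \<le> m' \<Longrightarrow> rt_graph p n q m' E"
  by (auto simp: rt_graph_def)

lemma rt_graph_restrict:
  assumes E: "rt_graph p N q m E" and n: "n \<le> N" and p: "0 < p"
  shows "rt_graph p n q m (induced_edges E {..<n})"
proof -
  have sub: "{..<n} \<subseteq> {..<N}" using n by auto
  have g: "sgraph {..<n} (induced_edges E {..<n})"
    using E by (auto simp: rt_graph_def sgraph_def induced_edges_def)
  have f: "K_free q {..<n} (induced_edges E {..<n})"
  proof (rule K_free_induced_mono[OF _ sub])
    have "induced_edges E {..<N} = E"
      using E by (auto simp: rt_graph_def sgraph_def induced_edges_def)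
    then show "K_free q {..<N} (induced_edges E {..<N})" using E by (simp add: rt_graph_def)
  qed
  have "real (p_independence_number p {..<n} (induced_edges E {..<n})) \<le> m"
  proof (rule p_independence_number_le)
    fix U assume U: "U \<subseteq> {..<n}" "K_free p U (induced_edges (induced_edges E {..<n}) U)"
    have "induced_edges (induced_edges E {..<n}) U = induced_edges E U"
      using U(1) by (auto simp: induced_edges_def)
    then have "card U \<le> p_independence_number p {..<N} E"
      using U sub by (intro card_le_p_independence_number) auto
    then show "real (card U) \<le> m" using E by (simp add: rt_graph_def)
  qed (use p in auto)
  then show ?thesis using g f by (simp add: rt_graph_def)
qed

text \<open>The disjoint union with \<open>H\<close> only serves to reach every vertex number; the independence
  ratio is not increased by it.\<close>

lemma rt_graph_blowup_union:
  assumes G: "rt_graph p n q (\<epsilon> * real n) E" and H: "rt_graph p s q (\<epsilon> * real s) F"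
    and p: "0 < p" and n: "0 < n"
  shows "\<exists>E'. rt_graph p (t * n + s) q (\<epsilon> * real (t * n + s)) E' \<and> t\<^sup>2 * card E \<le> card E'"
proof -
  define V where "V = {..<t * n + s}"
  define \<phi> where "\<phi> = (\<lambda>v. if v < t * n then Inl (v mod n) else Inr (v - t * n))"
  define R :: "nat + nat \<Rightarrow> nat + nat \<Rightarrow> bool" where
    "R = (\<lambda>x y. case x of Inl a \<Rightarrow> (case y of Inl b \<Rightarrow> {a, b} \<in> E | Inr _ \<Rightarrow> False)
                        | Inr a \<Rightarrow> (case y of Inl _ \<Rightarrow> False | Inr b \<Rightarrow> {a, b} \<in> F))"
  have R_simps [simp]: "R (Inl a) (Inl b) \<longleftrightarrow> {a, b} \<in> E" "R (Inr a) (Inr b) \<longleftrightarrow> {a, b} \<in> F"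
    "\<not> R (Inl a) (Inr b)" "\<not> R (Inr a) (Inl b)" for a b by (simp_all add: R_def)
  have loopless: "{a} \<notin> E" "{a} \<notin> F" for a
    using G H by (auto simp: rt_graph_def sgraph_def)
  have symp: "symp R"
  proof (rule sympI)
    fix x y assume "R x y" then show "R y x" by (cases x; cases y) (simp_all add: insert_commute)
  qed
  have irr: "irreflp R"
  proof (rule irreflpI)
    fix x show "\<not> R x x" using loopless by (cases x) simp_all
  qed
  define E' where "E' = pull_edges R \<phi> V"
  have "sgraph V E'" unfolding E'_def by (rule sgraph_pull_edges[OF symp irr]) (simp add: V_def)
  moreover have "K_free q V E'"
    unfolding E'_def
  proof (rule K_free_pull_edges[OF symp irr])
    fix Q assume Q: "finite Q" "Q \<subseteq> \<phi> ` V" "clique R Q"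
    have range: "a < n" if "Inl a \<in> Q" for a
    proof -
      obtain v where "Inl a = \<phi> v" using Q(2) \<open>Inl a \<in> Q\<close> by blast
      then show ?thesis using n by (auto simp: \<phi>_def split: if_splits)
    qed
    have range': "b < s" if "Inr b \<in> Q" for b
    proof -
      obtain v where "v \<in> V" "Inr b = \<phi> v" using Q(2) \<open>Inr b \<in> Q\<close> by blast
      then show ?thesis by (auto simp: \<phi>_def V_def split: if_splits)
    qed
    show "card Q \<noteq> q"
    proof
      assume cQ: "card Q = q"
      show False
      proof (cases "\<exists>b. Inr b \<in> Q")
        case False
        define Q1 where "Q1 = {a. Inl a \<in> Q}"
        have Qeq: "Q = Inl ` Q1"
        proof (intro equalityI subsetI)
          fix x assume "x \<in> Q" then show "x \<in> Inl ` Q1" using False by (cases x) (auto simp: Q1_def)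
        qed (auto simp: Q1_def)
        then have "card Q1 = q" using cQ by (simp add: card_image)
        moreover have "finite Q1" using Q(1) Qeq by (auto dest: finite_imageD)
        moreover have "Q1 \<subseteq> {..<n}" using range by (auto simp: Q1_def)
        moreover have "\<forall>x\<in>Q1. \<forall>y\<in>Q1. x \<noteq> y \<longrightarrow> {x, y} \<in> E"
        proof (intro ballI impI)
          fix x y assume "x \<in> Q1" "y \<in> Q1" "x \<noteq> y"
          then have "Inl x \<in> Q" "Inl y \<in> Q" "Inl x \<noteq> Inl y" by (simp_all add: Q1_def)
          then have "R (Inl x) (Inl y)" by (rule cliqueD[OF Q(3)])
          then show "{x, y} \<in> E" by simp
        qed
        ultimately show False using G unfolding rt_graph_def by (elim conjE K_freeD)
      next
        case True
        then obtain b where b: "Inr b \<in> Q" by blast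
        \<comment> \<open>There are no edges between the two parts, so a clique lies in one of
          them.\<close>
        have noInl: "Inl a \<notin> Q" for a
        proof
          assume "Inl a \<in> Q"
          then have "R (Inl a) (Inr b)" by (rule cliqueD[OF Q(3) _ b]) simp
          then show False by simp
        qed
        define Q2 where "Q2 = {a. Inr a \<in> Q}"
        have Qeq: "Q = Inr ` Q2"
        proof (intro equalityI subsetI)
          fix x assume "x \<in> Q" then show "x \<in> Inr ` Q2" using noInl by (cases x) (auto simp: Q2_def)
        qed (auto simp: Q2_def)
        then have "card Q2 = q" using cQ by (simp add: card_image)
        moreover have "finite Q2" using Q(1) Qeq by (auto dest: finite_imageD)
        moreover have "Q2 \<subseteq> {..<s}" using range' by (auto simp: Q2_def)
        moreover have "\<forall>x\<in>Q2. \<forall>y\<in>Q2. x \<noteq> y \<longrightarrow> {x, y} \<in> F"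
        proof (intro ballI impI)
          fix x y assume "x \<in> Q2" "y \<in> Q2" "x \<noteq> y"
          then have "Inr x \<in> Q" "Inr y \<in> Q" "Inr x \<noteq> Inr y" by (simp_all add: Q2_def)
          then have "R (Inr x) (Inr y)" by (rule cliqueD[OF Q(3)])
          then show "{x, y} \<in> F" by simp
        qed
        ultimately show False using H unfolding rt_graph_def by (elim conjE K_freeD)
      qed
    qed
  qed
  moreover have "real (p_independence_number p V E') \<le> \<epsilon> * real (t * n + s)"
  proof (rule p_independence_number_le)
    fix U assume U: "U \<subseteq> V" "K_free p U (induced_edges E' U)"
    have finU: "finite U" using U(1) by (auto simp: V_def intro: finite_subset)
    define U1 where "U1 = U \<inter> {..<t * n}"
    define Y where "Y = (\<lambda>v. v mod n) ` U1"
    define U2 where "U2 = {b. t * n + b \<in> U}"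
    have no_clique: "\<not> (clique R Q \<and> card Q = p \<and> finite Q)" if "Q \<subseteq> \<phi> ` U" for Q
      using not_K_free_pull_edges[OF symp irr U(1) _ that] U(2) unfolding E'_def by blast
    have "K_free p Y (induced_edges E Y)"
      unfolding K_free_def
    proof
      assume "\<exists>S\<subseteq>Y. finite S \<and> card S = p \<and> (\<forall>x\<in>S. \<forall>y\<in>S. x \<noteq> y \<longrightarrow> {x, y} \<in> induced_edges E Y)"
      then obtain S where S: "S \<subseteq> Y" "finite S" "card S = p"
        "\<forall>x\<in>S. \<forall>y\<in>S. x \<noteq> y \<longrightarrow> {x, y} \<in> induced_edges E Y" by (elim exE conjE)
      have "Inl ` S \<subseteq> \<phi> ` U"
      proof
        fix x :: "nat + nat" assume "x \<in> Inl ` S"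
        then obtain v where "v \<in> U" "v < t * n" "x = Inl (v mod n)" using S(1) by (auto simp: Y_def U1_def)
        then show "x \<in> \<phi> ` U" by (intro image_eqI[of _ _ v]) (simp_all add: \<phi>_def)
      qed
      moreover have "clique R (Inl ` S)" using S(4) by (auto simp: clique_def induced_edges_def)
      ultimately show False using no_clique[of "Inl ` S"] S(2,3) by (simp add: card_image)
    qed
    moreover have "Y \<subseteq> {..<n}" using n by (auto simp: Y_def)
    ultimately have "card Y \<le> p_independence_number p {..<n} E"
      by (intro card_le_p_independence_number) auto
    then have Y: "real (card Y) \<le> \<epsilon> * real n" using G by (simp add: rt_graph_def)
    have "K_free p U2 (induced_edges F U2)"
      unfolding K_free_def
    proof
      assume "\<exists>S\<subseteq>U2. finite S \<and> card S = p \<and> (\<forall>x\<in>S. \<forall>y\<in>S. x \<noteq> y \<longrightarrow> {x, y} \<in> induced_edges F U2)"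
      then obtain S where S: "S \<subseteq> U2" "finite S" "card S = p"
        "\<forall>x\<in>S. \<forall>y\<in>S. x \<noteq> y \<longrightarrow> {x, y} \<in> induced_edges F U2" by (elim exE conjE)
      have "Inr ` S \<subseteq> \<phi> ` U"
      proof
        fix x :: "nat + nat" assume "x \<in> Inr ` S"
        then obtain b where "t * n + b \<in> U" "x = Inr b" using S(1) by (auto simp: U2_def)
        then show "x \<in> \<phi> ` U" by (intro image_eqI[of _ _ "t * n + b"]) (simp_all add: \<phi>_def)
      qed
      moreover have "clique R (Inr ` S)" using S(4) by (auto simp: clique_def induced_edges_def)
      ultimately show False using no_clique[of "Inr ` S"] S(2,3) by (simp add: card_image)
    qed
    moreover have "U2 \<subseteq> {..<s}" using U(1) by (auto simp: U2_def V_def)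
    ultimately have "card U2 \<le> p_independence_number p {..<s} F"
      by (intro card_le_p_independence_number) auto
    then have U2: "real (card U2) \<le> \<epsilon> * real s" using H by (simp add: rt_graph_def)
    have finU1: "finite U1" using finU by (simp add: U1_def)
    \<comment> \<open>\<open>U1\<close> is at most \<open>t\<close> times as large as its trace
      \<open>Y\<close>, which is \<open>K_p\<close>-free in \<open>E\<close>.\<close>
    have "(\<lambda>v. (v div n, v mod n)) ` U1 \<subseteq> {..<t} \<times> Y"
      by (auto simp: U1_def Y_def less_mult_imp_div_less)
    moreover have "inj_on (\<lambda>v. (v div n, v mod n)) U1"
      by (rule inj_onI) (metis div_mult_mod_eq prod.inject)
    ultimately have "card U1 \<le> card ({..<t} \<times> Y)"
      using finU1 by (intro card_inj_on_le) (auto simp: Y_def)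
    then have cU1: "card U1 \<le> t * card Y" by (simp only: card_cartesian_product card_lessThan)
    have fin2: "finite U2" unfolding U2_def by (rule finite_subset[of _ "(\<lambda>v. v - t * n) ` U"]) (use finU in \<open>force+\<close>)
    have "U \<subseteq> U1 \<union> (\<lambda>b. t * n + b) ` U2"
    proof
      fix v assume v: "v \<in> U"
      show "v \<in> U1 \<union> (\<lambda>b. t * n + b) ` U2"
      proof (cases "v < t * n")
        case False
        then have "v = t * n + (v - t * n)" by simp
        then show ?thesis using v by (auto simp: U2_def)
      qed (use v in \<open>simp add: U1_def\<close>)
    qed
    then have "card U \<le> card (U1 \<union> (\<lambda>b. t * n + b) ` U2)"
      using finU1 fin2 by (intro card_mono) auto
    also have "\<dots> \<le> card U1 + card ((\<lambda>b. t * n + b) ` U2)" by (rule card_Un_le)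
    also have "\<dots> \<le> t * card Y + card U2" using cU1 fin2 by (intro add_mono card_image_le) auto
    finally have "real (card U) \<le> real (t * card Y + card U2)" by (rule of_nat_mono)
    also have "\<dots> = real t * real (card Y) + real (card U2)" by simp
    also have "\<dots> \<le> real t * (\<epsilon> * real n) + \<epsilon> * real s"
      using Y U2 by (intro add_mono mult_left_mono) auto
    finally show "real (card U) \<le> \<epsilon> * real (t * n + s)" by (simp add: algebra_simps)
  qed (use p in \<open>auto simp: V_def\<close>)
  moreover have "t\<^sup>2 * card E \<le> card E'"
  proof -
    \<comment> \<open>Ordering the endpoints lists each edge once, so that its
      \<open>t\<^sup>2\<close> copies, indexed by pairs \<open>(a, b)\<close>, are pairwise
      different.\<close>
    define P where "P = {(x, y). x < y \<and> {x, y} \<in> E}"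
    have En: "x < n" "y < n" if "{x, y} \<in> E" for x y
      using G that by (auto simp: rt_graph_def sgraph_def)
    have PE: "E \<subseteq> (\<lambda>(x, y). {x, y}) ` P"
    proof
      fix e assume e: "e \<in> E"
      then have "card e = 2" using G by (auto simp: rt_graph_def sgraph_def)
      then obtain x y where xy: "e = {x, y}" "x \<noteq> y" by (auto simp: card_2_iff)
      then have "e = {min x y, max x y}" "min x y < max x y" by (auto simp: min_def max_def)
      then show "e \<in> (\<lambda>(x, y). {x, y}) ` P"
        using e by (intro image_eqI[of _ _ "(min x y, max x y)"]) (simp_all add: P_def)
    qed
    have "P \<subseteq> {..<n} \<times> {..<n}" using En by (auto simp: P_def)
    then have finP: "finite P" by (rule finite_subset) simp
    have "card E \<le> card P"
      using card_mono[OF finite_imageI[OF finP] PE] card_image_le[OF finP] order.trans by blast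
    then have "t\<^sup>2 * card E \<le> t\<^sup>2 * card P" by (rule mult_le_mono2)
    also have "\<dots> = card (P \<times> {..<t} \<times> {..<t})"
      by (simp add: card_cartesian_product power2_eq_square)
    also have "\<dots> \<le> card E'"
    proof (rule card_inj_on_le)
      let ?f = "\<lambda>((x, y), a, b). {x + n * a, y + n * b}"
      have less: "x + n * a < t * n" if "x < n" "a < t" for x a
      proof -
        have "x + n * a < n * (a + 1)" using that by simp
        also have "\<dots> \<le> n * t" using that by (intro mult_le_mono2) simp
        finally show ?thesis by (simp add: mult.commute)
      qed
      have dest: "x = x' \<and> a = a'" if "x + n * a = x' + n * a'" "x < n" "x' < n" for x x' a a'
      proof -
        have "(x + n * a) mod n = x" "(x' + n * a') mod n = x'" using that(2,3) by simp_all
        then have "x = x'" using that(1) by simp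
        then show ?thesis using that(1) n by simp
      qed
      show "inj_on ?f (P \<times> {..<t} \<times> {..<t})"
      proof (rule inj_onI)
        fix u v assume u: "u \<in> P \<times> {..<t} \<times> {..<t}" and v: "v \<in> P \<times> {..<t} \<times> {..<t}"
          and eq: "?f u = ?f v"
        obtain x y a b where u': "u = ((x, y), a, b)" "x < y" "x < n" "y < n"
          using u En by (auto simp: P_def)
        obtain x' y' a' b' where v': "v = ((x', y'), a', b')" "x' < y'" "x' < n" "y' < n"
          using v En by (auto simp: P_def)
        have "(x + n * a = x' + n * a' \<and> y + n * b = y' + n * b')
            \<or> (x + n * a = y' + n * b' \<and> y + n * b = x' + n * a')"
          using eq u'(1) v'(1) by (simp add: doubleton_eq_iff)
        then show "u = v"
        proof
          assume "x + n * a = x' + n * a' \<and> y + n * b = y' + n * b'"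
          then show ?thesis using dest u' v' by blast
        next
          assume "x + n * a = y' + n * b' \<and> y + n * b = x' + n * a'"
          then have "x = y'" "y = x'" using dest u' v' by blast+
          then show ?thesis using u' v' by simp
        qed
      qed
      show "?f ` (P \<times> {..<t} \<times> {..<t}) \<subseteq> E'"
      proof
        fix e assume "e \<in> ?f ` (P \<times> {..<t} \<times> {..<t})"
        then obtain x y a b where e: "e = {x + n * a, y + n * b}" "{x, y} \<in> E" "a < t" "b < t"
          by (auto simp: P_def)
        then have "\<phi> (x + n * a) = Inl x" "\<phi> (y + n * b) = Inl y" "x + n * a \<in> V" "y + n * b \<in> V"
          using less[of x a] less[of y b] En[OF e(2)] by (auto simp: \<phi>_def V_def)
        then show "e \<in> E'" unfolding E'_def e(1) pull_edges_iff[OF symp irr] using e(2) by simp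
      qed
      show "finite E'" unfolding E'_def pull_edges_def
        by (rule finite_subset[of _ "Pow V"]) (auto simp: V_def)
    qed
    finally show ?thesis .
  qed
  ultimately show ?thesis unfolding rt_graph_def V_def by blast
qed

text \<open>A quadratic analogue of Fekete's lemma: the limit is the supremum over large
  \<open>n\<close>. Given a nearly optimal \<open>n\<close>, a large \<open>N\<close> is written as
  \<open>t * n + s\<close> with \<open>s0 \<le> s < s0 + n\<close>; then \<open>t * n\<close> is
  almost \<open>N\<close>, and the ratio at \<open>N\<close> is almost that at
  \<open>n\<close>.\<close>

lemma quadratic_superadditive_limit:
  fixes F :: "nat \<Rightarrow> real"
  assumes nonneg: "\<And>n. 0 \<le> F n" and upper: "\<And>n. s0 \<le> n \<Longrightarrow> F n \<le> (real n)\<^sup>2"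
    and super: "\<And>n t s. s0 \<le> n \<Longrightarrow> 0 < n \<Longrightarrow> s0 \<le> s \<Longrightarrow> (real t)\<^sup>2 * F n \<le> F (t * n + s)"
  shows "convergent (\<lambda>n. F n / (real n)\<^sup>2)"
proof -
  define a where "a = (\<lambda>n. F n / (real n)\<^sup>2)"
  define A where "A = a ` {max s0 1..}"
  define c where "c = Sup A"
  have a01: "0 \<le> a n" "a n \<le> 1" if "n \<ge> max s0 1" for n
    using that nonneg[of n] upper[of n] by (simp_all add: a_def divide_le_eq)
  have bdd: "bdd_above A" using a01 by (auto simp: A_def intro!: bdd_aboveI[of _ 1])
  have le: "a n \<le> c" if "n \<ge> max s0 1" for n
    unfolding c_def using that bdd by (intro cSup_upper) (auto simp: A_def)
  have "a \<longlonglongrightarrow> c"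
  proof (rule LIMSEQ_I)
    fix e :: real assume e: "e > 0"
    have "\<exists>x\<in>A. c - e / 2 < x" unfolding c_def
      using e by (intro less_cSupD) (auto simp: A_def)
    then obtain n where n: "n \<ge> max s0 1" "c - e / 2 < a n" by (auto simp: A_def)
    have n0: "n > 0" "s0 \<le> n" using n by auto
    \<comment> \<open>The loss in passing from \<open>n\<close> to \<open>N\<close> is at most
      \<open>2 * d\<close> with \<open>d = (s0 + n) / N\<close>; this makes it less than
      \<open>e / 2\<close>, the other half being the distance of \<open>a n\<close> from the
      supremum.\<close>
    define N1 where "N1 = nat \<lceil>4 * (real s0 + real n) / e\<rceil> + s0 + n + 1"
    have "norm (a N - c) < e" if N: "N \<ge> N1" for N
    proof -
      have Nn: "N \<ge> s0 + n" "N \<ge> max s0 1" "N > 0" using N by (auto simp: N1_def)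
      have "4 * (real s0 + real n) / e < real N" using N unfolding N1_def by linarith
      then have "4 * (real s0 + real n) < real N * e" using e by (simp add: divide_less_eq)
      then have small: "2 * ((real s0 + real n) / real N) < e / 2" using Nn by (simp add: divide_less_eq mult.commute)
      define t where "t = (N - s0) div n"
      define s where "s = N - t * n"
      have tn: "t * n \<le> N - s0" "N - s0 < (t + 1) * n"
        using dividend_less_div_times[OF n0(1), of "N - s0"] by (simp_all add: t_def)
      then have s: "s0 \<le> s" "N = t * n + s" using Nn by (auto simp: s_def)
      define d where "d = (real s0 + real n) / real N"
      have d: "0 \<le> d" "d \<le> 1" using Nn by (auto simp: d_def divide_le_eq simp flip: of_nat_add)
      have "real N - real s0 - real n \<le> real t * real n"
      proof -
        have "N \<le> t * n + n + s0" using tn(2) Nn by simp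
        then have "real N \<le> real (t * n + n + s0)" by (simp only: of_nat_le_iff)
        then show ?thesis by simp
      qed
      moreover have "(1 - d) * real N = real N - real s0 - real n"
        using Nn by (simp add: d_def left_diff_distrib)
      ultimately have "(1 - d) * real N \<le> real t * real n" by simp
      then have dt: "1 - d \<le> real t * real n / real N" using Nn by (simp add: le_divide_eq)
      have "a n - e / 2 \<le> a n - 2 * d" using small by (simp add: d_def)
      also have "\<dots> \<le> a n - 2 * d * a n" using a01[OF n(1)] d by (simp add: mult_left_le)
      also have "\<dots> \<le> (1 - d)\<^sup>2 * a n"
      proof -
        have "(1 - d)\<^sup>2 * a n = a n - 2 * d * a n + d\<^sup>2 * a n" by (simp add: power2_eq_square algebra_simps)
        moreover have "0 \<le> d\<^sup>2 * a n" using a01[OF n(1)] by simp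
        ultimately show ?thesis by linarith
      qed
      also have "\<dots> \<le> (real t * real n / real N)\<^sup>2 * a n"
        using dt d a01[OF n(1)] by (intro mult_right_mono power_mono) auto
      also have "\<dots> = (real t)\<^sup>2 * F n / (real N)\<^sup>2"
        using n0 by (simp add: a_def power_divide power_mult_distrib)
      also have "\<dots> \<le> a N" unfolding a_def using super[OF n0(2,1) s(1), of t] s(2)
        by (intro divide_right_mono) auto
      finally have "c - e < a N" using n(2) by linarith
      then show ?thesis using le[OF Nn(2)] e by (auto simp: abs_if)
    qed
    then show "\<exists>no. \<forall>N\<ge>no. norm (a N - c) < e" by blast
  qed
  then show ?thesis unfolding a_def convergent_def by blast
qed

lemma real_choose_two: "real (n choose 2) = real n * (real n - 1) / 2"
  by (induction n) (simp_all add: numeral_2_eq_2 field_simps)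

text \<open>Blow-ups are superadditive relative to the square of the order, so convergence is shown
  with denominator \<open>n\<^sup>2\<close> and transferred, the quotient of the two denominators
  tending to 2.\<close>

lemma convergent_ramsey_turan_ratio:
  assumes ex: "\<And>s. s \<ge> s0 \<Longrightarrow> \<exists>E. rt_graph p s q (\<epsilon> * real s) E" and p: "0 < p"
  shows "convergent (\<lambda>n. real (ramsey_turan p n q (\<epsilon> * real n)) / real (n choose 2))"
proof -
  define F where "F = (\<lambda>n. real (ramsey_turan p n q (\<epsilon> * real n)))"
  have "convergent (\<lambda>n. F n / (real n)\<^sup>2)"
  proof (rule quadratic_superadditive_limit)
    show "0 \<le> F n" for n by (simp add: F_def)
    show "F n \<le> (real n)\<^sup>2" if n: "s0 \<le> n" for n
    proof -
      obtain E where E: "rt_graph p n q (\<epsilon> * real n) E" "card E = ramsey_turan p n q (\<epsilon> * real n)"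
        using ex[OF n] ramsey_turan_attained by metis
      have "F n \<le> real (n choose 2)"
        using card_sgraph_le[of "{..<n}" E] E by (simp add: F_def rt_graph_def)
      also have "\<dots> \<le> (real n)\<^sup>2" unfolding real_choose_two by (simp add: power2_eq_square algebra_simps)
      finally show ?thesis .
    qed
    show "(real t)\<^sup>2 * F n \<le> F (t * n + s)" if n: "s0 \<le> n" "0 < n" and s: "s0 \<le> s" for n t s
    proof -
      obtain E where E: "rt_graph p n q (\<epsilon> * real n) E" "card E = ramsey_turan p n q (\<epsilon> * real n)"
        using ex[OF n(1)] ramsey_turan_attained by metis
      obtain H where H: "rt_graph p s q (\<epsilon> * real s) H" using ex[OF s] by blast
      obtain E' where E': "rt_graph p (t * n + s) q (\<epsilon> * real (t * n + s)) E'" "t\<^sup>2 * card E \<le> card E'"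
        using rt_graph_blowup_union[OF E(1) H p n(2)] by blast
      have "t\<^sup>2 * card E \<le> ramsey_turan p (t * n + s) q (\<epsilon> * real (t * n + s))"
        using E'(2) card_le_ramsey_turan[OF E'(1)] by (rule order.trans)
      then have "real (t\<^sup>2 * card E) \<le> F (t * n + s)" unfolding F_def by (rule of_nat_mono)
      then show ?thesis by (simp add: F_def E(2))
    qed
  qed
  then obtain c where c: "(\<lambda>n. F n / (real n)\<^sup>2) \<longlonglongrightarrow> c" by (auto simp: convergent_def)
  have "(\<lambda>n. 2 / (1 - 1 / real n)) \<longlonglongrightarrow> 2 / (1 - 0)"
    by (intro tendsto_intros lim_1_over_n) auto
  then have "(\<lambda>n. F n / (real n)\<^sup>2 * (2 / (1 - 1 / real n))) \<longlonglongrightarrow> c * (2 / (1 - 0))"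
    using c by (intro tendsto_mult)
  moreover have "eventually (\<lambda>n. F n / (real n)\<^sup>2 * (2 / (1 - 1 / real n)) = F n / real (n choose 2)) sequentially"
    using eventually_ge_at_top[of 2]
    by eventually_elim (simp add: real_choose_two power2_eq_square field_simps)
  ultimately have "(\<lambda>n. F n / real (n choose 2)) \<longlonglongrightarrow> c * (2 / (1 - 0))"
    by (rule Lim_transform_eventually)
  then show ?thesis unfolding F_def convergent_def by blast
qed

text \<open>Odd orders are reached by deleting a vertex. The bound \<open>\<epsilon> * n\<close>
  with \<open>n\<close> half the order leaves enough room for this.\<close>

lemma rt_graph_exists:
  assumes l: "0 < l" "l < p" "2 * l \<le> p" and eps: "\<epsilon> > 0"
  shows "\<exists>s0. \<forall>s\<ge>s0. \<exists>E. rt_graph p s (p + l + 1) (\<epsilon> * real s) E"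
proof -
  obtain n0 where n0: "\<And>n. n \<ge> n0 \<Longrightarrow> \<exists>E. sgraph {..<2 * n} E \<and>
      real (p_independence_number p {..<2 * n} E) \<le> \<epsilon> * real n \<and> K_free (p + l + 1) {..<2 * n} E"
    using two_sided_graph[OF l(1,2) eps] l(3) by meson
  have "\<exists>E. rt_graph p s (p + l + 1) (\<epsilon> * real s) E" if s: "s \<ge> 2 * n0 + 1" for s
  proof -
    define n where "n = (s + 1) div 2"
    have n: "n \<ge> n0" "s \<le> 2 * n" "n \<le> s" using s by (auto simp: n_def)
    obtain E where "sgraph {..<2 * n} E" "real (p_independence_number p {..<2 * n} E) \<le> \<epsilon> * real n"
      "K_free (p + l + 1) {..<2 * n} E" using n0[OF n(1)] by blast
    then have "rt_graph p (2 * n) (p + l + 1) (\<epsilon> * real n) E" by (simp add: rt_graph_def)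
    then have "rt_graph p s (p + l + 1) (\<epsilon> * real n) (induced_edges E {..<s})"
      using l n(2) by (intro rt_graph_restrict[of p "2 * n"]) auto
    then have "rt_graph p s (p + l + 1) (\<epsilon> * real s) (induced_edges E {..<s})"
      using n(3) eps by (elim rt_graph_mono) simp
    then show ?thesis by blast
  qed
  then show ?thesis by blast
qed

lemma tendsto_Inf_at_right:
  fixes D :: "real \<Rightarrow> real"
  assumes mono: "\<And>x y. a < x \<Longrightarrow> x \<le> y \<Longrightarrow> D x \<le> D y" and bdd: "\<And>x. a < x \<Longrightarrow> b \<le> D x"
  shows "(D \<longlongrightarrow> Inf (D ` {a<..})) (at_right a)"
proof (rule order_tendstoI)
  have below: "bdd_below (D ` {a<..})" using bdd by (auto intro!: bdd_belowI[of _ b])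
  fix y
  {
    assume "y < Inf (D ` {a<..})"
    then have "y < D x" if "a < x" for x
      using cInf_lower[of "D x" "D ` {a<..}"] below that by fastforce
    then show "eventually (\<lambda>x. y < D x) (at_right a)" by (auto simp: eventually_at_right_field gt_ex)
  next
    assume "Inf (D ` {a<..}) < y"
    moreover have "D ` {a<..} \<noteq> {}" using gt_ex[of a] by auto
    ultimately obtain x0 where x0: "a < x0" "D x0 < y" using cInf_lessD by (metis greaterThan_iff imageE)
    have "D x < y" if "a < x" "x < x0" for x using mono[of x x0] x0 that by simp
    then show "eventually (\<lambda>x. D x < y) (at_right a)"
      using x0(1) by (auto simp: eventually_at_right_field)
  }
qed

text \<open>A larger \<epsilon> admits more graphs, so the inner limit is monotone and the outer one
  is an infimum. It remains to bound the inner limit for each \<epsilon>; since it exists, even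
  orders suffice, and so do the edges between the two sides.\<close>

lemma ramsey_turan_density_ge:
  assumes l: "0 < l" "l < p" "2 * l \<le> p"
  shows "real l / (2 * real p) \<le> ramsey_turan_density p (p + l + 1)"
proof -
  define q where "q = p + l + 1"
  define r where "r = (\<lambda>\<epsilon> n. real (ramsey_turan p n q (\<epsilon> * real n)) / real (n choose 2))"
  define D where "D = (\<lambda>\<epsilon>. lim (r \<epsilon>))"
  have conv: "r \<epsilon> \<longlonglongrightarrow> D \<epsilon>" if eps: "\<epsilon> > 0" for \<epsilon>
  proof -
    obtain s0 where "\<And>s. s \<ge> s0 \<Longrightarrow> \<exists>E. rt_graph p s q (\<epsilon> * real s) E"
      using rt_graph_exists[OF l eps] unfolding q_def by blast
    then have "convergent (r \<epsilon>)"
      unfolding r_def by (rule convergent_ramsey_turan_ratio) (use l in auto)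
    then show ?thesis unfolding D_def by (simp add: convergent_LIMSEQ_iff)
  qed
  have mono: "D x \<le> D y" if xy: "0 < x" "x \<le> y" for x y
  proof (rule LIMSEQ_le[OF conv conv])
    obtain s0 where s0: "\<And>s. s \<ge> s0 \<Longrightarrow> \<exists>E. rt_graph p s q (x * real s) E"
      using rt_graph_exists[OF l xy(1)] unfolding q_def by blast
    have "r x n \<le> r y n" if n: "n \<ge> s0" for n
    proof -
      obtain E where E: "rt_graph p n q (x * real n) E" "card E = ramsey_turan p n q (x * real n)"
        using s0[OF n] ramsey_turan_attained by metis
      have "rt_graph p n q (y * real n) E"
        using E(1) xy by (elim rt_graph_mono) (simp add: mult_right_mono)
      then show ?thesis
        using card_le_ramsey_turan[of p n q "y * real n" E] E(2) by (simp add: r_def divide_right_mono)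
    qed
    then show "\<exists>N. \<forall>n\<ge>N. r x n \<le> r y n" by blast
  qed (use xy in auto)
  have lower: "real l / (2 * real p) \<le> D \<epsilon>" if eps: "\<epsilon> > 0" for \<epsilon>
  proof (rule field_le_epsilon)
    fix e :: real assume e: "e > 0"
    \<comment> \<open>The order is \<open>2 * n\<close>, so
      \<open>\<eta> * n \<le> \<epsilon> * (2 * n)\<close> is allowed; and
      \<open>2 * n choose 2\<close> is at most \<open>2 * n\<^sup>2\<close>, so an error of
      \<open>2 * e * n\<^sup>2\<close> edges costs \<open>e\<close> in the bound.\<close>
    define \<eta> where "\<eta> = min (2 * \<epsilon>) (2 * e)"
    have eta: "\<eta> > 0" "\<eta> \<le> 2 * \<epsilon>" "\<eta> \<le> 2 * e" using e eps by (auto simp: \<eta>_def)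
    obtain n0 where n0: "\<And>n. n \<ge> n0 \<Longrightarrow> \<exists>E. sgraph {..<2 * n} E \<and>
        real (p_independence_number p {..<2 * n} E) \<le> \<eta> * real n \<and>
        \<bar>real (card (edges_between E {..<n} {n..<2 * n})) - real l / real p * (real n)\<^sup>2\<bar> \<le> \<eta> * (real n)\<^sup>2 \<and>
        K_free q {..<2 * n} E"
      using two_sided_graph[OF l(1,2) eta(1)] l(3) unfolding q_def by meson
    have "real l / (2 * real p) - e \<le> r \<epsilon> (2 * n)" if n: "n \<ge> max n0 1" for n
    proof -
      obtain E where E: "sgraph {..<2 * n} E" "real (p_independence_number p {..<2 * n} E) \<le> \<eta> * real n"
        "\<bar>real (card (edges_between E {..<n} {n..<2 * n})) - real l / real p * (real n)\<^sup>2\<bar> \<le> \<eta> * (real n)\<^sup>2"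
        "K_free q {..<2 * n} E" using n0[of n] n by auto
      have "\<eta> * real n \<le> \<epsilon> * real (2 * n)" using mult_right_mono[OF eta(2), of "real n"] by simp
      then have "rt_graph p (2 * n) q (\<epsilon> * real (2 * n)) E" using E by (simp add: rt_graph_def)
      then have "card E \<le> ramsey_turan p (2 * n) q (\<epsilon> * real (2 * n))" by (rule card_le_ramsey_turan)
      moreover have "finite E" using sgraph_subset_Pow[OF E(1)] by (rule finite_subset) simp
      then have "card (edges_between E {..<n} {n..<2 * n}) \<le> card E"
        by (intro card_mono) (auto simp: edges_between_def)
      ultimately have "real (card (edges_between E {..<n} {n..<2 * n})) \<le> real (ramsey_turan p (2 * n) q (\<epsilon> * real (2 * n)))"
        by simp
      moreover have "\<eta> * (real n)\<^sup>2 \<le> 2 * e * (real n)\<^sup>2" using eta by (intro mult_right_mono) auto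
      ultimately have "real l / real p * (real n)\<^sup>2 - 2 * e * (real n)\<^sup>2
          \<le> real (ramsey_turan p (2 * n) q (\<epsilon> * real (2 * n)))"
        using E(3) by linarith
      then have "(real l / (2 * real p) - e) * (2 * (real n)\<^sup>2) \<le> real (ramsey_turan p (2 * n) q (\<epsilon> * real (2 * n)))"
        by (simp add: algebra_simps)
      then have "real l / (2 * real p) - e \<le> real (ramsey_turan p (2 * n) q (\<epsilon> * real (2 * n))) / (2 * (real n)\<^sup>2)"
        using n by (simp add: le_divide_eq)
      also have "\<dots> \<le> r \<epsilon> (2 * n)"
        unfolding r_def real_choose_two using n
        by (intro divide_left_mono) (auto simp: power2_eq_square algebra_simps)
      finally show ?thesis .
    qed
    moreover have "(\<lambda>n. r \<epsilon> (2 * n)) \<longlonglongrightarrow> D \<epsilon>"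
      using LIMSEQ_subseq_LIMSEQ[OF conv[OF eps], of "\<lambda>n. 2 * n"] by (simp add: strict_mono_def o_def)
    moreover have "\<exists>N. \<forall>n\<ge>N. real l / (2 * real p) - e \<le> r \<epsilon> (2 * n)"
      using calculation(1) by (intro exI[of _ "max n0 1"]) simp
    ultimately have "real l / (2 * real p) - e \<le> D \<epsilon>"
      by (intro LIMSEQ_le_const)
    then show "real l / (2 * real p) \<le> D \<epsilon> + e" by simp
  qed
  have "(D \<longlongrightarrow> Inf (D ` {0<..})) (at_right 0)"
    by (rule tendsto_Inf_at_right[OF mono lower]) auto
  then have "Lim (at_right 0) D = Inf (D ` {0<..})"
    by (intro tendsto_Lim) (simp add: trivial_limit_at_right_real)
  then have "ramsey_turan_density p q = Inf (D ` {0<..})"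
    by (simp add: ramsey_turan_density_def D_def r_def)
  moreover have "real l / (2 * real p) \<le> Inf (D ` {0<..})"
    using lower gt_ex[of "0::real"] by (intro cInf_greatest) auto
  ultimately show ?thesis by (simp add: q_def)
qed

theorem theorem1p1:
  fixes p l :: nat
  assumes "1 \<le> l" and "l < p"
  shows "(\<forall>\<epsilon>::real. \<epsilon> > 0 \<longrightarrow> (\<exists>n0::nat. \<forall>n\<ge>n0.
            \<exists>(W :: nat set) (Z :: nat set) (E :: nat set set).
              sgraph (W \<union> Z) E \<and> W \<inter> Z = {} \<and> card W = n \<and> card Z = n \<and>
              real (p_independence_number p (W \<union> Z) E) \<le> \<epsilon> * real n \<and>
              real (card (induced_edges E W)) \<le> \<epsilon> * (real n)\<^sup>2 \<and>
              real (card (induced_edges E Z)) \<le> \<epsilon> * (real n)\<^sup>2 \<and>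
              \<bar>real (card (edges_between E W Z)) - real l / real p * (real n)\<^sup>2\<bar>
                \<le> \<epsilon> * (real n)\<^sup>2 \<and>
              (real l \<le> real p / 2 \<longrightarrow> K_free (p + l + 1) (W \<union> Z) E))) \<and>
         (real l \<le> real p / 2 \<longrightarrow>
            ramsey_turan_density p (p + l + 1) \<ge> real l / (2 * real p))"
proof (intro conjI allI impI)
  fix \<epsilon> :: real assume "\<epsilon> > 0"
  then obtain n0 where n0: "\<And>n. n \<ge> n0 \<Longrightarrow> \<exists>E. sgraph {..<2 * n} E \<and>
    real (p_independence_number p {..<2 * n} E) \<le> \<epsilon> * real n \<and>
    real (card (induced_edges E {..<n})) \<le> \<epsilon> * (real n)\<^sup>2 \<and>
    real (card (induced_edges E {n..<2 * n})) \<le> \<epsilon> * (real n)\<^sup>2 \<and>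
    \<bar>real (card (edges_between E {..<n} {n..<2 * n})) - real l / real p * (real n)\<^sup>2\<bar> \<le> \<epsilon> * (real n)\<^sup>2 \<and>
    (2 * l \<le> p \<longrightarrow> K_free (p + l + 1) {..<2 * n} E)"
    using two_sided_graph[of l p \<epsilon>] assms by auto
  have half: "real l \<le> real p / 2 \<longleftrightarrow> 2 * l \<le> p" by linarith
  have un: "{..<n} \<union> {n..<2 * n} = {..<2 * n}" for n :: nat by auto
  show "\<exists>n0::nat. \<forall>n\<ge>n0. \<exists>(W :: nat set) (Z :: nat set) (E :: nat set set).
      sgraph (W \<union> Z) E \<and> W \<inter> Z = {} \<and> card W = n \<and> card Z = n \<and>
      real (p_independence_number p (W \<union> Z) E) \<le> \<epsilon> * real n \<and>
      real (card (induced_edges E W)) \<le> \<epsilon> * (real n)\<^sup>2 \<and>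
      real (card (induced_edges E Z)) \<le> \<epsilon> * (real n)\<^sup>2 \<and>
      \<bar>real (card (edges_between E W Z)) - real l / real p * (real n)\<^sup>2\<bar> \<le> \<epsilon> * (real n)\<^sup>2 \<and>
      (real l \<le> real p / 2 \<longrightarrow> K_free (p + l + 1) (W \<union> Z) E)"
  proof (intro exI[of _ n0] allI impI)
    fix n assume "n \<ge> n0"
    then obtain E where "sgraph {..<2 * n} E \<and>
      real (p_independence_number p {..<2 * n} E) \<le> \<epsilon> * real n \<and>
      real (card (induced_edges E {..<n})) \<le> \<epsilon> * (real n)\<^sup>2 \<and>
      real (card (induced_edges E {n..<2 * n})) \<le> \<epsilon> * (real n)\<^sup>2 \<and>
      \<bar>real (card (edges_between E {..<n} {n..<2 * n})) - real l / real p * (real n)\<^sup>2\<bar> \<le> \<epsilon> * (real n)\<^sup>2 \<and>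
      (2 * l \<le> p \<longrightarrow> K_free (p + l + 1) {..<2 * n} E)"
      using n0 by blast
    then show "\<exists>(W :: nat set) (Z :: nat set) (E :: nat set set).
      sgraph (W \<union> Z) E \<and> W \<inter> Z = {} \<and> card W = n \<and> card Z = n \<and>
      real (p_independence_number p (W \<union> Z) E) \<le> \<epsilon> * real n \<and>
      real (card (induced_edges E W)) \<le> \<epsilon> * (real n)\<^sup>2 \<and>
      real (card (induced_edges E Z)) \<le> \<epsilon> * (real n)\<^sup>2 \<and>
      \<bar>real (card (edges_between E W Z)) - real l / real p * (real n)\<^sup>2\<bar> \<le> \<epsilon> * (real n)\<^sup>2 \<and>
      (real l \<le> real p / 2 \<longrightarrow> K_free (p + l + 1) (W \<union> Z) E)"
      by (intro exI[of _ "{..<n}"] exI[of _ "{n..<2 * n}"] exI[of _ E]) (auto simp: un half)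
  qed
next
  assume "real l \<le> real p / 2"
  then have "2 * l \<le> p" by linarith
  then show "ramsey_turan_density p (p + l + 1) \<ge> real l / (2 * real p)"
    using ramsey_turan_density_ge assms by simp
qed

end
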